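(* Suppose $V\in L^1((0,\infty);dx)$ (complex-valued) and let $z\in\mathbb{C}$ with $\operatorname{Im}(z^{1/2})>0$. Let $K(z)$ be the (trace class) operator in $L^2((0,\infty);dx)$ and $\mathcal{F}(z)$ the Jost function defined in the context. Then $$\det(I-K(z))=\mathcal{F}(z).$$
   Context: Factor $V=uv$ with $v(x)=|V(x)|^{1/2}$, $u(x)=|V(x)|^{1/2}\exp(i\arg(V(x)))$. Let $H^{(0)}_+=-d^2/dx^2$ be the Dirichlet Laplacian in $L^2((0,\infty);dx)$ (boundary condition $g(0_+)=0$), with Green's function $$G^{(0)}_+(z,x,x')=\begin{cases} z^{-1/2}\sin(z^{1/2}x)e^{iz^{1/2}x'},&x\le x',\\ z^{-1/2}\sin(z^{1/2}x')e^{iz^{1/2}x},&x\ge x'.\end{cases}$$ $K(z)=-\overline{u(H^{(0)}_+-z)^{-1}v}$ (closure), i.e., the integral operator in $L^2((0,\infty);dx)$ with kernel $K(z,x,x')=-u(x)G^{(0)}_+(z,x,x')v(x')$; it is a trace class operator for $\operatorname{Im}(z^{1/2})>0$, and $\det(I-K(z))$ is its Fredholm determinant. The Jost solution $f(z,\cdot)$ of $-\psi''+V\psi=z\psi$ on $(0,\infty)$ is the solution (with $e^{-iz^{1/2}x}f(z,x)$ bounded on $[0,\infty)$) of $$f(z,x)=e^{iz^{1/2}x}-\int_x^\infty dx'\,z^{-1/2}\sin(z^{1/2}(x-x'))V(x')f(z,x'),\quad x\ge0,$$ and the regular solution $\phi(z,\cdot)$ is the solution of $$\phi(z,x)=z^{-1/2}\sin(z^{1/2}x)+\int_0^x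 dx'\,z^{-1/2}\sin(z^{1/2}(x-x'))V(x')\phi(z,x').$$ The Jost function is $\mathcal{F}(z)=W(f(z),\phi(z))=f(z,0)$, where $W(f,g)(x)=f(x)g'(x)-f'(x)g(x)$. *)

theory Defs
  imports "HOL-Analysis.Analysis" "HOL-Combinatorics.Permutations"
begin

text \<open>The branch of the square root with nonnegative imaginary part, so that
  \<open>Im (zsqrt z) > 0\<close> holds exactly on the complement of \<open>[0, \<infinity>)\<close>. The principal
  branch \<^const>\<open>csqrt\<close> has the wrong sign in the open lower half-plane.\<close>

definition zsqrt :: "complex \<Rightarrow> complex" where
  "zsqrt z = (if Im (csqrt z) \<ge> 0 then csqrt z else - csqrt z)"

text \<open>Elements of the Hilbert space are represented by functions, equality being
  equality almost everywhere. Operators act on representatives.\<close>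

abbreviation half_line :: "real measure" where
  "half_line \<equiv> lebesgue_on {0<..}"

definition L2 :: "(real \<Rightarrow> complex) set" where
  "L2 = {h \<in> borel_measurable half_line. integrable half_line (\<lambda>x. (cmod (h x))\<^sup>2)}"

definition L2_inner :: "(real \<Rightarrow> complex) \<Rightarrow> (real \<Rightarrow> complex) \<Rightarrow> complex" where
  "L2_inner g h = (LINT x|half_line. g x * cnj (h x))"

definition L2_norm :: "(real \<Rightarrow> complex) \<Rightarrow> real" where
  "L2_norm h = sqrt (LINT x|half_line. (cmod (h x))\<^sup>2)"

definition orthonormal_basis :: "(nat \<Rightarrow> real \<Rightarrow> complex) \<Rightarrow> bool" where
  "orthonormal_basis e \<longleftrightarrow>
     (\<forall>i. e i \<in> L2) \<and>
     (\<forall>i j. L2_inner (e i) (e j) = (if i = j then 1 else 0)) \<and>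
     (\<forall>h\<in>L2. (\<forall>i. L2_inner h (e i) = 0) \<longrightarrow> (AE x in half_line. h x = 0))"

text \<open>Trace class operators as the nuclear operators
  \<open>T = (\<Sum>j. \<langle>\<cdot>, g j\<rangle> f j)\<close> with \<open>(\<Sum>j. \<parallel>f j\<parallel> \<parallel>g j\<parallel>) < \<infinity>\<close>. Linearity, boundedness and
  compatibility with equality almost everywhere follow from the expansion.\<close>

definition trace_class :: "((real \<Rightarrow> complex) \<Rightarrow> real \<Rightarrow> complex) \<Rightarrow> bool" where
  "trace_class T \<longleftrightarrow>
     (\<forall>h\<in>L2. T h \<in> L2) \<and>
     (\<exists>f g. (\<forall>j::nat. f j \<in> L2 \<and> g j \<in> L2) \<and>
            summable (\<lambda>j. L2_norm (f j) * L2_norm (g j)) \<and>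
            (\<forall>h\<in>L2. (\<lambda>n. L2_norm (\<lambda>x. T h x - (\<Sum>j<n. L2_inner h (g j) * f j x)))
                      \<longlonglongrightarrow> 0))"

definition det_on :: "nat set \<Rightarrow> (nat \<Rightarrow> nat \<Rightarrow> complex) \<Rightarrow> complex" where
  "det_on S m = (\<Sum>p | p permutes S. of_int (sign p) * (\<Prod>i\<in>S. m i (p i)))"

text \<open>The trace of the \<open>k\<close>-th exterior power of \<open>T\<close>. If \<open>e\<close> is an orthonormal basis,
  the vectors \<open>e\<^sub>S = e i\<^sub>1 \<and> \<dots> \<and> e i\<^sub>k\<close>, with \<open>S = {i\<^sub>1 < \<dots> < i\<^sub>k}\<close>, form an orthonormal basis
  of the exterior power, and the diagonal matrix element at \<open>e\<^sub>S\<close> is the principal minor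
  \<open>det (\<langle>T (e j), e i\<rangle>)\<close> with \<open>i, j \<in> S\<close>. For trace class \<open>T\<close> the sum converges absolutely
  and does not depend on the basis.\<close>

definition ext_power_trace :: "((real \<Rightarrow> complex) \<Rightarrow> real \<Rightarrow> complex) \<Rightarrow> nat \<Rightarrow> complex" where
  "ext_power_trace T k =
     (THE t. \<forall>e. orthonormal_basis e \<longrightarrow>
        ((\<lambda>S. det_on S (\<lambda>i j. L2_inner (T (e j)) (e i))) has_sum t) {S. finite S \<and> card S = k})"

text \<open>The Fredholm determinant \<open>det (I - T)\<close> of a trace class operator \<open>T\<close>, as the
  alternating sum of the traces of its exterior powers.\<close>

definition fredholm_det :: "((real \<Rightarrow> complex) \<Rightarrow> real \<Rightarrow> complex) \<Rightarrow> complex" where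
  "fredholm_det T = (\<Sum>k. (- 1) ^ k * ext_power_trace T k)"

definition factor_v :: "(real \<Rightarrow> complex) \<Rightarrow> real \<Rightarrow> complex" where
  "factor_v V x = of_real (sqrt (cmod (V x)))"

definition factor_u :: "(real \<Rightarrow> complex) \<Rightarrow> real \<Rightarrow> complex" where
  "factor_u V x = of_real (sqrt (cmod (V x))) * exp (\<i> * of_real (Arg (V x)))"

definition green :: "complex \<Rightarrow> real \<Rightarrow> real \<Rightarrow> complex" where
  "green z x x' =
     (if x \<le> x' then sin (zsqrt z * of_real x) * exp (\<i> * zsqrt z * of_real x') / zsqrt z
      else sin (zsqrt z * of_real x') * exp (\<i> * zsqrt z * of_real x) / zsqrt z)"

definition K_kernel :: "(real \<Rightarrow> complex) \<Rightarrow> complex \<Rightarrow> real \<Rightarrow> real \<Rightarrow> complex" where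
  "K_kernel V z x x' = - factor_u V x * green z x x' * factor_v V x'"

text \<open>The closure of \<open>- u (H - z)\<inverse> v\<close>, which is the bounded integral operator with
  kernel \<open>K_kernel V z\<close>.\<close>

definition K_op :: "(real \<Rightarrow> complex) \<Rightarrow> complex \<Rightarrow> (real \<Rightarrow> complex) \<Rightarrow> real \<Rightarrow> complex" where
  "K_op V z h x = (LINT x'|half_line. K_kernel V z x x' * h x')"

text \<open>Integrability is demanded explicitly because the Bochner integral of a
  non-integrable function is \<open>0\<close> by convention. Only the values on \<open>[0, \<infinity>)\<close> matter.\<close>

definition jost_solution :: "(real \<Rightarrow> complex) \<Rightarrow> complex \<Rightarrow> (real \<Rightarrow> complex) \<Rightarrow> bool" where
  "jost_solution V z f \<longleftrightarrow>
     bounded ((\<lambda>x. exp (- (\<i> * zsqrt z * of_real x)) * f x) ` {0..}) \<and>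
     (\<forall>x\<ge>0.
        integrable (lebesgue_on {x<..})
          (\<lambda>x'. sin (zsqrt z * of_real (x - x')) / zsqrt z * V x' * f x') \<and>
        f x = exp (\<i> * zsqrt z * of_real x) -
          (LINT x'|lebesgue_on {x<..}.
             sin (zsqrt z * of_real (x - x')) / zsqrt z * V x' * f x'))"

definition regular_solution :: "(real \<Rightarrow> complex) \<Rightarrow> complex \<Rightarrow> (real \<Rightarrow> complex) \<Rightarrow> bool" where
  "regular_solution V z \<phi> \<longleftrightarrow>
     (\<forall>x\<ge>0.
        integrable (lebesgue_on {0<..<x})
          (\<lambda>x'. sin (zsqrt z * of_real (x - x')) / zsqrt z * V x' * \<phi> x') \<and>
        \<phi> x = sin (zsqrt z * of_real x) / zsqrt z +
          (LINT x'|lebesgue_on {0<..<x}.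
             sin (zsqrt z * of_real (x - x')) / zsqrt z * V x' * \<phi> x'))"

definition wronskian :: "(real \<Rightarrow> complex) \<Rightarrow> (real \<Rightarrow> complex) \<Rightarrow> real \<Rightarrow> complex" where
  "wronskian f g x =
     f x * vector_derivative g (at x within {0..}) -
     vector_derivative f (at x within {0..}) * g x"

text \<open>The Wronskian of the Jost and the regular solution is constant on \<open>[0, \<infinity>)\<close>. It is
  evaluated at \<open>0\<close>, where it equals the value at \<open>0\<close> of the Jost solution.\<close>

definition jost_function :: "(real \<Rightarrow> complex) \<Rightarrow> complex \<Rightarrow> complex" where
  "jost_function V z =
     (THE w. \<exists>f \<phi>. jost_solution V z f \<and> regular_solution V z \<phi> \<and> w = wronskian f \<phi> 0)"

end

theory Submission
  imports Defs
begin

text \<open>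
  With \<open>\<kappa> = zsqrt z\<close> and \<open>\<psi>(x) = exp (\<i> \<kappa> x)\<close>, the Green's function factors as
  \<open>\<integral> A(x, t) A(y, t) dt\<close> where \<open>A(x, t) = \<psi>(x) / \<psi>(t)\<close> for \<open>t < x\<close> and \<open>0\<close> otherwise. Expanding
  \<open>A(x, \<cdot>)\<close> in an orthonormal basis gives \<open>K(z) = \<Sum>j. \<langle>\<cdot>, g j\<rangle> f j\<close>, where the series for the kernel
  converges at every point. By Parseval and Fubini, \<open>k!\<close> times the sum of the principal \<open>k\<close>-minors in
  any orthonormal basis is \<open>\<Sum>l. det \<langle>f (l a), g (l b)\<rangle>\<close>; the same computation with \<open>L\<^sup>2(0, \<infinity>)\<close> in
  place of \<open>l\<^sup>2\<close> shows that this is also \<open>\<integral> det K(x a, x b) dx\<close>. Eliminating the smallest of the points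
  \<open>x a\<close> from the determinant replaces the Green's function of \<open>(s, \<infinity>)\<close> by that of \<open>(x a, \<infinity>)\<close>. Hence the
  integrals obey the recursion of the Picard iterates of the Volterra equation for
  \<open>exp (- \<i> \<kappa> x) f(z, x)\<close>, and their alternating sum is \<open>f(z, 0)\<close>.
\<close>

section \<open>Determinants over finite index sets\<close>

text \<open>The traces of exterior powers are specified by a definite description over all
  orthonormal bases, so a basis has to be produced and all bases have to give one value; with no
  basis at all the description would be vacuous. A second obstacle is that an operator fixes its
  kernel only almost everywhere, whereas \<integral> det K(x a, x b) dx uses K on the diagonal, a
  null set. Hence the factorization: its rows A(x, \<cdot>) are square integrable for every single
  x, and Parseval returns the value of the kernel at each pair of points, the diagonal included. The
  link to the Jost equation is that sin(\<kappa> r) exp(\<i> \<kappa> r) / \<kappa> is both the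
  value of the Green's function on the diagonal, hence the pivot of the elimination, and the kernel
  of the Volterra equation for exp(- \<i> \<kappa> x) f(z, x).\<close>

lemma det_on_cong:
  assumes "\<And>i j. i \<in> S \<Longrightarrow> j \<in> S \<Longrightarrow> M i j = N i j"
  shows "det_on S M = det_on S N"
  unfolding det_on_def
  by (intro sum.cong refl arg_cong2[where f = "(*)"] prod.cong) (use assms permutes_in_image in fastforce)

lemma det_on_row_combine:
  assumes "finite S" "r \<in> S"
  shows "det_on S (M(r := \<lambda>j. f j + c * g j)) = det_on S (M(r := f)) + c * det_on S (M(r := g))"
proof -
  have "(\<Prod>i\<in>S. (M(r := h)) i (p i)) = h (p r) * (\<Prod>i\<in>S - {r}. M i (p i))" for h p
    using assms by (subst prod.remove[of S r]) (auto intro!: prod.cong)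
  then show ?thesis
    unfolding det_on_def by (simp add: sum_distrib_left sum.distrib[symmetric] algebra_simps)
qed

text \<open>Composition with the transposition of \<open>a\<close> and \<open>b\<close> permutes the
  summands and flips every sign, while equality of the two rows keeps every product. The determinant
  is therefore its own negative.\<close>

lemma det_on_equal_rows:
  assumes S: "finite S" and ab: "a \<in> S" "b \<in> S" "a \<noteq> b"
    and eq: "\<And>j. j \<in> S \<Longrightarrow> M a j = M b j"
  shows "det_on S M = 0"
proof -
  let ?t = "Transposition.transpose a b"
  have t: "?t permutes S" using ab by (simp add: permutes_swap_id)
  have "det_on S M = (\<Sum>p | p permutes S. of_int (sign (p \<circ> ?t)) * (\<Prod>i\<in>S. M i ((p \<circ> ?t) i)))"
    unfolding det_on_def by (rule sum_permutations_compose_right[OF t])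
  also have "\<dots> = (\<Sum>p | p permutes S. - (of_int (sign p) * (\<Prod>i\<in>S. M i (p i))))"
  proof (rule sum.cong[OF refl], clarify)
    fix p assume p: "p permutes S"
    \<comment> \<open>Reindexing the product moves the transposition from the columns to the rows,
      where the equality of rows \<open>a\<close> and \<open>b\<close> absorbs it.\<close>
    have "(\<Prod>i\<in>S. M i ((p \<circ> ?t) i)) = (\<Prod>i\<in>S. M (?t i) ((p \<circ> ?t) (?t i)))"
      using prod.permute[OF t, of "\<lambda>i. M i ((p \<circ> ?t) i)"] by (simp only: o_def)
    also have "\<dots> = (\<Prod>i\<in>S. M i (p i))"
    proof (rule prod.cong[OF refl])
      fix i assume "i \<in> S"
      then have "M (?t i) (p i) = M i (p i)"
        using eq[of "p i"] permutes_in_image[OF p] by (cases "i = a \<or> i = b") auto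
      then show "M (?t i) ((p \<circ> ?t) (?t i)) = M i (p i)" by simp
    qed
    finally have 1: "(\<Prod>i\<in>S. M i ((p \<circ> ?t) i)) = (\<Prod>i\<in>S. M i (p i))" .
    have "sign (p \<circ> ?t) = - sign p"
      using ab S p by (subst sign_compose) (auto simp: sign_swap_id permutation_swap_id intro: permutes_imp_permutation)
    with 1 show "of_int (sign (p \<circ> ?t)) * (\<Prod>i\<in>S. M i ((p \<circ> ?t) i)) = - (of_int (sign p) * (\<Prod>i\<in>S. M i (p i)))"
      by simp
  qed
  also have "\<dots> = - det_on S M" by (simp add: det_on_def sum_negf)
  finally show ?thesis by simp
qed

lemma det_on_zero_row:
  assumes "finite S" "r \<in> S" "\<And>j. j \<in> S \<Longrightarrow> M r j = 0"
  shows "det_on S M = 0"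
proof -
  have "(\<Prod>i\<in>S. M i (p i)) = 0" if "p permutes S" for p
    using assms permutes_in_image[OF that] by (intro prod_zero) auto
  then show ?thesis by (simp add: det_on_def)
qed

lemma det_on_add_row:
  assumes "finite S" "r \<in> S" "m \<in> S" "r \<noteq> m"
  shows "det_on S (M(r := \<lambda>j. M r j + c * M m j)) = det_on S M"
proof -
  have "det_on S (M(r := M m)) = 0"
    using assms by (intro det_on_equal_rows[of S r m]) auto
  then show ?thesis
    using det_on_row_combine[OF assms(1,2), of M "M r" c "M m"] by simp
qed

text \<open>The pivot row \<open>m\<close> lies outside \<open>T\<close>, so it stays unchanged
  throughout the induction and every row operation uses the original row.\<close>

lemma det_on_add_rows:
  assumes "finite S" "m \<in> S" "finite T" "T \<subseteq> S - {m}"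
  shows "det_on S (\<lambda>i j. if i \<in> T then M i j + c i * M m j else M i j) = det_on S M"
  using assms(3,4)
proof (induction T rule: finite_induct)
  case (insert r T)
  let ?M = "\<lambda>i j. if i \<in> T then M i j + c i * M m j else M i j"
  have "(\<lambda>i j. if i \<in> insert r T then M i j + c i * M m j else M i j)
      = ?M(r := \<lambda>j. ?M r j + c r * ?M m j)"
    using insert by (auto simp: fun_eq_iff)
  then show ?case using insert det_on_add_row[of S r m ?M "c r"] assms by simp
qed simp

text \<open>A permutation of \<open>S\<close> that moves \<open>m\<close> takes some other row into
  column \<open>m\<close>, where the entry is zero. The surviving permutations are those of
  \<open>S - {m}\<close>.\<close>

lemma det_on_zero_column:
  assumes S: "finite S" "m \<in> S" and zero: "\<And>i. i \<in> S - {m} \<Longrightarrow> M i m = 0"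
  shows "det_on S M = M m m * det_on (S - {m}) M"
proof -
  let ?f = "\<lambda>p. of_int (sign p) * (\<Prod>i\<in>S. M i (p i))"
  have "det_on S M = (\<Sum>p | p permutes S - {m}. ?f p)"
    unfolding det_on_def
  proof (rule sum.mono_neutral_right)
    show "finite {p. p permutes S}" using S by (simp add: finite_permutations)
    show "{p. p permutes S - {m}} \<subseteq> {p. p permutes S}"
      by (auto intro: permutes_subset)
    show "\<forall>p\<in>{p. p permutes S} - {p. p permutes S - {m}}. ?f p = 0"
    proof
      fix p assume p: "p \<in> {p. p permutes S} - {p. p permutes S - {m}}"
      then have pS: "p permutes S" by simp
      have "p m \<noteq> m"
        using p permutes_superset[OF pS, of "S - {m}"] by auto
      moreover obtain i where i: "i \<in> S" "p i = m"
        using permutes_image[OF pS] S by (metis imageE)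
      ultimately have "i \<in> S - {m}" by auto
      then have "M i (p i) = 0" using zero i by simp
      then show "?f p = 0" using i S by (auto intro: prod_zero)
    qed
  qed
  also have "\<dots> = (\<Sum>p | p permutes S - {m}. M m m * (of_int (sign p) * (\<Prod>i\<in>S - {m}. M i (p i))))"
  proof (rule sum.cong[OF refl], clarify)
    fix p assume "p permutes S - {m}"
    then have "p m = m" by (auto simp: permutes_def)
    then show "?f p = M m m * (of_int (sign p) * (\<Prod>i\<in>S - {m}. M i (p i)))"
      using S by (subst prod.remove[of S m]) auto
  qed
  also have "\<dots> = M m m * det_on (S - {m}) M"
    by (simp add: det_on_def sum_distrib_left)
  finally show ?thesis .
qed

text \<open>Gaussian elimination with pivot \<open>M m m\<close>: once multiples of row
  \<open>m\<close> have cleared column \<open>m\<close> off the pivot, that column can be split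
  off.\<close>

lemma det_on_Schur:
  assumes S: "finite S" "m \<in> S" and nz: "M m m \<noteq> 0"
  shows "det_on S M = M m m * det_on (S - {m}) (\<lambda>i j. M i j - M i m * M m j / M m m)"
proof -
  let ?N = "\<lambda>i j. if i \<in> S - {m} then M i j + (- M i m / M m m) * M m j else M i j"
  have "det_on S M = det_on S ?N"
    using S by (intro det_on_add_rows[symmetric]) auto
  also have "\<dots> = ?N m m * det_on (S - {m}) ?N"
    using S nz by (intro det_on_zero_column) (auto simp: field_simps)
  also have "det_on (S - {m}) ?N = det_on (S - {m}) (\<lambda>i j. M i j - M i m * M m j / M m m)"
    by (rule det_on_cong) (auto simp: field_simps)
  finally show ?thesis by simp
qed

text \<open>Conjugation by \<open>f\<close> carries the permutations of \<open>A\<close> to those of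
  \<open>B\<close> and preserves signs. A principal minor thus depends on its index set and not on
  the enumeration.\<close>

lemma det_on_reindex:
  assumes "finite A" "bij_betw f A B"
  shows "det_on B M = det_on A (\<lambda>i j. M (f i) (f j))"
proof -
  have inj: "inj_on f A" and B: "B = f ` A" using assms(2) by (auto simp: bij_betw_def)
  have mp: "map_permutation A f = (\<lambda>\<pi> x. if x \<in> B then f (\<pi> (inv_into A f x)) else x)"
    by (auto simp: map_permutation_def restrict_id_def B fun_eq_iff)
  have "det_on B M = (\<Sum>p | p permutes A. of_int (sign (map_permutation A f p)) * (\<Prod>i\<in>B. M i (map_permutation A f p i)))"
    unfolding det_on_def
    by (rule sum.reindex_bij_betw[symmetric]) (unfold mp, rule bij_betw_permutations[OF assms(2)])
  also have "\<dots> = det_on A (\<lambda>i j. M (f i) (f j))"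
    unfolding det_on_def B
    by (intro sum.cong refl) (simp add: sign_map_permutation inj assms prod.reindex map_permutation_apply)
  finally show ?thesis .
qed

text \<open>A repeated index yields two equal rows. Hence sums of minors may run over all index
  tuples instead of the injective ones only.\<close>

lemma det_on_non_injective:
  assumes "finite S" "\<not> inj_on f S"
  shows "det_on S (\<lambda>i j. M (f i) (f j)) = 0"
proof -
  obtain a b where "a \<in> S" "b \<in> S" "a \<noteq> b" "f a = f b" using assms(2) by (auto simp: inj_on_def)
  then show ?thesis by (intro det_on_equal_rows[of S a b]) (auto simp: assms)
qed

lemma det_on_scale_rows:
  "det_on S (\<lambda>i j. c i * M i j) = (\<Prod>i\<in>S. c i) * det_on S M"
  by (simp add: det_on_def prod.distrib sum_distrib_left mult.left_commute)

lemma det_on_scale_columns: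
  "det_on S (\<lambda>i j. M i j * c j) = (\<Prod>i\<in>S. c i) * det_on S M"
proof -
  have "(\<Prod>i\<in>S. c (p i)) = (\<Prod>i\<in>S. c i)" if "p permutes S" for p
    using prod.permute[OF that, of c] by (simp add: o_def)
  then show ?thesis
    unfolding det_on_def sum_distrib_left by (intro sum.cong refl) (simp add: prod.distrib mult_ac)
qed

section \<open>The Hilbert space of square integrable functions\<close>

lemma sigma_finite_half_line: "sigma_finite_measure half_line"
proof -
  have "sigma_finite_measure (lebesgue :: real measure)"
  proof (rule sigma_finite_measure.intro, intro exI[of _ "range (\<lambda>n::nat. {- real n..real n})"] conjI)
    show "\<Union> (range (\<lambda>n::nat. {- real n..real n})) = space lebesgue"
    proof -
      have "\<exists>n::nat. x \<in> {- real n..real n}" for x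
      proof -
        obtain n where "\<bar>x\<bar> \<le> real n" using real_arch_simple by blast
        then show ?thesis by (intro exI[of _ n]) (auto simp: abs_le_iff)
      qed
      then show ?thesis by auto
    qed
  qed auto
  then show ?thesis by (rule sigma_finite_measure_restrict_space) auto
qed

interpretation half_line: sigma_finite_measure half_line
  by (rule sigma_finite_half_line)

interpretation half_line_pair: pair_sigma_finite half_line half_line ..

lemma L2_measurable [measurable_dest]: "h \<in> L2 \<Longrightarrow> h \<in> borel_measurable half_line"
  by (simp add: L2_def)

lemma L2_integrable_square: "h \<in> L2 \<Longrightarrow> integrable half_line (\<lambda>x. (cmod (h x))\<^sup>2)"
  by (simp add: L2_def)

lemma L2_I:
  assumes [measurable]: "h \<in> borel_measurable half_line"
    and "integrable half_line b" "\<And>x. 0 < x \<Longrightarrow> (cmod (h x))\<^sup>2 \<le> b x"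
  shows "h \<in> L2"
proof -
  have "integrable half_line (\<lambda>x. (cmod (h x))\<^sup>2)"
    by (rule Bochner_Integration.integrable_bound[OF assms(2)])
       (auto intro!: AE_I2 intro: order_trans[OF assms(3)])
  then show ?thesis by (simp add: L2_def)
qed

lemma borel_measurable_cnj [measurable]:
  "f \<in> borel_measurable M \<Longrightarrow> (\<lambda>x. cnj (f x)) \<in> borel_measurable M"
  by (rule measurable_compose[OF _ borel_measurable_continuous_onI]) (auto intro: continuous_intros)

lemma L2_cnj: "h \<in> L2 \<Longrightarrow> (\<lambda>x. cnj (h x)) \<in> L2"
  by (auto simp: L2_def)

lemma L2_zero: "(\<lambda>x. 0) \<in> L2"
  by (auto simp: L2_def)

lemma L2_scale:
  assumes "h \<in> L2" shows "(\<lambda>x. c * h x) \<in> L2"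
  using assms by (auto simp: L2_def norm_mult power_mult_distrib)

lemma L2_add:
  assumes "g \<in> L2" "h \<in> L2" shows "(\<lambda>x. g x + h x) \<in> L2"
proof (rule L2_I[where b = "\<lambda>x. 2 * (cmod (g x))\<^sup>2 + 2 * (cmod (h x))\<^sup>2"])
  fix x
  have "(cmod (g x + h x))\<^sup>2 \<le> (cmod (g x) + cmod (h x))\<^sup>2"
    by (intro power_mono norm_triangle_ineq) auto
  also have "\<dots> \<le> 2 * (cmod (g x))\<^sup>2 + 2 * (cmod (h x))\<^sup>2"
    using sum_squares_bound[of "cmod (g x)" "cmod (h x)"] by (simp add: power2_sum)
  finally show "(cmod (g x + h x))\<^sup>2 \<le> 2 * (cmod (g x))\<^sup>2 + 2 * (cmod (h x))\<^sup>2" .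
qed (use assms in \<open>auto simp: L2_integrable_square L2_measurable\<close>)

lemma L2_diff:
  assumes "g \<in> L2" "h \<in> L2" shows "(\<lambda>x. g x - h x) \<in> L2"
  using L2_add[OF assms(1) L2_scale[OF assms(2), of "-1"]] by simp

lemma L2_sum:
  assumes "\<And>i. i \<in> I \<Longrightarrow> f i \<in> L2" shows "(\<lambda>x. \<Sum>i\<in>I. f i x) \<in> L2"
  using assms by (induction I rule: infinite_finite_induct) (auto intro: L2_zero L2_add)

lemma L2_mult_integrable:
  assumes "g \<in> L2" "h \<in> L2" shows "integrable half_line (\<lambda>x. g x * h x)"
proof (rule Bochner_Integration.integrable_bound)
  show "integrable half_line (\<lambda>x. (cmod (g x))\<^sup>2 + (cmod (h x))\<^sup>2)"
    using assms by (intro Bochner_Integration.integrable_add L2_integrable_square)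
  show "AE x in half_line. norm (g x * h x) \<le> norm ((cmod (g x))\<^sup>2 + (cmod (h x))\<^sup>2)"
  proof (rule AE_I2)
    fix x
    have "0 \<le> cmod (g x) * cmod (h x)" by simp
    then have "cmod (g x) * cmod (h x) \<le> (cmod (g x))\<^sup>2 + (cmod (h x))\<^sup>2"
      using sum_squares_bound[of "cmod (g x)" "cmod (h x)"] by linarith
    then show "norm (g x * h x) \<le> norm ((cmod (g x))\<^sup>2 + (cmod (h x))\<^sup>2)"
      by (simp add: norm_mult)
  qed
qed (use assms in \<open>auto intro!: borel_measurable_times L2_measurable\<close>)

lemma L2_inner_integrable:
  "g \<in> L2 \<Longrightarrow> h \<in> L2 \<Longrightarrow> integrable half_line (\<lambda>x. g x * cnj (h x))"
  by (intro L2_mult_integrable L2_cnj)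

lemma L2_inner_add_left:
  "f \<in> L2 \<Longrightarrow> g \<in> L2 \<Longrightarrow> h \<in> L2 \<Longrightarrow> L2_inner (\<lambda>x. f x + g x) h = L2_inner f h + L2_inner g h"
  unfolding L2_inner_def by (simp add: L2_inner_integrable algebra_simps Bochner_Integration.integral_add)

lemma L2_inner_diff_left:
  "f \<in> L2 \<Longrightarrow> g \<in> L2 \<Longrightarrow> h \<in> L2 \<Longrightarrow> L2_inner (\<lambda>x. f x - g x) h = L2_inner f h - L2_inner g h"
  unfolding L2_inner_def by (simp add: L2_inner_integrable algebra_simps Bochner_Integration.integral_diff)

lemma L2_inner_scale_left: "L2_inner (\<lambda>x. c * g x) h = c * L2_inner g h"
  unfolding L2_inner_def by (simp add: mult.assoc)

lemma L2_inner_cnj: "cnj (L2_inner g h) = L2_inner h g"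
proof -
  have "cnj (L2_inner g h) = (LINT x|half_line. cnj (g x * cnj (h x)))"
    unfolding L2_inner_def by (rule Bochner_Integration.integral_cnj[symmetric])
  then show ?thesis unfolding L2_inner_def by (simp add: mult.commute)
qed

lemma L2_inner_scale_right: "L2_inner g (\<lambda>x. c * h x) = cnj c * L2_inner g h"
  by (subst (1 2) L2_inner_cnj[symmetric]) (simp add: L2_inner_scale_left)

lemma L2_inner_zero_left: "L2_inner (\<lambda>x. 0) h = 0"
  by (simp add: L2_inner_def)

lemma L2_inner_sum_left:
  assumes "\<And>i. i \<in> I \<Longrightarrow> f i \<in> L2" "h \<in> L2"
  shows "L2_inner (\<lambda>x. \<Sum>i\<in>I. f i x) h = (\<Sum>i\<in>I. L2_inner (f i) h)"
  using assms
  by (induction I rule: infinite_finite_induct)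
     (auto simp: L2_inner_zero_left L2_inner_add_left L2_sum)

lemma L2_norm_nonneg: "0 \<le> L2_norm h"
  by (simp add: L2_norm_def)

lemma L2_norm_square: "(L2_norm h)\<^sup>2 = (LINT x|half_line. (cmod (h x))\<^sup>2)"
  by (simp add: L2_norm_def)

lemma L2_inner_self: "L2_inner h h = of_real ((L2_norm h)\<^sup>2)"
  unfolding L2_inner_def L2_norm_square
  by (simp flip: complex_norm_square integral_complex_of_real)

lemma L2_norm_square_diff:
  assumes "g \<in> L2" "h \<in> L2"
  shows "(L2_norm (\<lambda>x. g x - h x))\<^sup>2 = (L2_norm g)\<^sup>2 + (L2_norm h)\<^sup>2 - 2 * Re (L2_inner g h)"
proof -
  have "complex_of_real ((L2_norm (\<lambda>x. g x - h x))\<^sup>2) = L2_inner (\<lambda>x. g x - h x) (\<lambda>x. g x - h x)"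
    by (simp add: L2_inner_self)
  also have "\<dots> = L2_inner g (\<lambda>x. g x - h x) - L2_inner h (\<lambda>x. g x - h x)"
    using assms by (simp add: L2_inner_diff_left L2_diff)
  also have "L2_inner g (\<lambda>x. g x - h x) = cnj (L2_inner (\<lambda>x. g x - h x) g)" by (simp add: L2_inner_cnj)
  also have "L2_inner h (\<lambda>x. g x - h x) = cnj (L2_inner (\<lambda>x. g x - h x) h)" by (simp add: L2_inner_cnj)
  also have "cnj (L2_inner (\<lambda>x. g x - h x) g) - cnj (L2_inner (\<lambda>x. g x - h x) h)
      = L2_inner g g - cnj (L2_inner h g) - (cnj (L2_inner g h) - L2_inner h h)"
    using assms by (simp add: L2_inner_diff_left L2_inner_cnj)
  also have "\<dots> = of_real ((L2_norm g)\<^sup>2) + of_real ((L2_norm h)\<^sup>2) - (L2_inner g h + cnj (L2_inner g h))"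
    by (simp add: L2_inner_self L2_inner_cnj)
  also have "\<dots> = of_real ((L2_norm g)\<^sup>2 + (L2_norm h)\<^sup>2 - 2 * Re (L2_inner g h))"
    by (simp only: complex_add_cnj of_real_add of_real_diff)
  finally show ?thesis by (simp only: of_real_eq_iff)
qed

text \<open>Cauchy-Schwarz from \<open>2 * s * t <= s^2 + t^2\<close> with
  \<open>s = a * cmod (g x)\<close> and \<open>t = b * cmod (h x)\<close>, where each weight is the
  norm of the other function. If one norm is zero, the product vanishes almost everywhere.\<close>

lemma L2_norm_mult_bound:
  assumes "g \<in> L2" "h \<in> L2"
  shows "(LINT x|half_line. cmod (g x * h x)) \<le> L2_norm g * L2_norm h"
proof -
  let ?P = "L2_norm g" and ?Q = "L2_norm h" and ?I = "LINT x|half_line. cmod (g x * h x)"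
  have I: "integrable half_line (\<lambda>x. cmod (g x * h x))"
    using L2_mult_integrable[OF assms] by simp
  note sq = assms[THEN L2_integrable_square]
  have bound: "2 * (a * b * ?I) \<le> a\<^sup>2 * ?P\<^sup>2 + b\<^sup>2 * ?Q\<^sup>2" for a b :: real
  proof -
    have "2 * (a * b * ?I) = (LINT x|half_line. 2 * (a * b * cmod (g x * h x)))"
      using I by simp
    also have "\<dots> \<le> (LINT x|half_line. a\<^sup>2 * (cmod (g x))\<^sup>2 + b\<^sup>2 * (cmod (h x))\<^sup>2)"
    proof (intro integral_mono)
      fix x show "2 * (a * b * cmod (g x * h x)) \<le> a\<^sup>2 * (cmod (g x))\<^sup>2 + b\<^sup>2 * (cmod (h x))\<^sup>2"
        using sum_squares_bound[of "a * cmod (g x)" "b * cmod (h x)"]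
        by (simp add: norm_mult power_mult_distrib mult_ac)
    qed (use I sq in auto)
    also have "\<dots> = a\<^sup>2 * ?P\<^sup>2 + b\<^sup>2 * ?Q\<^sup>2" using sq by (simp add: L2_norm_square)
    finally show ?thesis .
  qed
  show ?thesis
  proof (cases "?P = 0 \<or> ?Q = 0")
    case False
    then have "0 < ?P * ?Q" by (simp add: order.not_eq_order_implies_strict L2_norm_nonneg)
    then show ?thesis using bound[of ?Q ?P] mult_le_cancel_left_pos[of "?P * ?Q" ?I "?P * ?Q"]
      by (simp add: power2_eq_square mult_ac)
  next
    case True
    then have "(AE x in half_line. g x = 0) \<or> (AE x in half_line. h x = 0)"
      using integral_nonneg_eq_0_iff_AE[OF sq(1)] integral_nonneg_eq_0_iff_AE[OF sq(2)]
      by (auto simp: L2_norm_def)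
    then have "AE x in half_line. cmod (g x * h x) = 0" by auto
    then have "?I = 0" by (rule integral_eq_zero_AE)
    then show ?thesis by (simp add: L2_norm_nonneg)
  qed
qed

lemma L2_inner_bound:
  assumes "g \<in> L2" "h \<in> L2" shows "cmod (L2_inner g h) \<le> L2_norm g * L2_norm h"
proof -
  have "cmod (L2_inner g h) \<le> (LINT x|half_line. cmod (g x * cnj (h x)))"
    unfolding L2_inner_def by (rule integral_norm_bound)
  also have "\<dots> \<le> L2_norm g * L2_norm (\<lambda>x. cnj (h x))"
    using assms by (intro L2_norm_mult_bound L2_cnj)
  finally show ?thesis by (simp add: L2_norm_def)
qed

lemma L2_norm_cnj [simp]: "L2_norm (\<lambda>x. cnj (h x)) = L2_norm h"
  by (simp add: L2_norm_def)

text \<open>The Riesz--Fischer theorem. Along a subsequence with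
  \<open>\<parallel>s (r (Suc k)) - s (r k)\<parallel>\<^sup>2 \<le> 8\<^sup>-\<^sup>k\<close> the increments are almost everywhere \<open>O(2\<^sup>-\<^sup>k)\<close>.\<close>

lemma L2_complete:
  assumes s: "\<And>n. s n \<in> L2"
    and Cauchy: "\<And>\<epsilon>. 0 < \<epsilon> \<Longrightarrow> \<exists>N. \<forall>m\<ge>N. \<forall>n\<ge>N. (L2_norm (\<lambda>x. s m x - s n x))\<^sup>2 \<le> \<epsilon>"
  obtains t where "t \<in> L2" "(\<lambda>n. L2_norm (\<lambda>x. s n x - t x)) \<longlonglongrightarrow> 0"
proof -
  have [measurable]: "s n \<in> borel_measurable half_line" for n using s by (rule L2_measurable)
  have nn: "(\<integral>\<^sup>+x. ennreal ((cmod (s m x - s n x))\<^sup>2) \<partial>half_line) = ennreal ((L2_norm (\<lambda>x. s m x - s n x))\<^sup>2)" for m n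
    using L2_integrable_square[OF L2_diff[OF s s]]
    by (simp add: L2_norm_square nn_integral_eq_integral)
  have "\<exists>r. \<forall>k. (\<forall>m\<ge>r k. \<forall>n\<ge>r k. (L2_norm (\<lambda>x. s m x - s n x))\<^sup>2 \<le> (1/8) ^ k) \<and> r k \<le> r (Suc k)"
  proof (rule dependent_nat_choice)
    show "\<exists>x. \<forall>m\<ge>x. \<forall>n\<ge>x. (L2_norm (\<lambda>x. s m x - s n x))\<^sup>2 \<le> (1/8) ^ 0"
      by (rule Cauchy) simp
  next
    fix x k
    obtain N where "\<forall>m\<ge>N. \<forall>n\<ge>N. (L2_norm (\<lambda>x. s m x - s n x))\<^sup>2 \<le> (1/8) ^ Suc k"
      using Cauchy[of "(1/8) ^ Suc k"] by auto
    then show "\<exists>y. (\<forall>m\<ge>y. \<forall>n\<ge>y. (L2_norm (\<lambda>x. s m x - s n x))\<^sup>2 \<le> (1/8) ^ Suc k) \<and> x \<le> y"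
      by (intro exI[of _ "max N x"]) auto
  qed
  then obtain r where r: "\<And>k m n. m \<ge> r k \<Longrightarrow> n \<ge> r k \<Longrightarrow> (L2_norm (\<lambda>x. s m x - s n x))\<^sup>2 \<le> (1/8) ^ k"
    and r_mono: "\<And>k. r k \<le> r (Suc k)" by blast
  have r_le: "r k \<le> r l" if "k \<le> l" for k l using that r_mono by (rule lift_Suc_mono_le[rotated])
  let ?d = "\<lambda>k x. s (r (Suc k)) x - s (r k) x"
  have "(\<integral>\<^sup>+x. (\<Sum>k. ennreal (4 ^ k * (cmod (?d k x))\<^sup>2)) \<partial>half_line)
      = (\<Sum>k. \<integral>\<^sup>+x. ennreal (4 ^ k * (cmod (?d k x))\<^sup>2) \<partial>half_line)"
    by (rule nn_integral_suminf) measurable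
  also have "\<dots> = (\<Sum>k. ennreal (4 ^ k * (L2_norm (?d k))\<^sup>2))"
    by (simp add: ennreal_mult nn_integral_cmult nn)
  also have "\<dots> \<le> (\<Sum>k. ennreal ((1/2) ^ k))"
  proof (intro suminf_le ennreal_leI)
    fix k
    have "4 ^ k * (L2_norm (?d k))\<^sup>2 \<le> 4 ^ k * (1/8) ^ k"
      using r[of k] r_mono by (intro mult_left_mono) auto
    also have "\<dots> = (1/2::real) ^ k" by (simp flip: power_mult_distrib)
    finally show "4 ^ k * (L2_norm (?d k))\<^sup>2 \<le> (1/2) ^ k" .
  qed auto
  also have "(\<Sum>k. ennreal ((1/2) ^ k)) = ennreal (\<Sum>k. (1/2) ^ k)"
    by (rule suminf_ennreal2) (simp_all add: summable_geometric)
  also have "\<dots> < \<infinity>" by simp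
  finally have "AE x in half_line. (\<Sum>k. ennreal (4 ^ k * (cmod (?d k x))\<^sup>2)) \<noteq> \<infinity>"
    by (intro nn_integral_PInf_AE) auto
  then have conv: "AE x in half_line. convergent (\<lambda>k. s (r k) x)"
  proof eventually_elim
    case (elim x)
    then have "summable (\<lambda>k. 4 ^ k * (cmod (?d k x))\<^sup>2)"
      by (intro summable_suminf_not_top) auto
    then have "(\<lambda>k. 4 ^ k * (cmod (?d k x))\<^sup>2) \<longlonglongrightarrow> 0" by (rule summable_LIMSEQ_zero)
    then have "\<forall>\<^sub>F k in sequentially. 4 ^ k * (cmod (?d k x))\<^sup>2 < 1"
      by (rule order_tendstoD) simp
    then have "\<forall>\<^sub>F k in sequentially. norm (?d k x) \<le> (1/2) ^ k"
    proof eventually_elim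
      case (elim k)
      have "(2 ^ k * cmod (?d k x))\<^sup>2 = 4 ^ k * (cmod (?d k x))\<^sup>2"
        by (simp add: power_mult_distrib power2_eq_square flip: power_mult_distrib)
      then have "2 ^ k * cmod (?d k x) < 1" using elim by (intro power2_less_imp_less[of _ 1]) auto
      then show ?case by (simp add: field_simps)
    qed
    then have "summable (\<lambda>k. ?d k x)"
      by (rule summable_comparison_test_ev) (simp add: summable_geometric)
    then have "convergent (\<lambda>n. \<Sum>k<n. ?d k x)" by (simp add: summable_iff_convergent)
    then have "convergent (\<lambda>n. s (r n) x - s (r 0) x)" by (simp add: sum_lessThan_telescope[of "\<lambda>k. s (r k) x"])
    from convergent_add[OF this convergent_const[of "s (r 0) x"]] show ?case by simp
  qed
  define t where "t x = lim (\<lambda>k. s (r k) x)" for x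
  have [measurable]: "t \<in> borel_measurable half_line" unfolding t_def by measurable
  have lim: "AE x in half_line. (\<lambda>k. s (r k) x) \<longlonglongrightarrow> t x"
    using conv by eventually_elim (simp add: t_def convergent_LIMSEQ_iff)
  \<comment> \<open>Fatou's lemma along the subsequence, with \<open>n\<close> fixed, turns the
    almost everywhere limit into a norm estimate for every \<open>n \<ge> r k\<close>, not only for
    members of the subsequence.\<close>
  have Fatou: "(\<integral>\<^sup>+x. ennreal ((cmod (s n x - t x))\<^sup>2) \<partial>half_line) \<le> ennreal ((1/8) ^ k)" if n: "n \<ge> r k" for n k
  proof -
    have "(\<integral>\<^sup>+x. ennreal ((cmod (s n x - t x))\<^sup>2) \<partial>half_line)
        = (\<integral>\<^sup>+x. liminf (\<lambda>l. ennreal ((cmod (s n x - s (r l) x))\<^sup>2)) \<partial>half_line)"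
    proof (rule nn_integral_cong_AE, use lim in eventually_elim)
      fix x assume "(\<lambda>k. s (r k) x) \<longlonglongrightarrow> t x"
      then have "(\<lambda>l. ennreal ((cmod (s n x - s (r l) x))\<^sup>2)) \<longlonglongrightarrow> ennreal ((cmod (s n x - t x))\<^sup>2)"
        by (intro tendsto_intros)
      then show "ennreal ((cmod (s n x - t x))\<^sup>2) = liminf (\<lambda>l. ennreal ((cmod (s n x - s (r l) x))\<^sup>2))"
        by (rule lim_imp_Liminf[OF sequentially_bot, symmetric])
    qed
    also have "\<dots> \<le> liminf (\<lambda>l. \<integral>\<^sup>+x. ennreal ((cmod (s n x - s (r l) x))\<^sup>2) \<partial>half_line)"
      by (rule nn_integral_liminf) measurable
    also have "\<dots> \<le> liminf (\<lambda>l. ennreal ((1/8) ^ k))"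
    proof (rule Liminf_mono, rule eventually_sequentiallyI[of k])
      fix l assume "k \<le> l"
      then show "(\<integral>\<^sup>+x. ennreal ((cmod (s n x - s (r l) x))\<^sup>2) \<partial>half_line) \<le> ennreal ((1/8) ^ k)"
        unfolding nn using n by (intro ennreal_leI r r_le)
    qed
    also have "\<dots> = ennreal ((1/8) ^ k)" by (simp add: Liminf_const)
    finally show ?thesis .
  qed
  \<comment> \<open>The case \<open>k = 0\<close> of the estimate: the integral is at most 1, so
    \<open>t\<close> differs from \<open>s (r 0)\<close> by an element of \<open>L2\<close>.\<close>
  have "integrable half_line (\<lambda>x. (cmod (s (r 0) x - t x))\<^sup>2)"
    using Fatou[of 0 "r 0"] by (intro integrableI_bounded) (auto simp: less_top[symmetric] top_unique)
  then have "(\<lambda>x. s (r 0) x - t x) \<in> L2" by (simp add: L2_def)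
  from L2_diff[OF s[of "r 0"] this] have t: "t \<in> L2" by simp
  have "(\<lambda>n. (L2_norm (\<lambda>x. s n x - t x))\<^sup>2) \<longlonglongrightarrow> 0"
  proof (rule LIMSEQ_I)
    fix \<epsilon> :: real assume "0 < \<epsilon>"
    then obtain k where k: "(1/8::real) ^ k < \<epsilon>" using real_arch_pow_inv[of \<epsilon> "1/8"] by auto
    have "(L2_norm (\<lambda>x. s n x - t x))\<^sup>2 \<le> (1/8) ^ k" if "n \<ge> r k" for n
    proof -
      have "ennreal ((L2_norm (\<lambda>x. s n x - t x))\<^sup>2) = (\<integral>\<^sup>+x. ennreal ((cmod (s n x - t x))\<^sup>2) \<partial>half_line)"
        using L2_integrable_square[OF L2_diff[OF s t]] by (simp add: L2_norm_square nn_integral_eq_integral)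
      from order.trans[OF eq_refl[OF this] Fatou[OF that]] show ?thesis
        by (subst (asm) ennreal_le_iff) auto
    qed
    with k show "\<exists>N. \<forall>n\<ge>N. norm ((L2_norm (\<lambda>x. s n x - t x))\<^sup>2 - 0) < \<epsilon>"
      by (intro exI[of _ "r k"]) (auto intro: le_less_trans)
  qed
  from tendsto_real_sqrt[OF this] have "(\<lambda>n. L2_norm (\<lambda>x. s n x - t x)) \<longlonglongrightarrow> 0"
    by (simp add: L2_norm_nonneg)
  with t show ?thesis by (rule that)
qed

section \<open>Bessel's inequality, Fourier expansions and Parseval's identity\<close>

lemma orthonormal_basisD:
  assumes "orthonormal_basis e"
  shows "e i \<in> L2" "L2_inner (e i) (e j) = (if i = j then 1 else 0)"
    "h \<in> L2 \<Longrightarrow> (\<And>i. L2_inner h (e i) = 0) \<Longrightarrow> AE x in half_line. h x = 0"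
  using assms by (auto simp: orthonormal_basis_def)

lemma L2_norm_minus_commute: "L2_norm (\<lambda>x. g x - h x) = L2_norm (\<lambda>x. h x - g x)"
  by (simp add: L2_norm_def norm_minus_commute)

context
  fixes e :: "nat \<Rightarrow> real \<Rightarrow> complex"
  assumes e_L2: "\<And>i. e i \<in> L2"
    and e_orth: "\<And>i j. L2_inner (e i) (e j) = (if i = j then 1 else 0)"
begin

lemma L2_inner_orthonormal_sum:
  assumes "finite I"
  shows "L2_inner (\<lambda>x. \<Sum>i\<in>I. c i * e i x) (e j) = (if j \<in> I then c j else 0)"
  using assms e_L2 by (simp add: L2_inner_sum_left L2_scale L2_inner_scale_left e_orth if_distrib cong: if_cong)

lemma L2_norm_orthonormal_sum:
  assumes "finite I"
  shows "(L2_norm (\<lambda>x. \<Sum>i\<in>I. c i * e i x))\<^sup>2 = (\<Sum>i\<in>I. (cmod (c i))\<^sup>2)"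
proof -
  let ?p = "\<lambda>x. \<Sum>i\<in>I. c i * e i x"
  have p: "?p \<in> L2" by (intro L2_sum L2_scale e_L2)
  have "of_real ((L2_norm ?p)\<^sup>2) = L2_inner ?p ?p" by (simp add: L2_inner_self)
  also have "\<dots> = (\<Sum>i\<in>I. c i * L2_inner (e i) ?p)"
    using p by (subst L2_inner_sum_left) (auto intro: L2_scale e_L2 simp: L2_inner_scale_left)
  also have "\<dots> = (\<Sum>i\<in>I. c i * cnj (c i))"
    using L2_inner_orthonormal_sum[OF assms, of c]
    by (intro sum.cong refl) (subst L2_inner_cnj[symmetric], simp)
  also have "\<dots> = of_real (\<Sum>i\<in>I. (cmod (c i))\<^sup>2)" by (simp only: of_real_sum complex_norm_square)
  finally show ?thesis by (simp only: of_real_eq_iff)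
qed

text \<open>The right side exceeds the left by the squared distance from \<open>h\<close> to its
  orthogonal projection on the span of the \<open>e i\<close> with \<open>i \<in> I\<close>.\<close>

lemma Bessel:
  assumes h: "h \<in> L2" and I: "finite I"
  shows "(\<Sum>i\<in>I. (cmod (L2_inner h (e i)))\<^sup>2) \<le> (L2_norm h)\<^sup>2"
proof -
  let ?c = "\<lambda>i. L2_inner h (e i)"
  let ?p = "\<lambda>x. \<Sum>i\<in>I. ?c i * e i x"
  have p: "?p \<in> L2" by (intro L2_sum L2_scale e_L2)
  have "L2_inner ?p h = (\<Sum>i\<in>I. ?c i * L2_inner (e i) h)"
    using h by (subst L2_inner_sum_left) (auto intro: L2_scale e_L2 simp: L2_inner_scale_left)
  also have "\<dots> = of_real (\<Sum>i\<in>I. (cmod (?c i))\<^sup>2)"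
    by (simp only: of_real_sum complex_norm_square L2_inner_cnj)
  finally have "Re (L2_inner ?p h) = (\<Sum>i\<in>I. (cmod (?c i))\<^sup>2)" by simp
  then have "(L2_norm (\<lambda>x. ?p x - h x))\<^sup>2 = (L2_norm h)\<^sup>2 - (\<Sum>i\<in>I. (cmod (?c i))\<^sup>2)"
    using L2_norm_square_diff[OF p h] L2_norm_orthonormal_sum[OF I, of ?c] by simp
  moreover have "0 \<le> (L2_norm (\<lambda>x. ?p x - h x))\<^sup>2" by simp
  ultimately show ?thesis by linarith
qed

lemma Bessel_summable:
  assumes "h \<in> L2"
  shows "summable (\<lambda>i. (cmod (L2_inner h (e i)))\<^sup>2)"
    and "(\<Sum>i. (cmod (L2_inner h (e i)))\<^sup>2) \<le> (L2_norm h)\<^sup>2"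
proof -
  show *: "summable (\<lambda>i. (cmod (L2_inner h (e i)))\<^sup>2)"
    by (rule summableI_nonneg_bounded[of _ "(L2_norm h)\<^sup>2"]) (auto intro: Bessel assms)
  show "(\<Sum>i. (cmod (L2_inner h (e i)))\<^sup>2) \<le> (L2_norm h)\<^sup>2"
    by (rule suminf_le_const[OF *]) (auto intro: Bessel assms)
qed

end

text \<open>By Bessel the partial sums are Cauchy and have an \<open>L2\<close> limit
  \<open>t\<close>. Its coefficients agree with those of \<open>h\<close>, so the completeness
  clause of the basis makes \<open>t\<close> and \<open>h\<close> equal almost everywhere.\<close>

lemma orthonormal_basis_expansion:
  assumes e: "orthonormal_basis e" and h: "h \<in> L2"
  shows "(\<lambda>n. L2_norm (\<lambda>x. (\<Sum>i<n. L2_inner h (e i) * e i x) - h x)) \<longlonglongrightarrow> 0"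
proof -
  note e' = orthonormal_basisD[OF e]
  let ?c = "\<lambda>i. L2_inner h (e i)"
  let ?s = "\<lambda>n x. \<Sum>i<n. ?c i * e i x"
  let ?a = "\<lambda>n. \<Sum>i<n. (cmod (?c i))\<^sup>2"
  have s: "?s n \<in> L2" for n by (intro L2_sum L2_scale e')
  \<comment> \<open>Pythagoras: the squared distance of two partial sums is a difference of partial
    sums of a convergent scalar series.\<close>
  have diff: "(L2_norm (\<lambda>x. ?s m x - ?s n x))\<^sup>2 = \<bar>?a m - ?a n\<bar>" for m n
  proof (induction m n rule: linorder_wlog)
    case (le m n)
    have split: "(\<Sum>i<n. f i) - (\<Sum>i<m. f i) = (\<Sum>i\<in>{m..<n}. f i)" for f :: "nat \<Rightarrow> 'a::ab_group_add"
      using sum_diff_nat_ivl[of 0 m n f] le by (simp add: lessThan_atLeast0)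
    have "(L2_norm (\<lambda>x. ?s n x - ?s m x))\<^sup>2 = (\<Sum>i\<in>{m..<n}. (cmod (?c i))\<^sup>2)"
      unfolding split by (rule L2_norm_orthonormal_sum[OF e'(1,2)]) auto
    also have "\<dots> = \<bar>\<Sum>i\<in>{m..<n}. (cmod (?c i))\<^sup>2\<bar>" by (simp add: sum_nonneg)
    finally show ?case
      unfolding split[symmetric] by (subst L2_norm_minus_commute) (simp add: abs_minus_commute)
  next
    case (sym m n)
    then show ?case by (subst L2_norm_minus_commute) (simp add: abs_minus_commute)
  qed
  have "Cauchy ?a"
    using Bessel_summable(1)[OF e'(1,2) h] by (simp add: summable_iff_convergent convergent_Cauchy)
  then have "\<exists>N. \<forall>m\<ge>N. \<forall>n\<ge>N. (L2_norm (\<lambda>x. ?s m x - ?s n x))\<^sup>2 \<le> \<epsilon>" if "0 < \<epsilon>" for \<epsilon>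
    using that unfolding diff by (force simp: Cauchy_def dist_real_def intro: less_imp_le)
  then obtain t where t: "t \<in> L2" and lim: "(\<lambda>n. L2_norm (\<lambda>x. ?s n x - t x)) \<longlonglongrightarrow> 0"
    using L2_complete[of ?s, OF s] by blast
  have "L2_inner (\<lambda>x. t x - h x) (e i) = 0" for i
  proof -
    have "(\<lambda>n. L2_norm (\<lambda>x. ?s n x - t x) * L2_norm (e i)) \<longlonglongrightarrow> 0"
      using tendsto_mult_left_zero[OF lim] .
    moreover have "\<forall>\<^sub>F n in sequentially. norm (L2_inner (\<lambda>x. t x - h x) (e i)) \<le> L2_norm (\<lambda>x. ?s n x - t x) * L2_norm (e i)"
    \<comment> \<open>From \<open>n = Suc i\<close> on, the partial sum has the same coefficient at
      index \<open>i\<close> as \<open>h\<close>.\<close>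
    proof (rule eventually_sequentiallyI[of "Suc i"])
      fix n assume "Suc i \<le> n"
      then have "L2_inner (?s n) (e i) = ?c i"
        using L2_inner_orthonormal_sum[OF e'(1,2), of "{..<n}" ?c i] by simp
      then have "L2_inner (\<lambda>x. t x - h x) (e i) = - L2_inner (\<lambda>x. ?s n x - t x) (e i)"
        by (simp add: L2_inner_diff_left t h s e')
      then show "norm (L2_inner (\<lambda>x. t x - h x) (e i)) \<le> L2_norm (\<lambda>x. ?s n x - t x) * L2_norm (e i)"
        using L2_inner_bound[OF L2_diff[OF s[of n] t] e'(1)[of i]] by simp
    qed
    ultimately have "(\<lambda>n. L2_inner (\<lambda>x. t x - h x) (e i)) \<longlonglongrightarrow> 0" by (rule Lim_null_comparison[rotated])
    then show ?thesis by (simp add: LIMSEQ_const_iff)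
  qed
  then have ae: "AE x in half_line. t x - h x = 0"
    by (intro e'(3) L2_diff t h)
  have "L2_norm (\<lambda>x. ?s n x - h x) = L2_norm (\<lambda>x. ?s n x - t x)" for n
  proof -
    have "(LINT x|half_line. (cmod (?s n x - h x))\<^sup>2) = (LINT x|half_line. (cmod (?s n x - t x))\<^sup>2)"
      using L2_measurable[OF L2_diff[OF s[of n] h]] L2_measurable[OF L2_diff[OF s[of n] t]] ae
      by (intro integral_cong_AE) auto
    then show ?thesis by (simp only: L2_norm_def)
  qed
  with lim show ?thesis by simp
qed

text \<open>Norm convergence of the expansion passes to the inner product with \<open>g\<close> by
  Cauchy-Schwarz.\<close>

lemma Parseval:
  assumes e: "orthonormal_basis e" and h: "h \<in> L2" and g: "g \<in> L2"
  shows "(\<lambda>i. L2_inner h (e i) * L2_inner (e i) g) sums L2_inner h g"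
proof -
  note e' = orthonormal_basisD[OF e]
  let ?s = "\<lambda>n x. \<Sum>i<n. L2_inner h (e i) * e i x"
  have s: "?s n \<in> L2" for n by (intro L2_sum L2_scale e')
  have eq: "(\<Sum>i<n. L2_inner h (e i) * L2_inner (e i) g) = L2_inner (?s n) g" for n
    using g by (subst L2_inner_sum_left) (auto intro: L2_scale e' simp: L2_inner_scale_left)
  have "(\<lambda>n. L2_inner (?s n) g - L2_inner h g) \<longlonglongrightarrow> 0"
  proof (rule Lim_null_comparison)
    show "\<forall>\<^sub>F n in sequentially. norm (L2_inner (?s n) g - L2_inner h g) \<le> L2_norm (\<lambda>x. ?s n x - h x) * L2_norm g"
      using L2_inner_bound[OF L2_diff[OF s h] g] by (simp add: L2_inner_diff_left s h g)
    show "(\<lambda>n. L2_norm (\<lambda>x. ?s n x - h x) * L2_norm g) \<longlonglongrightarrow> 0"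
      by (rule tendsto_mult_left_zero[OF orthonormal_basis_expansion[OF e h]])
  qed
  then show ?thesis unfolding sums_def eq by (simp add: LIM_zero_iff)
qed

section \<open>Gram-Schmidt orthonormalization\<close>

function gram_schmidt :: "(nat \<Rightarrow> real \<Rightarrow> complex) \<Rightarrow> nat \<Rightarrow> real \<Rightarrow> complex" where
  "gram_schmidt w n =
     (let r = (\<lambda>x. w n x - (\<Sum>i<n. L2_inner (w n) (gram_schmidt w i) * gram_schmidt w i x))
      in (\<lambda>x. of_real (1 / L2_norm r) * r x))"
  by pat_completeness auto
termination by (relation "Wellfounded.measure snd") auto

declare gram_schmidt.simps [simp del]

context
  fixes w :: "nat \<Rightarrow> real \<Rightarrow> complex"
  assumes w_L2: "\<And>n. w n \<in> L2"
    and indep: "\<And>n c. \<not> (AE x in half_line. w n x = (\<Sum>i<n. c i * w i x))"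
begin

private definition "residual n = (\<lambda>x. w n x - (\<Sum>i<n. L2_inner (w n) (gram_schmidt w i) * gram_schmidt w i x))"

private lemma gram_schmidt_residual: "gram_schmidt w n = (\<lambda>x. of_real (1 / L2_norm (residual n)) * residual n x)"
  by (subst gram_schmidt.simps) (simp add: residual_def Let_def)

text \<open>All properties go through one induction. The representation by the \<open>w l\<close>
  turns a residual of norm zero into a linear dependence, which \<open>indep\<close> excludes;
  without this, \<open>1 / 0 = 0\<close> would make the normalized vector zero.\<close>

private lemma gram_schmidt_invariant:
  "(\<forall>i<n. gram_schmidt w i \<in> L2 \<and> L2_norm (residual i) \<noteq> 0) \<and>
   (\<forall>i<n. \<forall>j<n. L2_inner (gram_schmidt w i) (gram_schmidt w j) = (if i = j then 1 else 0)) \<and>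
   (\<forall>i<n. \<exists>c. \<forall>x. gram_schmidt w i x = (\<Sum>l<n. c l * w l x))"
proof (induction n)
  case (Suc n)
  let ?e = "gram_schmidt w"
  have L: "?e i \<in> L2" and O: "L2_inner (?e i) (?e j) = (if i = j then 1 else 0)" if "i < n" "j < n" for i j
    using Suc that by auto
  obtain C where C: "?e i x = (\<Sum>l<n. C i l * w l x)" if "i < n" for i x
    using Suc by metis
  have sL: "(\<lambda>x. \<Sum>i<n. L2_inner (w n) (?e i) * ?e i x) \<in> L2"
    using L by (intro L2_sum L2_scale) auto
  then have r: "residual n \<in> L2"
    unfolding residual_def by (intro L2_diff w_L2)
  have orth: "L2_inner (residual n) (?e j) = 0" if "j < n" for j
  proof -
    have "L2_inner (residual n) (?e j) = L2_inner (w n) (?e j) - L2_inner (\<lambda>x. \<Sum>i<n. L2_inner (w n) (?e i) * ?e i x) (?e j)"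
      unfolding residual_def using that by (intro L2_inner_diff_left w_L2 sL L)
    also have "L2_inner (\<lambda>x. \<Sum>i<n. L2_inner (w n) (?e i) * ?e i x) (?e j)
        = (\<Sum>i<n. L2_inner (w n) (?e i) * L2_inner (?e i) (?e j))"
      using that L by (subst L2_inner_sum_left) (auto intro!: L2_scale simp: L2_inner_scale_left)
    also have "\<dots> = (\<Sum>i<n. if i = j then L2_inner (w n) (?e i) else 0)"
      using that by (intro sum.cong refl) (simp add: O)
    also have "\<dots> = L2_inner (w n) (?e j)" using that by simp
    finally show ?thesis by simp
  qed
  define d where "d l = (\<Sum>i<n. L2_inner (w n) (?e i) * C i l)" for l
  have rd: "residual n x = w n x - (\<Sum>l<n. d l * w l x)" for x
  proof -
    have "(\<Sum>i<n. L2_inner (w n) (?e i) * ?e i x) = (\<Sum>i<n. \<Sum>l<n. L2_inner (w n) (?e i) * (C i l * w l x))"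
      by (simp add: C sum_distrib_left)
    also have "\<dots> = (\<Sum>l<n. d l * w l x)"
      by (subst sum.swap) (simp add: d_def sum_distrib_right mult.assoc)
    finally show ?thesis by (simp add: residual_def)
  qed
  have N: "L2_norm (residual n) \<noteq> 0"
  proof
    assume "L2_norm (residual n) = 0"
    then have "AE x in half_line. (cmod (residual n x))\<^sup>2 = 0"
      using integral_nonneg_eq_0_iff_AE[OF L2_integrable_square[OF r]] by (simp add: L2_norm_def)
    then have "AE x in half_line. w n x = (\<Sum>i<n. d i * w i x)" by (simp add: rd)
    with indep show False by blast
  qed
  have eL: "?e n \<in> L2" unfolding gram_schmidt_residual using r by (rule L2_scale)
  have e0: "L2_inner (?e n) (?e j) = 0" if "j < n" for j
    by (subst gram_schmidt_residual) (simp only: L2_inner_scale_left orth[OF that] mult_zero_right)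
  have e0': "L2_inner (?e j) (?e n) = 0" if "j < n" for j
    using e0[OF that] L2_inner_cnj by (metis complex_cnj_zero)
  have e1: "L2_inner (?e n) (?e n) = 1"
    unfolding gram_schmidt_residual[of n] L2_inner_scale_left L2_inner_scale_right L2_inner_self
    using N by (simp add: power2_eq_square)
  have ext: "\<exists>c. \<forall>x. ?e i x = (\<Sum>l<Suc n. c l * w l x)" if "i < Suc n" for i
  proof (cases "i = n")
    case True
    \<comment> \<open>The formula \<open>rd\<close> supplies the coefficients: 1 at the index
      \<open>n\<close> and \<open>- d l\<close> below it, divided by the norm of the
      residual.\<close>
    show ?thesis
      by (rule exI[of _ "\<lambda>l. of_real (1 / L2_norm (residual n)) * (if l = n then 1 else - d l)"])
         (simp add: True gram_schmidt_residual rd sum_distrib_left sum_negf algebra_simps)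
  next
    case False
    \<comment> \<open>A zero coefficient at \<open>n\<close> brings the old representations to the
      common length \<open>Suc n\<close>.\<close>
    with that show ?thesis
      by (intro exI[of _ "(C i)(n := 0)"]) (simp add: C)
  qed
  show ?case
    using L O e0 e0' e1 eL N ext by (auto simp: less_Suc_eq Suc.IH)
qed simp

lemma gram_schmidt_L2: "gram_schmidt w i \<in> L2"
  using gram_schmidt_invariant[of "Suc i"] by blast

lemma gram_schmidt_orthonormal:
  "L2_inner (gram_schmidt w i) (gram_schmidt w j) = (if i = j then 1 else 0)"
proof -
  have "i < Suc (max i j)" "j < Suc (max i j)" by auto
  then show ?thesis using gram_schmidt_invariant[of "Suc (max i j)"] by blast
qed

text \<open>The recursion can be solved for \<open>w n\<close>, because the norm of the residual is
  nonzero. Completeness of the orthonormal system can thus be tested on the original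
  functions.\<close>

lemma orthogonal_gram_schmidt_imp:
  assumes h: "h \<in> L2" and orth: "\<And>i. L2_inner h (gram_schmidt w i) = 0"
  shows "L2_inner h (w n) = 0"
proof -
  have N: "L2_norm (residual n) \<noteq> 0" using gram_schmidt_invariant[of "Suc n"] by blast
  have o': "L2_inner (gram_schmidt w i) h = 0" for i
    using orth[of i, THEN arg_cong[where f = cnj]] by (simp add: L2_inner_cnj)
  have res: "residual n \<in> L2"
    unfolding residual_def by (intro L2_diff L2_sum L2_scale gram_schmidt_L2 w_L2)
  have "L2_inner (gram_schmidt w n) h = of_real (1 / L2_norm (residual n)) * L2_inner (residual n) h"
    unfolding gram_schmidt_residual[of n] by (rule L2_inner_scale_left)
  then have "L2_inner (residual n) h = 0" using N by (simp add: o')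
  moreover have "L2_inner (residual n) h = L2_inner (w n) h - (\<Sum>i<n. L2_inner (w n) (gram_schmidt w i) * L2_inner (gram_schmidt w i) h)"
    unfolding residual_def
    by (simp add: L2_inner_diff_left L2_inner_sum_left L2_inner_scale_left L2_sum L2_scale gram_schmidt_L2 w_L2 h)
  ultimately have "L2_inner (w n) h = 0" by (simp add: o')
  then show ?thesis by (subst L2_inner_cnj[symmetric]) simp
qed

end

section \<open>Step functions with rational jumps and existence of an orthonormal basis\<close>

lemma AE_half_line_ex_interval:
  assumes ae: "AE x in half_line. P x" and ab: "0 \<le> a" "a < b"
  shows "\<exists>x\<in>{a<..<b}. P x"
proof (rule ccontr)
  assume neg: "\<not> ?thesis"
  obtain N where N: "{x \<in> space half_line. \<not> P x} \<subseteq> N" "emeasure half_line N = 0" "N \<in> sets half_line"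
    using AE_E[OF ae] by blast
  \<comment> \<open>An interval without a good point would lie in a null set, although its measure
    is \<open>b - a\<close>.\<close>
  have "{a<..<b} \<subseteq> N" using N(1) neg ab by (force simp: space_restrict_space)
  then have "emeasure half_line {a<..<b} \<le> 0" using emeasure_mono[OF _ N(3), of "{a<..<b}"] N(2) by simp
  moreover have "emeasure half_line {a<..<b} = ennreal (b - a)"
    using ab by (subst emeasure_restrict_space) auto
  ultimately show False using ab by simp
qed

text \<open>Rational endpoints suffice by density. The generator becomes countable, to match a
  sequence of step functions.\<close>

lemma borel_eq_sigma_lessThan_rat: "sets (borel :: real measure) = sigma_sets UNIV (range (\<lambda>q. {..<of_rat q}))"
proof -
  let ?G = "range (\<lambda>q. {..<of_rat q}) :: real set set"
  have "{..<a} \<in> sigma_sets UNIV ?G" for a :: real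
  proof -
    have "{..<a} = (\<Union>q\<in>{q. of_rat q < a}. {..<of_rat q})"
      using of_rat_dense[of _ a] by (auto intro: less_trans)
    also have "\<dots> \<in> sigma_sets UNIV ?G"
      by (rule sigma_sets_UNION) (auto intro: sigma_sets.Basic)
    finally show ?thesis .
  qed
  then have "sigma_sets UNIV (range lessThan) \<subseteq> sigma_sets UNIV ?G"
    by (intro sigma_sets_mono) auto
  moreover have "sigma_sets UNIV ?G \<subseteq> sigma_sets UNIV (range lessThan)"
    by (intro sigma_sets_mono) (auto intro: sigma_sets.Basic)
  moreover have "sets (borel :: real measure) = sigma_sets UNIV (range lessThan)"
    unfolding borel_Iio by simp
  ultimately show ?thesis by blast
qed

text \<open>Dynkin's argument: the generating half-lines are stable under intersection,
  \<open>total\<close> accounts for complements and dominated convergence for disjoint unions.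
  Lebesgue sets are Borel up to null sets, so the integral vanishes over every measurable
  set.\<close>

lemma density_zero_lessThan_rat:
  fixes f :: "real \<Rightarrow> complex"
  assumes f: "integrable half_line f"
    and zero: "\<And>q. set_lebesgue_integral half_line {..<of_rat q} f = 0"
    and total: "integral\<^sup>L half_line f = 0"
  shows "AE x in half_line. f x = 0"
proof (rule half_line.density_zero[OF f])
  have ind: "integrable half_line (\<lambda>x. indicator A x *\<^sub>R f x)" if A: "A \<in> sets borel" for A
  proof -
    have [measurable]: "A \<in> sets lebesgue" using A by auto
    have [measurable]: "f \<in> borel_measurable half_line" using f by auto
    have [measurable]: "(indicator A :: real \<Rightarrow> real) \<in> borel_measurable half_line"
      by (intro measurable_restrict_space1) measurable
    show ?thesis
      by (rule Bochner_Integration.integrable_bound[OF f]) (auto intro!: AE_I2 split: split_indicator)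
  qed
  have borel: "set_lebesgue_integral half_line A f = 0" if "A \<in> sets borel" for A
  proof -
    have stable: "Int_stable (range (\<lambda>q. {..<of_rat q} :: real set))"
    proof (rule Int_stableI, clarify)
      fix p q :: rat
      have "{..<of_rat p} \<inter> {..<of_rat q} = {..<of_rat (min p q) :: real}"
        by (auto simp: min_def of_rat_less_eq of_rat_less intro: less_le_trans)
      then show "{..<of_rat p} \<inter> {..<of_rat q} \<in> range (\<lambda>q. {..<of_rat q} :: real set)" by blast
    qed
    have sub: "range (\<lambda>q. {..<of_rat q} :: real set) \<subseteq> Pow UNIV" by simp
    have "A \<in> sigma_sets UNIV (range (\<lambda>q. {..<of_rat q} :: real set))"
      using that by (simp only: borel_eq_sigma_lessThan_rat)
    with stable sub show ?thesis
    proof (induction rule: sigma_sets_induct_disjoint)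
      case (compl A)
      then have A: "A \<in> sets borel" by (simp add: borel_eq_sigma_lessThan_rat)
      have "set_lebesgue_integral half_line (UNIV - A) f = (LINT x|half_line. f x - indicator A x *\<^sub>R f x)"
        unfolding set_lebesgue_integral_def
        by (intro Bochner_Integration.integral_cong) (auto split: split_indicator)
      also have "\<dots> = 0"
        using compl(2) total ind[OF A] f by (simp add: set_lebesgue_integral_def)
      finally show ?case .
    next
      case (union A)
      then have A: "A i \<in> sets borel" for i by (auto simp: borel_eq_sigma_lessThan_rat)
      have "(\<lambda>n. LINT x|half_line. (\<Sum>i<n. indicator (A i) x *\<^sub>R f x)) \<longlonglongrightarrow> set_lebesgue_integral half_line (\<Union>i. A i) f"
        unfolding set_lebesgue_integral_def
      proof (rule integral_dominated_convergence[where w = "\<lambda>x. norm (f x)"])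
        have s: "(\<Sum>i<n. indicator (A i) x *\<^sub>R f x) = indicator (\<Union>i<n. A i) x *\<^sub>R f x" for n x
          using union(1) by (subst indicator_UN_disjoint) (auto simp: scaleR_sum_left disjoint_family_on_def)
        show "AE x in half_line. (\<lambda>n. \<Sum>i<n. indicator (A i) x *\<^sub>R f x) \<longlonglongrightarrow> indicator (\<Union>i. A i) x *\<^sub>R f x"
        proof (rule AE_I2)
          fix x
          show "(\<lambda>n. \<Sum>i<n. indicator (A i) x *\<^sub>R f x) \<longlonglongrightarrow> indicator (\<Union>i. A i) x *\<^sub>R f x"
          unfolding s by (intro tendsto_scaleR tendsto_const LIMSEQ_indicator_UN)
        qed
        show "AE x in half_line. norm (\<Sum>i<n. indicator (A i) x *\<^sub>R f x) \<le> norm (f x)" for n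
          unfolding s by (auto intro!: AE_I2 split: split_indicator)
      next
        show "(\<lambda>x. indicator (\<Union>i. A i) x *\<^sub>R f x) \<in> borel_measurable half_line"
          using ind[of "\<Union>i. A i"] A by auto
        show "(\<lambda>x. \<Sum>i<n. indicator (A i) x *\<^sub>R f x) \<in> borel_measurable half_line" for n
          using ind[OF A] by (intro borel_measurable_sum) auto
      qed (use f in auto)
      moreover have "(LINT x|half_line. (\<Sum>i<n. indicator (A i) x *\<^sub>R f x)) = 0" for n
        using union(3) ind[OF A]
        by (subst Bochner_Integration.integral_sum) (auto simp: set_lebesgue_integral_def simp del: sum_indicator_scaleR)
      ultimately show ?case by (simp add: LIMSEQ_const_iff)
    qed (use zero in \<open>auto simp: set_lebesgue_integral_def\<close>)
  qed
  fix A assume "A \<in> sets half_line"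
  then have "A \<in> sets lebesgue" by (auto simp: sets_restrict_space_iff)
  then obtain S N N' where S: "A = S \<union> N" "N \<subseteq> N'" "N' \<in> null_sets lborel" "S \<in> sets lborel"
    by (rule sets_completionE)
  have "AE x in lebesgue. x \<notin> N'" using S(3) by (intro AE_not_in null_sets_completionI)
  then have "AE x in half_line. x \<notin> N'" by (subst AE_restrict_space_iff) auto
  moreover have "(\<lambda>x. indicator A x *\<^sub>R f x) \<in> borel_measurable half_line"
    using \<open>A \<in> sets half_line\<close> f by auto
  ultimately have "set_lebesgue_integral half_line A f = set_lebesgue_integral half_line S f"
    unfolding set_lebesgue_integral_def using S ind[of S]
    by (intro integral_cong_AE) (auto split: split_indicator)
  with borel S(4) show "set_lebesgue_integral half_line A f = 0" by simp
qed

text \<open>Gram-Schmidt is applied to the indicators of the intervals (0, q) with positive rational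
  q. They are independent because only one of them jumps at a given q, and total because a function
  orthogonal to all of them has integral zero over every such interval.\<close>

theorem ex_orthonormal_basis: "\<exists>e. orthonormal_basis e"
proof -
  define Q where "Q = {q :: rat. 0 < q}"
  have "infinite Q"
  proof
    assume "finite Q"
    moreover have "of_nat ` {0<..} \<subseteq> Q" by (auto simp: Q_def)
    ultimately have "finite (of_nat ` {0::nat<..} :: rat set)" by (rule finite_subset[rotated])
    then have "finite {0::nat<..}" by (rule finite_imageD) (auto simp: inj_on_def)
    then show False by (simp add: infinite_Ioi)
  qed
  \<comment> \<open>The enumeration is free of repetitions, as linear independence requires.\<close>
  then have bij: "bij_betw (from_nat_into Q) UNIV Q" by (intro bij_betw_from_nat_into) auto
  define q where "q n = (of_rat (from_nat_into Q n) :: real)" for n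
  have q_pos: "0 < q n" for n
    using bij by (auto simp: q_def Q_def bij_betw_def)
  have q_inj: "q i = q j \<longleftrightarrow> i = j" for i j
    using bij by (auto simp: q_def bij_betw_def inj_on_def)
  have q_onto: "\<exists>n. of_rat r = q n" if "0 < r" for r
  proof -
    have "r \<in> from_nat_into Q ` UNIV" using bij that by (simp add: bij_betw_def Q_def)
    then show ?thesis by (auto simp: q_def)
  qed
  define w :: "nat \<Rightarrow> real \<Rightarrow> complex" where "w n x = of_bool (x < q n)" for n x
  have w_L2: "w n \<in> L2" for n
  proof (rule L2_I)
    have "emeasure half_line {0<..<q n} = ennreal (q n)"
      using q_pos[of n] by (subst emeasure_restrict_space) auto
    then show "integrable half_line (indicator {0<..<q n} :: real \<Rightarrow> real)"
      by (intro integrable_real_indicator) (auto simp: sets_restrict_space_iff)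
    show "w n \<in> borel_measurable half_line"
      unfolding w_def by (intro measurable_restrict_space1 measurable_completion) measurable
    show "\<And>x. 0 < x \<Longrightarrow> (cmod (w n x))\<^sup>2 \<le> indicator {0<..<q n} x"
      by (auto simp: w_def)
  qed
  have indep: "\<not> (AE x in half_line. w n x = (\<Sum>i<n. c i * w i x))" for n c
  proof
    assume ae: "AE x in half_line. w n x = (\<Sum>i<n. c i * w i x)"
    \<comment> \<open>Within distance \<open>\<delta>\<close> of \<open>q n\<close> no earlier
      function jumps, and the interval to the left stays in the half-line. Points on the two sides
      of \<open>q n\<close> are then separated by \<open>w n\<close> but by no earlier
      function.\<close>
    define \<delta> where "\<delta> = Min (insert (q n) ((\<lambda>i. \<bar>q i - q n\<bar>) ` {..<n}))"
    have \<delta>: "0 < \<delta>" "\<delta> \<le> q n" using q_pos q_inj by (auto simp: \<delta>_def)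
    have \<delta>': "\<delta> \<le> \<bar>q i - q n\<bar>" if "i < n" for i using that by (auto simp: \<delta>_def)
    obtain x where x: "x \<in> {q n - \<delta><..<q n}" "w n x = (\<Sum>i<n. c i * w i x)"
      using AE_half_line_ex_interval[OF ae, of "q n - \<delta>" "q n"] \<delta> by auto
    obtain y where y: "y \<in> {q n<..<q n + \<delta>}" "w n y = (\<Sum>i<n. c i * w i y)"
      using AE_half_line_ex_interval[OF ae, of "q n" "q n + \<delta>"] \<delta> by auto
    have "w i x = w i y" if "i < n" for i
      using \<delta>'[OF that] x y by (auto simp: w_def)
    then have "w n x = w n y" using x y by simp
    with x y show False by (simp add: w_def)
  qed
  have "orthonormal_basis (gram_schmidt w)"
    unfolding orthonormal_basis_def
  proof (intro conjI allI ballI impI)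
    fix h assume h: "h \<in> L2" and "\<forall>i. L2_inner h (gram_schmidt w i) = 0"
    then have hw: "L2_inner h (w n) = 0" for n
      by (intro orthogonal_gram_schmidt_imp[OF w_L2 indep]) auto
    have int0: "(LINT x|half_line. of_bool (x < of_rat r) * h x) = 0" for r
    proof (cases "0 < r")
      case True
      then obtain n where "of_rat r = q n" using q_onto by blast
      then have "(LINT x|half_line. of_bool (x < of_rat r) * h x) = L2_inner h (w n)"
        unfolding L2_inner_def w_def by (intro Bochner_Integration.integral_cong) auto
      with hw show ?thesis by simp
    next
      case False
      then have "of_rat r \<le> (0::real)" by simp
      then have "\<not> x < of_rat r" if "x \<in> space half_line" for x
        using that \<open>of_rat r \<le> (0::real)\<close> by (simp add: space_restrict_space del: of_rat_le_0_iff)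
      then have "(LINT x|half_line. of_bool (x < of_rat r) * h x) = (LINT x|half_line. 0)"
        by (intro Bochner_Integration.integral_cong) auto
      then show ?thesis by simp
    qed
    \<comment> \<open>A function in \<open>L2\<close> need not be integrable over the half-line; cut
      off at \<open>Suc N\<close> it is, and these cut-offs exhaust the half-line.\<close>
    have "AE x in half_line. of_bool (x < real (Suc N)) * h x = 0" for N
    proof (rule density_zero_lessThan_rat)
      obtain n where n: "real (Suc N) = q n" using q_onto[of "of_nat (Suc N)"] by (metis of_nat_0_less_iff of_rat_of_nat_eq zero_less_Suc)
      show "integrable half_line (\<lambda>x. of_bool (x < real (Suc N)) * h x)"
        using L2_mult_integrable[OF w_L2[of n] h] unfolding w_def n .
      show "(LINT x|half_line. of_bool (x < real (Suc N)) * h x) = 0"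
        using int0[of "of_nat (Suc N)"] by (simp only: of_rat_of_nat_eq)
      show "set_lebesgue_integral half_line {..<of_rat r} (\<lambda>x. of_bool (x < real (Suc N)) * h x) = 0" for r
      proof -
        have "set_lebesgue_integral half_line {..<of_rat r} (\<lambda>x. of_bool (x < real (Suc N)) * h x)
            = (LINT x|half_line. of_bool (x < of_rat (min r (of_nat (Suc N)))) * h x)"
          unfolding set_lebesgue_integral_def
        proof (intro Bochner_Integration.integral_cong refl)
          fix x
          have "of_rat (min r (of_nat (Suc N))) = min (of_rat r) (real (Suc N))"
            using of_rat_less_eq[of r "of_nat (Suc N)", where ?'a = real]
            by (simp add: min_def del: of_nat_Suc)
          then show "indicator {..<of_rat r} x *\<^sub>R (of_bool (x < real (Suc N)) * h x) = of_bool (x < of_rat (min r (of_nat (Suc N)))) * h x"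
            by (auto split: split_indicator simp del: of_nat_Suc)
        qed
        then show ?thesis by (simp only: int0)
      qed
    qed
    then have "AE x in half_line. \<forall>N. of_bool (x < real (Suc N)) * h x = 0"
      by (subst AE_all_countable) blast
    then show "AE x in half_line. h x = 0"
    proof eventually_elim
      case (elim x)
      obtain N where "x < real N" using reals_Archimedean2 by blast
      then have "x < real (Suc N)" by simp
      with elim[rule_format, of N] show ?case by simp
    qed
  qed (rule gram_schmidt_L2[OF w_L2 indep] gram_schmidt_orthonormal[OF w_L2 indep])+
  then show ?thesis by blast
qed

section \<open>Volterra equations\<close>

lemma borel_measurable_half_lineI:
  "f \<in> measurable borel N \<Longrightarrow> f \<in> measurable half_line N"
  by (intro measurable_restrict_space1 measurable_completion) simp

lemma measurable_ident_half_line [measurable]: "(\<lambda>x. x) \<in> measurable half_line borel"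
  by (rule borel_measurable_half_lineI) measurable

lemma measurable_fst_half_line [measurable]: "fst \<in> measurable (half_line \<Otimes>\<^sub>M M) borel"
  using measurable_compose[OF measurable_fst[of half_line M] measurable_ident_half_line] .

lemma measurable_snd_half_line [measurable]: "snd \<in> measurable (M \<Otimes>\<^sub>M half_line) borel"
  using measurable_compose[OF measurable_snd[of M half_line] measurable_ident_half_line] .

text \<open>One theory for two equations: \<open>R t x\<close> says that \<open>t\<close> belongs to
  the range of integration at \<open>x\<close>, which is \<open>x < t\<close> for the Jost solution
  and \<open>t < x\<close> for the regular one. The factorial bounds rest on \<open>R\<close> being
  transitive and asymmetric.\<close>

locale volterra =
  fixes V :: "real \<Rightarrow> complex" and q :: "real \<Rightarrow> real \<Rightarrow> complex" and R :: "real \<Rightarrow> real \<Rightarrow> bool"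
    and f0 :: "real \<Rightarrow> complex" and C B :: real
  assumes V: "integrable half_line V"
    and q_measurable: "(\<lambda>(x, t). q x t) \<in> borel_measurable (borel \<Otimes>\<^sub>M borel)"
    and R_measurable: "Measurable.pred (borel \<Otimes>\<^sub>M borel) (\<lambda>(t, x). R t x)"
    and f0_measurable [measurable]: "f0 \<in> borel_measurable borel"
    and q_bound: "\<And>x t. 0 \<le> x \<Longrightarrow> 0 < t \<Longrightarrow> R t x \<Longrightarrow> cmod (q x t) \<le> C"
    and f0_bound: "\<And>x. 0 \<le> x \<Longrightarrow> cmod (f0 x) \<le> B"
    and C_nonneg: "0 \<le> C"
    and R_trans: "\<And>s t x. R s t \<Longrightarrow> R t x \<Longrightarrow> R s x"
    and R_asym: "\<And>t x. R t x \<Longrightarrow> \<not> R x t"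
begin

lemma V_measurable [measurable]: "V \<in> borel_measurable half_line"
  using V by auto

lemma R_measurable' [measurable (raw)]:
  assumes "f \<in> measurable M borel" "g \<in> measurable M borel"
  shows "Measurable.pred M (\<lambda>y. R (f y) (g y))"
  using measurable_compose[OF measurable_Pair[OF assms] R_measurable] by simp

lemma q_measurable' [measurable (raw)]:
  assumes "f \<in> measurable M borel" "g \<in> measurable M borel"
  shows "(\<lambda>y. q (f y) (g y)) \<in> borel_measurable M"
  using measurable_compose[OF measurable_Pair[OF assms] q_measurable] by simp

definition "\<rho> t = ennreal (C * cmod (V t))"

lemma \<rho>_measurable [measurable]: "\<rho> \<in> borel_measurable half_line"
  unfolding \<rho>_def by measurable

text \<open>The integral of a product of \<open>n\<close> factors \<open>\<rho>\<close> over the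
  chains of \<open>R\<close> that end at \<open>x\<close>. With values in \<open>ennreal\<close>,
  Tonelli's theorem applies without integrability conditions.\<close>

primrec \<nu> :: "nat \<Rightarrow> real \<Rightarrow> ennreal" where
  "\<nu> 0 x = 1"
| "\<nu> (Suc n) x = (\<integral>\<^sup>+t. \<rho> t * of_bool (R t x) * \<nu> n t \<partial>half_line)"

lemma \<nu>_measurable [measurable]: "\<nu> n \<in> borel_measurable borel"
proof (induction n)
  case (Suc n)
  note Suc [measurable]
  show ?case by simp measurable
qed simp

text \<open>In the double integral of \<open>\<rho> t * \<rho> r * \<nu> n t\<close> over \<open>R t x\<close> and \<open>R r x\<close>, the part with \<open>R t r\<close>
  is \<open>\<nu> (Suc (Suc n)) x\<close> and the part with \<open>R r t\<close> is controlled by the induction hypothesis. Iterating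
  the estimate gives \<open>\<nu> n x \<le> w\<^sup>n / n!\<close>.\<close>

lemma \<nu>_Suc_le: "of_nat (Suc n) * \<nu> (Suc n) x \<le> \<nu> 1 x * \<nu> n x"
proof (induction n arbitrary: x)
  case (Suc n)
  have "\<nu> (Suc (Suc n)) x = (\<integral>\<^sup>+r. (\<integral>\<^sup>+t. \<rho> r * of_bool (R r x) * (\<rho> t * of_bool (R t r) * \<nu> n t) \<partial>half_line) \<partial>half_line)"
    by (simp add: nn_integral_cmult)
  also have "\<dots> = (\<integral>\<^sup>+t. (\<integral>\<^sup>+r. \<rho> r * of_bool (R r x) * (\<rho> t * of_bool (R t r) * \<nu> n t) \<partial>half_line) \<partial>half_line)"
    by (rule half_line_pair.Fubini'[symmetric]) measurable
  finally have swap: "\<nu> (Suc (Suc n)) x = (\<integral>\<^sup>+t. (\<integral>\<^sup>+r. \<rho> r * of_bool (R r x) * (\<rho> t * of_bool (R t r) * \<nu> n t) \<partial>half_line) \<partial>half_line)" .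
  have "of_nat (Suc (Suc n)) * \<nu> (Suc (Suc n)) x
      = \<nu> (Suc (Suc n)) x + (\<integral>\<^sup>+t. \<rho> t * of_bool (R t x) * (of_nat (Suc n) * \<nu> (Suc n) t) \<partial>half_line)"
  proof -
    have "(\<integral>\<^sup>+t. \<rho> t * of_bool (R t x) * (of_nat (Suc n) * \<nu> (Suc n) t) \<partial>half_line)
       = (\<integral>\<^sup>+t. of_nat (Suc n) * (\<rho> t * of_bool (R t x) * \<nu> (Suc n) t) \<partial>half_line)"
      by (simp only: mult_ac)
    also have "\<dots> = of_nat (Suc n) * \<nu> (Suc (Suc n)) x"
      unfolding \<nu>.simps(2)[of "Suc n"] by (rule nn_integral_cmult) measurable
    finally show ?thesis by (simp only: of_nat_Suc[of "Suc n"] distrib_right mult_1_left)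
  qed
  also have "\<dots> \<le> \<nu> (Suc (Suc n)) x + (\<integral>\<^sup>+t. \<rho> t * of_bool (R t x) * (\<nu> 1 t * \<nu> n t) \<partial>half_line)"
    by (intro add_left_mono nn_integral_mono mult_left_mono Suc) auto
  also have "\<dots> = (\<integral>\<^sup>+t. (\<integral>\<^sup>+r. \<rho> r * of_bool (R r x) * (\<rho> t * of_bool (R t r) * \<nu> n t) \<partial>half_line)
              + (\<integral>\<^sup>+r. \<rho> t * of_bool (R t x) * (\<rho> r * of_bool (R r t) * \<nu> n t) \<partial>half_line) \<partial>half_line)"
    unfolding swap by (subst nn_integral_add) (simp_all add: nn_integral_cmult nn_integral_multc)
  also have "\<dots> = (\<integral>\<^sup>+t. (\<integral>\<^sup>+r. \<rho> r * of_bool (R r x) * (\<rho> t * of_bool (R t r) * \<nu> n t)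
              + \<rho> t * of_bool (R t x) * (\<rho> r * of_bool (R r t) * \<nu> n t) \<partial>half_line) \<partial>half_line)"
    by (intro nn_integral_cong nn_integral_add[symmetric]) measurable
  also have "\<dots> \<le> (\<integral>\<^sup>+t. (\<integral>\<^sup>+r. \<rho> t * of_bool (R t x) * \<nu> n t * (\<rho> r * of_bool (R r x)) \<partial>half_line) \<partial>half_line)"
  \<comment> \<open>By transitivity both summands live where \<open>R t x\<close> and
    \<open>R r x\<close> hold, and by asymmetry at most one of them is nonzero.\<close>
  proof (intro nn_integral_mono)
    fix t r
    show "\<rho> r * of_bool (R r x) * (\<rho> t * of_bool (R t r) * \<nu> n t) + \<rho> t * of_bool (R t x) * (\<rho> r * of_bool (R r t) * \<nu> n t)
       \<le> \<rho> t * of_bool (R t x) * \<nu> n t * (\<rho> r * of_bool (R r x))"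
      using R_trans[of t r x] R_trans[of r t x] R_asym[of t r]
      by (cases "R t r"; cases "R r t"; cases "R r x"; cases "R t x") (auto simp: mult_ac)
  qed
  also have "\<dots> = \<nu> 1 x * \<nu> (Suc n) x"
    by (simp add: nn_integral_cmult nn_integral_multc mult.commute)
  finally show ?case .
qed simp

definition "w = C * (LINT t|half_line. cmod (V t))"

lemma w_nonneg: "0 \<le> w"
  unfolding w_def using C_nonneg by simp

lemma nn_integral_\<rho>: "(\<integral>\<^sup>+t. \<rho> t \<partial>half_line) = ennreal w"
  unfolding w_def \<rho>_def using V C_nonneg
  by (subst nn_integral_eq_integral) auto

lemma \<nu>_1_le: "\<nu> 1 x \<le> ennreal w"
  unfolding nn_integral_\<rho>[symmetric] One_nat_def \<nu>.simps
  by (intro nn_integral_mono) auto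

lemma \<nu>_le: "\<nu> n x \<le> ennreal (w ^ n / fact n)"
proof (induction n)
  case (Suc n)
  have "of_nat (Suc n) * \<nu> (Suc n) x \<le> ennreal w * ennreal (w ^ n / fact n)"
    by (rule order.trans[OF \<nu>_Suc_le]) (intro mult_mono \<nu>_1_le Suc; simp)
  also have "\<dots> = ennreal (w * (w ^ n / fact n))"
    using w_nonneg by (intro ennreal_mult[symmetric]) auto
  also have "w * (w ^ n / fact n) = real (Suc n) * (w ^ Suc n / fact (Suc n))"
    by (simp add: fact_Suc del: of_nat_Suc)
  also have "ennreal \<dots> = of_nat (Suc n) * ennreal (w ^ Suc n / fact (Suc n))"
    unfolding ennreal_of_nat_eq_real_of_nat using w_nonneg by (intro ennreal_mult) auto
  finally show ?case
    by (subst (asm) ennreal_mult_le_mult_iff) (simp_all add: ennreal_of_nat_eq_real_of_nat del: of_nat_Suc)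
qed simp

section \<open>The Picard series: convergence, existence and uniqueness\<close>

primrec picard :: "nat \<Rightarrow> real \<Rightarrow> complex" where
  "picard 0 x = f0 x"
| "picard (Suc n) x = (LINT t|half_line. q x t * V t * of_bool (R t x) * picard n t)"

lemma picard_measurable [measurable]: "picard n \<in> borel_measurable borel"
proof (induction n)
  case (Suc n)
  note Suc [measurable]
  show ?case by simp measurable
qed (simp add: f0_measurable)

lemma B_nonneg: "0 \<le> B"
  using f0_bound[of 0] norm_ge_zero order.trans by blast

lemma kernel_bound:
  assumes "0 \<le> x" "0 < t" "cmod h \<le> b"
  shows "cmod (q x t * V t * of_bool (R t x) * h) \<le> b * (C * cmod (V t))"
proof (cases "R t x")
  case True
  have "cmod (q x t) * cmod (V t) * cmod h \<le> C * cmod (V t) * b"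
    using assms True by (intro mult_mono q_bound) (auto simp: C_nonneg)
  with True show ?thesis by (simp add: norm_mult mult_ac)
next
  case False
  have "0 \<le> b" using assms(3) norm_ge_zero order.trans by blast
  with False show ?thesis by (simp add: C_nonneg)
qed

lemma kernel_integrable:
  assumes [measurable]: "h \<in> borel_measurable half_line" and "\<And>t. 0 < t \<Longrightarrow> cmod (h t) \<le> b" "0 \<le> x"
  shows "integrable half_line (\<lambda>t. q x t * V t * of_bool (R t x) * h t)"
proof (rule Bochner_Integration.integrable_bound)
  show "integrable half_line (\<lambda>t. b * (C * cmod (V t)))" using V by simp
  show "AE t in half_line. norm (q x t * V t * of_bool (R t x) * h t) \<le> norm (b * (C * cmod (V t)))"
    using assms kernel_bound by (intro AE_I2) (force intro: order.trans[OF _ abs_ge_self])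
qed measurable

text \<open>The induction step shared by the bound on the Picard iterates and by uniqueness, where
  \<open>h\<close> is the difference of two solutions.\<close>

lemma kernel_nn_bound:
  assumes "integrable half_line (\<lambda>t. q x t * V t * of_bool (R t x) * h t)"
    and "0 \<le> x" "0 \<le> b" "\<And>t. 0 < t \<Longrightarrow> ennreal (cmod (h t)) \<le> ennreal b * \<nu> n t"
  shows "ennreal (cmod (LINT t|half_line. q x t * V t * of_bool (R t x) * h t)) \<le> ennreal b * \<nu> (Suc n) x"
proof -
  have "ennreal (cmod (LINT t|half_line. q x t * V t * of_bool (R t x) * h t))
      \<le> (\<integral>\<^sup>+t. ennreal (cmod (q x t * V t * of_bool (R t x) * h t)) \<partial>half_line)"
    by (rule integral_norm_bound_ennreal[OF assms(1)])
  also have "\<dots> \<le> (\<integral>\<^sup>+t. ennreal b * (\<rho> t * of_bool (R t x) * \<nu> n t) \<partial>half_line)"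
  proof (rule nn_integral_mono)
    fix t assume "t \<in> space half_line"
    then have t: "0 < t" by simp
    show "ennreal (cmod (q x t * V t * of_bool (R t x) * h t)) \<le> ennreal b * (\<rho> t * of_bool (R t x) * \<nu> n t)"
    proof (cases "R t x")
      case True
      have "ennreal (cmod (q x t * V t * of_bool (R t x) * h t)) \<le> ennreal (cmod (h t) * (C * cmod (V t)))"
        using kernel_bound[OF assms(2) t order.refl] by (intro ennreal_leI)
      also have "\<dots> = ennreal (cmod (h t)) * \<rho> t" by (simp add: \<rho>_def C_nonneg ennreal_mult)
      also have "\<dots> \<le> ennreal b * \<nu> n t * \<rho> t" using assms(4)[OF t] by (intro mult_right_mono) auto
      finally show ?thesis using True by (simp add: mult_ac)
    qed simp
  qed
  also have "\<dots> = ennreal b * \<nu> (Suc n) x" by (simp add: nn_integral_cmult)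
  finally show ?thesis .
qed

lemma cmod_le_if_\<nu>:
  assumes "ennreal (cmod h) \<le> ennreal b * \<nu> n x" "0 \<le> b"
  shows "cmod h \<le> b * (w ^ n / fact n)"
proof -
  have "ennreal (cmod h) \<le> ennreal b * ennreal (w ^ n / fact n)"
    using assms(1) by (rule order.trans) (intro mult_left_mono \<nu>_le; simp)
  also have "\<dots> = ennreal (b * (w ^ n / fact n))"
    using assms(2) w_nonneg by (intro ennreal_mult[symmetric]) auto
  finally show ?thesis by (subst (asm) ennreal_le_iff) (auto simp: assms w_nonneg)
qed

lemma picard_nn_bound: "0 \<le> x \<Longrightarrow> ennreal (cmod (picard n x)) \<le> ennreal B * \<nu> n x"
proof (induction n arbitrary: x)
  case 0
  then show ?case by (simp add: f0_bound ennreal_leI)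
next
  case (Suc n)
  show ?case unfolding picard.simps
  proof (rule kernel_nn_bound)
    show "integrable half_line (\<lambda>t. q x t * V t * of_bool (R t x) * picard n t)"
      using cmod_le_if_\<nu>[OF Suc.IH] B_nonneg Suc.prems by (intro kernel_integrable[where b = "B * (w ^ n / fact n)"]) auto
  qed (use Suc B_nonneg in auto)
qed

lemma picard_bound: "0 \<le> x \<Longrightarrow> cmod (picard n x) \<le> B * (w ^ n / fact n)"
  by (rule cmod_le_if_\<nu>[OF picard_nn_bound B_nonneg])

lemma exp_series: "(\<lambda>n. B * (w ^ n / fact n)) sums (B * exp w)"
  using sums_mult[OF exp_converges[of w], of B] by (simp add: field_simps scaleR_conv_of_real)

lemma picard_summable: "0 \<le> x \<Longrightarrow> summable (\<lambda>n. cmod (picard n x))"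
  by (rule summable_comparison_test'[OF sums_summable[OF exp_series], where N = 0]) (use picard_bound in simp)

definition "solution x = (\<Sum>n. picard n x)"

lemma solution_measurable [measurable]: "solution \<in> borel_measurable borel"
  unfolding solution_def by measurable

lemma solution_sums: "0 \<le> x \<Longrightarrow> (\<lambda>n. picard n x) sums solution x"
  unfolding solution_def by (rule summable_sums[OF summable_norm_cancel[OF picard_summable]])

lemma partial_sum_bound: "0 \<le> x \<Longrightarrow> cmod (\<Sum>n<N. picard n x) \<le> B * exp w"
proof -
  assume x: "0 \<le> x"
  have "cmod (\<Sum>n<N. picard n x) \<le> (\<Sum>n<N. B * (w ^ n / fact n))"
    using x by (intro sum_norm_le picard_bound)
  also have "\<dots> \<le> (\<Sum>n. B * (w ^ n / fact n))"
    using B_nonneg w_nonneg by (intro sum_le_suminf sums_summable[OF exp_series]) auto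
  also have "\<dots> = B * exp w" by (rule sums_unique[OF exp_series, symmetric])
  finally show ?thesis .
qed

lemma solution_bound:
  assumes "0 \<le> x" shows "cmod (solution x) \<le> B * exp w"
proof (rule LIMSEQ_le_const2)
  show "(\<lambda>N. cmod (\<Sum>n<N. picard n x)) \<longlonglongrightarrow> cmod (solution x)"
    using solution_sums[OF assms] unfolding sums_def by (rule tendsto_norm)
qed (use partial_sum_bound assms in auto)

lemma solution_integrable: "0 \<le> x \<Longrightarrow> integrable half_line (\<lambda>t. q x t * V t * of_bool (R t x) * solution t)"
  by (rule kernel_integrable[where b = "B * exp w"]) (auto intro: solution_bound)

text \<open>The partial sums are bounded by \<open>B * exp w\<close> for all \<open>x\<close>, so
  dominated convergence moves the sum through the integral. The shift of the index accounts for
  \<open>f0\<close>.\<close>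

lemma solution_eq:
  assumes x: "0 \<le> x"
  shows "solution x = f0 x + (LINT t|half_line. q x t * V t * of_bool (R t x) * solution t)"
proof -
  let ?k = "\<lambda>t. q x t * V t * of_bool (R t x)"
  have "(\<lambda>N. LINT t|half_line. ?k t * (\<Sum>n<N. picard n t)) \<longlonglongrightarrow> (LINT t|half_line. ?k t * solution t)"
  proof (rule integral_dominated_convergence)
    show "integrable half_line (\<lambda>t. B * exp w * (C * cmod (V t)))" using V by simp
    show "AE t in half_line. (\<lambda>N. ?k t * (\<Sum>n<N. picard n t)) \<longlonglongrightarrow> ?k t * solution t"
      using solution_sums by (intro AE_I2 tendsto_mult_left) (auto simp: sums_def)
    show "AE t in half_line. norm (?k t * (\<Sum>n<N. picard n t)) \<le> B * exp w * (C * cmod (V t))" for N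
      using x by (intro AE_I2 kernel_bound partial_sum_bound) auto
  qed measurable
  moreover have "(LINT t|half_line. ?k t * (\<Sum>n<N. picard n t)) = (\<Sum>n<N. picard (Suc n) x)" for N
  proof -
    have "integrable half_line (\<lambda>t. ?k t * picard n t)" for n
      using x picard_bound by (intro kernel_integrable[where b = "B * (w ^ n / fact n)"]) auto
    then show ?thesis by (simp add: sum_distrib_left)
  qed
  ultimately have "(\<lambda>n. picard (Suc n) x) sums (LINT t|half_line. ?k t * solution t)"
    by (simp add: sums_def)
  then have "(\<lambda>n. picard n x) sums ((LINT t|half_line. ?k t * solution t) + picard 0 x)"
    using sums_Suc_iff[of "\<lambda>n. picard n x"] by blast
  from sums_unique2[OF solution_sums[OF x] this] show ?thesis by simp
qed

text \<open>The difference of two bounded solutions solves the homogeneous equation. Boundedness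
  starts an induction that bounds it by a constant times \<open>\<nu> n\<close> for every
  \<open>n\<close>, which tends to zero.\<close>

lemma solution_unique:
  assumes int: "\<And>x. 0 \<le> x \<Longrightarrow> integrable half_line (\<lambda>t. q x t * V t * of_bool (R t x) * d t)"
    and eq: "\<And>x. 0 \<le> x \<Longrightarrow> d x = f0 x + (LINT t|half_line. q x t * V t * of_bool (R t x) * d t)"
    and bound: "\<And>x. 0 \<le> x \<Longrightarrow> cmod (d x) \<le> D"
    and x: "0 \<le> x"
  shows "d x = solution x"
proof -
  let ?h = "\<lambda>x. d x - solution x" and ?b = "D + B * exp w"
  have "0 \<le> D" using bound[of 0] norm_ge_zero order.trans by blast
  then have b: "0 \<le> ?b" using B_nonneg by simp
  have h_int: "integrable half_line (\<lambda>t. q x t * V t * of_bool (R t x) * ?h t)" if "0 \<le> x" for x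
    using Bochner_Integration.integrable_diff[OF int[OF that] solution_integrable[OF that]] by (simp add: algebra_simps)
  have h_eq: "?h x = (LINT t|half_line. q x t * V t * of_bool (R t x) * ?h t)" if "0 \<le> x" for x
    using eq[OF that] solution_eq[OF that] int[OF that] solution_integrable[OF that]
    by (simp add: right_diff_distrib)
  have "ennreal (cmod (?h x)) \<le> ennreal ?b * \<nu> n x" if "0 \<le> x" for n x
    using that
  proof (induction n arbitrary: x)
    case 0
    have "cmod (?h x) \<le> ?b"
      using norm_triangle_ineq4[of "d x" "solution x"] bound[OF 0] solution_bound[OF 0] by linarith
    then show ?case by (simp add: ennreal_leI)
  next
    case (Suc n)
    show ?case
      unfolding h_eq[OF Suc.prems] by (rule kernel_nn_bound[OF h_int]) (use Suc b in auto)
  qed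
  then have "cmod (?h x) \<le> ?b * (w ^ n / fact n)" for n
    using x b by (intro cmod_le_if_\<nu>) auto
  moreover have "(\<lambda>n. ?b * (w ^ n / fact n)) \<longlonglongrightarrow> ?b * 0"
    using summable_LIMSEQ_zero[OF sums_summable[OF exp_converges[of w]]]
    by (intro tendsto_mult_left) (simp add: field_simps)
  ultimately have "cmod (?h x) \<le> ?b * 0"
    by (intro LIMSEQ_le_const[where x = "?b * 0"]) auto
  then show ?thesis by simp
qed

end

section \<open>Traces of exterior powers\<close>

text \<open>Both integrals equal \<open>\<integral>\<integral> (\<Prod>a\<in>I. F (l a) (x a) * G (l a) (x (p a)))\<close>, the integration over \<open>l\<close>
  or over \<open>x\<close> being performed first.\<close>

lemma
  fixes F G :: "'l \<Rightarrow> 'a \<Rightarrow> complex" and \<alpha> \<beta> :: "'l \<Rightarrow> real" and p :: "'i \<Rightarrow> 'i"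
  assumes M: "sigma_finite_measure M" and N: "sigma_finite_measure N"
    and F: "(\<lambda>(l, x). F l x) \<in> borel_measurable (N \<Otimes>\<^sub>M M)"
    and G: "(\<lambda>(l, x). G l x) \<in> borel_measurable (N \<Otimes>\<^sub>M M)"
    and nonneg: "\<And>l. 0 \<le> \<alpha> l" "\<And>l. 0 \<le> \<beta> l"
    and \<alpha>\<beta>: "integrable N (\<lambda>l. \<alpha> l * \<beta> l)"
    and FG: "\<And>l l'. l \<in> space N \<Longrightarrow> l' \<in> space N \<Longrightarrow> integrable M (\<lambda>x. F l x * G l' x)"
    and bound: "\<And>l l'. l \<in> space N \<Longrightarrow> l' \<in> space N \<Longrightarrow> (LINT x|M. cmod (F l x * G l' x)) \<le> \<alpha> l * \<beta> l'"
    and K: "\<And>x y. x \<in> space M \<Longrightarrow> y \<in> space M \<Longrightarrow> integrable N (\<lambda>l. F l x * G l y)"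
    and I: "finite I" and p: "p permutes I"
  shows integrable_cyclic_product: "integrable (PiM I (\<lambda>_. M)) (\<lambda>x. \<Prod>a\<in>I. (LINT l|N. F l (x a) * G l (x (p a))))"
    and integral_cyclic_product: "(LINT x|PiM I (\<lambda>_. M). (\<Prod>a\<in>I. (LINT l|N. F l (x a) * G l (x (p a)))))
      = (LINT l|PiM I (\<lambda>_. N). (\<Prod>a\<in>I. (LINT x|M. F (l a) x * G (l (inv p a)) x)))"
proof -
  interpret PM: product_sigma_finite "\<lambda>_. M" using M by (simp add: product_sigma_finite_def)
  interpret PN: product_sigma_finite "\<lambda>_. N" using N by (simp add: product_sigma_finite_def)
  interpret P: pair_sigma_finite "PiM I (\<lambda>_. M)" "PiM I (\<lambda>_. N)"
    using PM.sigma_finite[OF I] PN.sigma_finite[OF I] by (simp add: pair_sigma_finite_def)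
  have pI: "p a \<in> I" if "a \<in> I" for a using p that by (simp add: permutes_in_image)
  have p': "inv p permutes I" by (rule permutes_inv[OF p])
  have p'I: "inv p a \<in> I" if "a \<in> I" for a using p' that by (simp add: permutes_in_image)
  define H where "H x l = (\<Prod>a\<in>I. F (l a) (x a) * G (l a) (x (p a)))" for x :: "'i \<Rightarrow> 'a" and l :: "'i \<Rightarrow> 'l"
  \<comment> \<open>Grouped by the variable \<open>x a\<close> instead of \<open>l a\<close>: each
    grouping makes the integral over one family of variables a product of single integrals.\<close>
  have H': "H x l = (\<Prod>a\<in>I. F (l a) (x a) * G (l (inv p a)) (x a))" for x l
  proof -
    have "(\<Prod>a\<in>I. G (l a) (x (p a))) = (\<Prod>a\<in>I. G (l (inv p a)) (x (p (inv p a))))"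
      using prod.permute[OF p', of "\<lambda>a. G (l a) (x (p a))"] by (simp add: o_def)
    then show ?thesis
      by (simp add: H_def prod.distrib permutes_inverses(1)[OF p])
  qed
  have [measurable]: "(\<lambda>z. F (snd z a) (fst z b)) \<in> borel_measurable (PiM I (\<lambda>_. M) \<Otimes>\<^sub>M PiM I (\<lambda>_. N))"
    if "a \<in> I" "b \<in> I" for a b
  proof -
    have "(\<lambda>z. (snd z a, fst z b)) \<in> measurable (PiM I (\<lambda>_. M) \<Otimes>\<^sub>M PiM I (\<lambda>_. N)) (N \<Otimes>\<^sub>M M)"
      using that by measurable
    from measurable_compose[OF this F] show ?thesis by simp
  qed
  have [measurable]: "(\<lambda>z. G (snd z a) (fst z b)) \<in> borel_measurable (PiM I (\<lambda>_. M) \<Otimes>\<^sub>M PiM I (\<lambda>_. N))"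
    if "a \<in> I" "b \<in> I" for a b
  proof -
    have "(\<lambda>z. (snd z a, fst z b)) \<in> measurable (PiM I (\<lambda>_. M) \<Otimes>\<^sub>M PiM I (\<lambda>_. N)) (N \<Otimes>\<^sub>M M)"
      using that by measurable
    from measurable_compose[OF this G] show ?thesis by simp
  qed
  have meas: "(\<lambda>z. H (fst z) (snd z)) \<in> borel_measurable (PiM I (\<lambda>_. M) \<Otimes>\<^sub>M PiM I (\<lambda>_. N))"
    unfolding H_def using pI by (intro borel_measurable_prod borel_measurable_times) auto
  have inner: "(\<integral>\<^sup>+x. ennreal (cmod (H x l)) \<partial>PiM I (\<lambda>_. M)) \<le> (\<Prod>a\<in>I. ennreal (\<alpha> (l a) * \<beta> (l a)))"
    if l: "l \<in> space (PiM I (\<lambda>_. N))" for l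
  proof -
    have la: "l a \<in> space N" if "a \<in> I" for a using l that by (auto simp: space_PiM)
    have "(\<integral>\<^sup>+x. ennreal (cmod (H x l)) \<partial>PiM I (\<lambda>_. M))
        = (\<integral>\<^sup>+x. (\<Prod>a\<in>I. ennreal (cmod (F (l a) (x a) * G (l (inv p a)) (x a)))) \<partial>PiM I (\<lambda>_. M))"
      by (simp add: H' prod_norm[symmetric] prod_ennreal)
    also have "\<dots> = (\<Prod>a\<in>I. \<integral>\<^sup>+x. ennreal (cmod (F (l a) x * G (l (inv p a)) x)) \<partial>M)"
      using FG[OF la la] p'I by (intro PM.product_nn_integral_prod I) auto
    also have "\<dots> = (\<Prod>a\<in>I. ennreal (LINT x|M. cmod (F (l a) x * G (l (inv p a)) x)))"
      using FG[OF la la] p'I by (intro prod.cong refl nn_integral_eq_integral) auto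
    also have "\<dots> = ennreal (\<Prod>a\<in>I. (LINT x|M. cmod (F (l a) x * G (l (inv p a)) x)))"
      by (rule prod_ennreal) simp
    also have "\<dots> \<le> ennreal (\<Prod>a\<in>I. \<alpha> (l a) * \<beta> (l (inv p a)))"
      using p'I by (intro ennreal_leI prod_mono conjI bound la) auto
    \<comment> \<open>The permutation only reorders the factors \<open>\<beta>\<close>, so the bound
      decouples into functions of one variable and no longer involves \<open>p\<close>.\<close>
    also have "\<dots> = (\<Prod>a\<in>I. ennreal (\<alpha> (l a) * \<beta> (l a)))"
      using prod.permute[OF p', of "\<lambda>a. \<beta> (l a)"] nonneg
      by (simp add: prod_ennreal prod.distrib o_def)
    finally show ?thesis .
  qed
  have int: "integrable (PiM I (\<lambda>_. M) \<Otimes>\<^sub>M PiM I (\<lambda>_. N)) (\<lambda>z. H (fst z) (snd z))"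
  proof (intro integrableI_bounded meas)
    have "(\<integral>\<^sup>+z. ennreal (norm (H (fst z) (snd z))) \<partial>(PiM I (\<lambda>_. M) \<Otimes>\<^sub>M PiM I (\<lambda>_. N)))
        = (\<integral>\<^sup>+l. (\<integral>\<^sup>+x. ennreal (cmod (H x l)) \<partial>PiM I (\<lambda>_. M)) \<partial>PiM I (\<lambda>_. N))"
      using meas by (subst P.nn_integral_snd[symmetric]) auto
    also have "\<dots> \<le> (\<integral>\<^sup>+l. (\<Prod>a\<in>I. ennreal (\<alpha> (l a) * \<beta> (l a))) \<partial>PiM I (\<lambda>_. N))"
      by (intro nn_integral_mono inner)
    also have "\<dots> = (\<Prod>a\<in>I. \<integral>\<^sup>+l. ennreal (\<alpha> l * \<beta> l) \<partial>N)"
      using \<alpha>\<beta> by (intro PN.product_nn_integral_prod I) auto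
    also have "\<dots> = (\<Prod>a\<in>I. ennreal (LINT l|N. \<alpha> l * \<beta> l))"
      using \<alpha>\<beta> nonneg by (subst nn_integral_eq_integral) auto
    also have "\<dots> = ennreal (\<Prod>a\<in>I. (LINT l|N. \<alpha> l * \<beta> l))"
      using nonneg by (intro prod_ennreal Bochner_Integration.integral_nonneg) auto
    also have "\<dots> < \<infinity>" by simp
    finally show "(\<integral>\<^sup>+z. ennreal (norm (H (fst z) (snd z))) \<partial>(PiM I (\<lambda>_. M) \<Otimes>\<^sub>M PiM I (\<lambda>_. N))) < \<infinity>" .
  qed
  then have int': "integrable (PiM I (\<lambda>_. M) \<Otimes>\<^sub>M PiM I (\<lambda>_. N)) (case_prod H)"
    by (simp add: case_prod_beta')
  have overN: "(LINT l|PiM I (\<lambda>_. N). H x l) = (\<Prod>a\<in>I. (LINT l|N. F l (x a) * G l (x (p a))))"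
    if "x \<in> space (PiM I (\<lambda>_. M))" for x
    unfolding H_def using that pI by (intro PN.product_integral_prod I K) (auto simp: space_PiM)
  have overM: "(LINT x|PiM I (\<lambda>_. M). H x l) = (\<Prod>a\<in>I. (LINT x|M. F (l a) x * G (l (inv p a)) x))"
    if "l \<in> space (PiM I (\<lambda>_. N))" for l
    unfolding H' using that p'I by (intro PM.product_integral_prod I FG) (auto simp: space_PiM)
  have "integrable (PiM I (\<lambda>_. M)) (\<lambda>x. LINT l|PiM I (\<lambda>_. N). H x l)"
    using P.integrable_fst[OF int'] .
  then show "integrable (PiM I (\<lambda>_. M)) (\<lambda>x. \<Prod>a\<in>I. (LINT l|N. F l (x a) * G l (x (p a))))"
    by (subst Bochner_Integration.integrable_cong[OF refl overN[symmetric]])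
  show "(LINT x|PiM I (\<lambda>_. M). (\<Prod>a\<in>I. (LINT l|N. F l (x a) * G l (x (p a)))))
      = (LINT l|PiM I (\<lambda>_. N). (\<Prod>a\<in>I. (LINT x|M. F (l a) x * G (l (inv p a)) x)))"
    using P.Fubini_integral[OF int']
    by (simp add: overM overN cong: Bochner_Integration.integral_cong)
qed

text \<open>The value sees \<open>F\<close> and \<open>G\<close> only through the integrals of
  \<open>F l * G l'\<close>. Different measure spaces with the same integrals therefore give the
  same result; the half-line and the counting measure on basis indices are such a pair.\<close>

lemma
  fixes F G :: "nat \<Rightarrow> 'a \<Rightarrow> complex" and \<alpha> \<beta> :: "nat \<Rightarrow> real"
  assumes M: "sigma_finite_measure M"
    and FG: "\<And>l l'. F l \<in> borel_measurable M" "\<And>l l'. G l \<in> borel_measurable M"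
      "\<And>l l'. integrable M (\<lambda>x. F l x * G l' x)"
    and bound: "\<And>l l'. (LINT x|M. cmod (F l x * G l' x)) \<le> \<alpha> l * \<beta> l'"
    and nonneg: "\<And>l. 0 \<le> \<alpha> l" "\<And>l. 0 \<le> \<beta> l"
    and \<alpha>\<beta>: "summable (\<lambda>l. \<alpha> l * \<beta> l)"
    and K: "\<And>x y. x \<in> space M \<Longrightarrow> y \<in> space M \<Longrightarrow> summable (\<lambda>l. cmod (F l x * G l y))"
    and I: "finite I"
  shows integrable_det_on: "integrable (PiM I (\<lambda>_. M)) (\<lambda>x. det_on I (\<lambda>a b. \<Sum>l. F l (x a) * G l (x b)))"
    and integral_det_on: "(LINT x|PiM I (\<lambda>_. M). det_on I (\<lambda>a b. \<Sum>l. F l (x a) * G l (x b)))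
      = (\<Sum>p | p permutes I. of_int (sign p) *
          (LINT l|PiM I (\<lambda>_. count_space UNIV). (\<Prod>a\<in>I. (LINT x|M. F (l a) x * G (l (inv p a)) x))))"
proof -
  let ?N = "count_space UNIV :: nat measure"
  have N: "sigma_finite_measure ?N" by (intro sigma_finite_measure_count_space)
  have m: "(\<lambda>(l, x). F l x) \<in> borel_measurable (?N \<Otimes>\<^sub>M M)" "(\<lambda>(l, x). G l x) \<in> borel_measurable (?N \<Otimes>\<^sub>M M)"
    using FG by (auto intro!: measurable_pair_measure_countable1)
  have ab: "integrable ?N (\<lambda>l. \<alpha> l * \<beta> l)"
    using \<alpha>\<beta> nonneg by (simp add: integrable_count_space_nat_iff)
  have K': "integrable ?N (\<lambda>l. F l x * G l y)" if "x \<in> space M" "y \<in> space M" for x y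
    using K[OF that] by (simp add: integrable_count_space_nat_iff)
  note cyc = M N m nonneg ab FG(3) bound K' I
  have sum: "(\<Prod>a\<in>I. (\<Sum>l. F l (x a) * G l (x (p a)))) = (\<Prod>a\<in>I. (LINT l|?N. F l (x a) * G l (x (p a))))"
    if p: "p permutes I" and x: "x \<in> space (PiM I (\<lambda>_. M))" for p x
  proof (intro prod.cong refl integral_count_space_nat[symmetric] K')
    fix a assume "a \<in> I"
    then show "x a \<in> space M" "x (p a) \<in> space M"
      using x permutes_in_image[OF p] by (auto simp: space_PiM)
  qed
  have int: "integrable (PiM I (\<lambda>_. M)) (\<lambda>x. \<Prod>a\<in>I. (\<Sum>l. F l (x a) * G l (x (p a))))" if p: "p permutes I" for p
    using integrable_cyclic_product[OF cyc p]
    by (subst Bochner_Integration.integrable_cong[OF refl sum[OF p]]) auto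
  then show "integrable (PiM I (\<lambda>_. M)) (\<lambda>x. det_on I (\<lambda>a b. \<Sum>l. F l (x a) * G l (x b)))"
    unfolding det_on_def by (intro Bochner_Integration.integrable_sum integrable_mult_right) auto
  have "(LINT x|PiM I (\<lambda>_. M). det_on I (\<lambda>a b. \<Sum>l. F l (x a) * G l (x b)))
     = (\<Sum>p | p permutes I. of_int (sign p) * (LINT x|PiM I (\<lambda>_. M). (\<Prod>a\<in>I. (\<Sum>l. F l (x a) * G l (x (p a))))))"
    unfolding det_on_def using int by (subst Bochner_Integration.integral_sum) auto
  also have "\<dots> = (\<Sum>p | p permutes I. of_int (sign p) *
          (LINT l|PiM I (\<lambda>_. ?N). (\<Prod>a\<in>I. (LINT x|M. F (l a) x * G (l (inv p a)) x))))"
  proof (intro sum.cong refl arg_cong2[where f = "(*)"], clarify)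
    fix p assume p: "p permutes I"
    show "(LINT x|PiM I (\<lambda>_. M). (\<Prod>a\<in>I. (\<Sum>l. F l (x a) * G l (x (p a)))))
      = (LINT l|PiM I (\<lambda>_. ?N). (\<Prod>a\<in>I. (LINT x|M. F (l a) x * G (l (inv p a)) x)))"
      by (rule trans[OF Bochner_Integration.integral_cong[OF refl sum[OF p]] integral_cyclic_product[OF cyc p]])
  qed
  finally show "(LINT x|PiM I (\<lambda>_. M). det_on I (\<lambda>a b. \<Sum>l. F l (x a) * G l (x b)))
      = (\<Sum>p | p permutes I. of_int (sign p) *
          (LINT l|PiM I (\<lambda>_. count_space UNIV). (\<Prod>a\<in>I. (LINT x|M. F (l a) x * G (l (inv p a)) x))))" .
qed

text \<open>Tuples with a repetition contribute nothing, and the \<open>fact k\<close> injective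
  tuples with image \<open>S\<close> all give the minor of \<open>S\<close>. Absolute summability
  over the tuples justifies grouping them by their image.\<close>

lemma has_sum_principal_minors:
  fixes m :: "nat \<Rightarrow> nat \<Rightarrow> complex"
  assumes int: "integrable (PiM {..<k} (\<lambda>_. count_space UNIV)) (\<lambda>i. det_on {..<k} (\<lambda>a b. m (i a) (i b)))"
  shows "((\<lambda>S. det_on S m) has_sum (LINT i|PiM {..<k} (\<lambda>_. count_space UNIV). det_on {..<k} (\<lambda>a b. m (i a) (i b))) / fact k)
    {S. finite S \<and> card S = k}"
proof -
  let ?d = "\<lambda>i. det_on {..<k} (\<lambda>a b. m (i a) (i b))"
  let ?P = "{..<k} \<rightarrow>\<^sub>E (UNIV :: nat set)"
  let ?A = "{S :: nat set. finite S \<and> card S = k}"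
  let ?B = "\<lambda>S. {i \<in> {..<k} \<rightarrow>\<^sub>E S. inj_on i {..<k}}"
  have eq: "PiM {..<k} (\<lambda>_. count_space (UNIV :: nat set)) = count_space ?P"
    by (rule count_space_PiM_finite) auto
  let ?t = "LINT i|count_space ?P. ?d i"
  have abs: "Infinite_Set_Sum.abs_summable_on ?d ?P"
    using int unfolding eq Infinite_Set_Sum.abs_summable_on_def .
  then have "?d summable_on ?P"
    by (rule abs_summable_summable[OF iffD2[OF abs_summable_equivalent]])
  then have "(?d has_sum ?t) ?P"
    using infsetsum_infsum[OF abs] by (simp add: infsetsum_def)
  then have "(?d has_sum ?t) {i \<in> ?P. inj_on i {..<k}}"
    by (rule iffD1[OF has_sum_cong_neutral, rotated -1])
       (auto intro: det_on_non_injective)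
  also have "(?d has_sum ?t) {i \<in> ?P. inj_on i {..<k}} \<longleftrightarrow> ((\<lambda>(S, i). ?d i) has_sum ?t) (Sigma ?A ?B)"
  proof (rule has_sum_reindex_bij_witness[where j = "\<lambda>i. (i ` {..<k}, i)" and i = snd])
    fix b assume b: "b \<in> Sigma ?A ?B"
    then obtain S i where [simp]: "b = (S, i)" and S: "finite S" "card S = k" and i: "i \<in> {..<k} \<rightarrow>\<^sub>E S" "inj_on i {..<k}"
      by auto
    have "i ` {..<k} = S" using S i by (intro card_subset_eq) (auto simp: card_image)
    then show "(snd b ` {..<k}, snd b) = b" by simp
    show "snd b \<in> {i \<in> ?P. inj_on i {..<k}}" using i by auto
  qed (auto simp: card_image)
  finally have "((\<lambda>S. fact k * det_on S m) has_sum ?t) ?A"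
  proof (rule has_sum_SigmaD)
    fix S assume S: "S \<in> ?A"
    have fin: "finite (?B S)" using S by (intro finite_subset[OF _ finite_PiE[of "{..<k}" "\<lambda>_. S"]]) auto
    have "card (?B S) = (\<Prod>j = 0..<k. k - j)"
      using S card_inj_on_subset_funcset[of "{..<k}" S "{..<k}"] by simp
    also have "\<dots> = fact k" by (simp add: fact_prod_rev)
    finally have card: "card (?B S) = fact k" .
    have "?d i = det_on S m" if i: "i \<in> ?B S" for i
    proof -
      have "i ` {..<k} = S" using S i by (intro card_subset_eq) (auto simp: card_image)
      with i show ?thesis by (intro det_on_reindex[symmetric]) (auto simp: bij_betw_def)
    qed
    then have "(\<Sum>i\<in>?B S. ?d i) = fact k * det_on S m" using card by simp
    then show "((\<lambda>i. case (S, i) of (S, i) \<Rightarrow> ?d i) has_sum fact k * det_on S m) (?B S)"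
      using has_sum_finite[OF fin, of ?d] by simp
  qed
  from has_sum_cmult_right[OF this, of "1 / fact k"] show ?thesis
    unfolding eq by simp
qed

text \<open>Bessel bounds both factors of the finite Cauchy-Schwarz inequality uniformly in the
  number of terms.\<close>

lemma Bessel_Cauchy_Schwarz:
  assumes e: "\<And>i. e i \<in> L2" "\<And>i j. L2_inner (e i) (e j) = (if i = j then 1 else 0)"
    and g: "g \<in> L2" and h: "h \<in> L2"
  shows "summable (\<lambda>i. cmod (L2_inner g (e i) * L2_inner (e i) h))"
    and "(\<Sum>i<n. cmod (L2_inner g (e i) * L2_inner (e i) h)) \<le> L2_norm g * L2_norm h"
    and "(\<Sum>i. cmod (L2_inner g (e i) * L2_inner (e i) h)) \<le> L2_norm g * L2_norm h"
proof -
  have flip: "cmod (L2_inner (e i) h) = cmod (L2_inner h (e i))" for i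
    by (subst L2_inner_cnj[symmetric]) simp
  show part: "(\<Sum>i<n. cmod (L2_inner g (e i) * L2_inner (e i) h)) \<le> L2_norm g * L2_norm h" for n
  proof -
    have "(\<Sum>i<n. cmod (L2_inner g (e i) * L2_inner (e i) h)) = (\<Sum>i<n. \<bar>cmod (L2_inner g (e i))\<bar> * \<bar>cmod (L2_inner h (e i))\<bar>)"
      by (simp add: norm_mult flip)
    also have "\<dots> \<le> L2_set (\<lambda>i. cmod (L2_inner g (e i))) {..<n} * L2_set (\<lambda>i. cmod (L2_inner h (e i))) {..<n}"
      by (rule L2_set_mult_ineq)
    also have "\<dots> \<le> L2_norm g * L2_norm h"
      unfolding L2_set_def using Bessel[OF e g, of "{..<n}"] Bessel[OF e h, of "{..<n}"]
      by (intro mult_mono real_le_lsqrt) (auto intro: sum_nonneg L2_norm_nonneg)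
    finally show ?thesis .
  qed
  show *: "summable (\<lambda>i. cmod (L2_inner g (e i) * L2_inner (e i) h))"
    by (rule summableI_nonneg_bounded[OF _ part]) simp
  show "(\<Sum>i. cmod (L2_inner g (e i) * L2_inner (e i) h)) \<le> L2_norm g * L2_norm h"
    by (rule suminf_le_const[OF * part])
qed

text \<open>The pairings of \<open>f\<close> with \<open>g\<close> are computed once as integrals
  over the half-line and once from coefficient sequences in a basis; Parseval makes them equal,
  whatever the basis. The assumption \<open>K\<close> concerns every pair of points because diagonal
  values enter the integrand.\<close>

theorem ext_power_trace_nuclear:
  assumes f: "\<And>l. f l \<in> L2" and g: "\<And>l. g l \<in> L2"
    and fg: "summable (\<lambda>l. L2_norm (f l) * L2_norm (g l))"
    and T_L2: "\<And>h. h \<in> L2 \<Longrightarrow> T h \<in> L2"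
    and T: "\<And>h. h \<in> L2 \<Longrightarrow> (\<lambda>n. L2_norm (\<lambda>x. T h x - (\<Sum>l<n. L2_inner h (g l) * f l x))) \<longlonglongrightarrow> 0"
    and K: "\<And>x y. 0 < x \<Longrightarrow> 0 < y \<Longrightarrow> summable (\<lambda>l. cmod (f l x * cnj (g l y)))"
  shows "ext_power_trace T k =
    (LINT x|PiM {..<k} (\<lambda>_. half_line). det_on {..<k} (\<lambda>a b. \<Sum>l. f l (x a) * cnj (g l (x b)))) / fact k"
    (is "_ = ?t / _")
proof -
  let ?D = "\<Sum>p | p permutes {..<k}. of_int (sign p) *
    (LINT l|PiM {..<k} (\<lambda>_. count_space UNIV). (\<Prod>a<k. L2_inner (f (l a)) (g (l (inv p a)))))"
  have "?t = ?D"
  proof -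
    have "(LINT x|half_line. cmod (f l x * cnj (g l' x))) \<le> L2_norm (f l) * L2_norm (g l')" for l l'
      using L2_norm_mult_bound[OF f L2_cnj[OF g], of l l'] by simp
    then show ?thesis
      unfolding L2_inner_def using f g fg K
      by (intro integral_det_on[where \<alpha> = "\<lambda>l. L2_norm (f l)" and \<beta> = "\<lambda>l. L2_norm (g l)"])
         (auto intro: sigma_finite_half_line L2_measurable L2_cnj L2_inner_integrable L2_norm_nonneg simp: space_restrict_space)
  qed
  have basis: "((\<lambda>S. det_on S (\<lambda>i j. L2_inner (T (e j)) (e i))) has_sum ?D / fact k) {S. finite S \<and> card S = k}"
    if e: "orthonormal_basis e" for e
  proof -
    note e' = orthonormal_basisD[OF e]
    let ?M = "count_space UNIV :: nat measure"
    define F where "F l i = L2_inner (f l) (e i)" for l i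
    define G where "G l i = L2_inner (e i) (g l)" for l i
    note BCS = Bessel_Cauchy_Schwarz[OF e'(1,2) f g]
    have int: "integrable ?M (\<lambda>i. F l i * G l' i)" for l l'
      unfolding F_def G_def integrable_count_space_nat_iff by (rule BCS)
    have inner: "(LINT i|?M. F l i * G l' i) = L2_inner (f l) (g l')" for l l'
      unfolding integral_count_space_nat[OF int]
      unfolding F_def G_def by (intro sums_unique[symmetric] Parseval e f g)
    have bound: "(LINT i|?M. cmod (F l i * G l' i)) \<le> L2_norm (f l) * L2_norm (g l')" for l l'
      using BCS(3)[of l l'] int[of l l', THEN integrable_norm] by (subst integral_count_space_nat) (simp_all add: F_def G_def)
    have e_norm: "L2_norm (e i) = 1" for i
    proof -
      have "complex_of_real ((L2_norm (e i))\<^sup>2) = 1"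
        unfolding L2_inner_self[symmetric] using e'(2)[of i i] by simp
      then have "(L2_norm (e i))\<^sup>2 = 1" by (simp only: of_real_eq_1_iff)
      with L2_norm_nonneg[of "e i"] show ?thesis by (simp add: power2_eq_1_iff)
    qed
    have KS: "summable (\<lambda>l. cmod (F l i * G l j))" for i j
    proof (rule summable_comparison_test'[OF fg, where N = 0])
      fix l
      have "cmod (F l i) * cmod (G l j) \<le> L2_norm (f l) * L2_norm (g l)"
        unfolding F_def G_def
        using L2_inner_bound[OF f[of l] e'(1)[of i]] L2_inner_bound[OF e'(1)[of j] g[of l]]
        by (intro mult_mono) (auto simp: e_norm L2_norm_nonneg)
      then show "norm (cmod (F l i * G l j)) \<le> L2_norm (f l) * L2_norm (g l)"
        by (simp add: norm_mult)
    qed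
    \<comment> \<open>The nuclear expansion of \<open>T (e j)\<close> converges in norm and can be
      paired with \<open>e i\<close> term by term.\<close>
    have m: "(\<Sum>l. F l i * G l j) = L2_inner (T (e j)) (e i)" for i j
    proof (rule sums_unique[symmetric])
      let ?s = "\<lambda>n x. \<Sum>l<n. L2_inner (e j) (g l) * f l x"
      have s: "?s n \<in> L2" for n by (intro L2_sum L2_scale f)
      have eq: "(\<Sum>l<n. F l i * G l j) = L2_inner (?s n) (e i)" for n
      proof -
        have "L2_inner (?s n) (e i) = (\<Sum>l<n. L2_inner (e j) (g l) * L2_inner (f l) (e i))"
          by (subst L2_inner_sum_left) (auto intro: L2_scale f e' simp: L2_inner_scale_left)
        then show ?thesis unfolding F_def G_def by (simp only: mult.commute)
      qed
      have "(\<lambda>n. L2_inner (T (e j)) (e i) - L2_inner (?s n) (e i)) \<longlonglongrightarrow> 0"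
      proof (rule Lim_null_comparison)
        show "\<forall>\<^sub>F n in sequentially. norm (L2_inner (T (e j)) (e i) - L2_inner (?s n) (e i)) \<le> L2_norm (\<lambda>x. T (e j) x - ?s n x)"
          using L2_inner_bound[OF L2_diff[OF T_L2[OF e'(1)[of j]] s] e'(1)[of i]]
          by (simp add: L2_inner_diff_left T_L2 e' s e_norm)
        show "(\<lambda>n. L2_norm (\<lambda>x. T (e j) x - ?s n x)) \<longlonglongrightarrow> 0" by (rule T[OF e'(1)])
      qed
      from tendsto_diff[OF tendsto_const[of "L2_inner (T (e j)) (e i)"] this]
      show "(\<lambda>l. F l i * G l j) sums L2_inner (T (e j)) (e i)"
        unfolding sums_def eq by simp
    qed
    have M: "sigma_finite_measure ?M" by (rule sigma_finite_measure_count_space)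
    have meas: "F l \<in> borel_measurable ?M" "G l \<in> borel_measurable ?M" for l by simp_all
    note det = M meas int bound L2_norm_nonneg L2_norm_nonneg fg KS finite_lessThan[of k]
    have "integrable (PiM {..<k} (\<lambda>_. ?M)) (\<lambda>i. det_on {..<k} (\<lambda>a b. L2_inner (T (e (i b))) (e (i a))))"
      using integrable_det_on[OF det] unfolding m .
    from has_sum_principal_minors[OF this]
    show ?thesis using integral_det_on[OF det] unfolding m inner by simp
  qed
  \<comment> \<open>One existing basis keeps the description in \<open>ext_power_trace\<close> from
    holding vacuously for other values.\<close>
  obtain e where e: "orthonormal_basis e" using ex_orthonormal_basis by blast
  have "ext_power_trace T k = ?D / fact k"
    unfolding ext_power_trace_def
  proof (rule the_equality)
    fix t assume "\<forall>e. orthonormal_basis e \<longrightarrow>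
      ((\<lambda>S. det_on S (\<lambda>i j. L2_inner (T (e j)) (e i))) has_sum t) {S. finite S \<and> card S = k}"
    with e basis[OF e] show "t = ?D / fact k" by (blast intro: has_sum_unique)
  qed (use basis in blast)
  with \<open>?t = ?D\<close> show ?thesis by simp
qed

section \<open>Factorization of the Green's function\<close>

text \<open>Restrictions of the domain move into the integrand, so that all integral equations take
  the form over \<open>half_line\<close> used in the locale \<open>volterra\<close>.\<close>

lemma half_line_integrable_subset:
  fixes f :: "real \<Rightarrow> complex"
  assumes "S \<in> sets lebesgue" "S \<subseteq> {0<..}"
  shows "integrable half_line (\<lambda>t. of_bool (t \<in> S) * f t) \<longleftrightarrow> integrable (lebesgue_on S) f"
    and "(LINT t|half_line. of_bool (t \<in> S) * f t) = (LINT t|lebesgue_on S. f t)"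
proof -
  have "(\<lambda>t. indicator {0<..} t *\<^sub>R (of_bool (t \<in> S) * f t)) = (\<lambda>t. indicator S t *\<^sub>R f t)"
    using assms by (auto simp: fun_eq_iff indicator_def)
  then show "integrable half_line (\<lambda>t. of_bool (t \<in> S) * f t) \<longleftrightarrow> integrable (lebesgue_on S) f"
    "(LINT t|half_line. of_bool (t \<in> S) * f t) = (LINT t|lebesgue_on S. f t)"
    using assms by (simp_all add: integrable_restrict_space integral_restrict_space)
qed

lemma half_line_integral_exp:
  fixes c :: complex and m :: real
  assumes c: "c \<noteq> 0" and m: "0 \<le> m"
  shows "(LINT t|half_line. of_bool (t < m) * exp (c * of_real t)) = (exp (c * of_real m) - 1) / c"
proof -
  have cont: "continuous_on {0..m} (\<lambda>t. exp (c * complex_of_real t))" by (intro continuous_intros)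
  have "integrable (lebesgue_on {0<..<m}) (\<lambda>t. exp (c * complex_of_real t))"
    using set_integrable_subset[of lebesgue "{0..m}" "\<lambda>t. exp (c * complex_of_real t)" "{0<..<m}", OF _ _ greaterThanLessThan_subseteq_atLeastAtMost_iff[THEN iffD2]]
      continuous_imp_integrable_real[OF cont]
    by (simp add: set_integrable_def integrable_restrict_space)
  then have "(LINT t|lebesgue_on {0<..<m}. exp (c * complex_of_real t)) = integral {0..m} (\<lambda>t. exp (c * complex_of_real t))"
    by (simp add: lebesgue_integral_eq_integral integral_open_interval_real)
  also have "\<dots> = exp (c * of_real m) / c - exp (c * of_real 0) / c"
  proof (intro integral_unique fundamental_theorem_of_calculus m)
    fix t
    have "((\<lambda>w. exp (c * w) / c) has_field_derivative exp (c * of_real t)) (at (of_real t))"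
      using c by (auto intro!: derivative_eq_intros)
    then have "((\<lambda>w. exp (c * w) / c) \<circ> complex_of_real has_vector_derivative 1 * exp (c * of_real t)) (at t within {0..m})"
      by (intro field_vector_diff_chain_within) (auto intro: has_field_derivative_at_within has_vector_derivative_of_real derivative_eq_intros)
    then show "((\<lambda>t. exp (c * complex_of_real t) / c) has_vector_derivative exp (c * complex_of_real t)) (at t within {0..m})"
      by (simp add: o_def)
  qed
  finally have "(LINT t|half_line. of_bool (t \<in> {0<..<m}) * exp (c * of_real t)) = (exp (c * of_real m) - 1) / c"
    by (subst half_line_integrable_subset) (auto simp: diff_divide_distrib)
  moreover have "(LINT t|half_line. of_bool (t < m) * exp (c * of_real t)) = (LINT t|half_line. of_bool (t \<in> {0<..<m}) * exp (c * of_real t))"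
    by (intro Bochner_Integration.integral_cong) auto
  ultimately show ?thesis by simp
qed

lemma factor_u_v: "factor_u V x * factor_v V x = V x"
proof (cases "V x = 0")
  case False
  have "factor_u V x * factor_v V x
      = (of_real (sqrt (cmod (V x))) * of_real (sqrt (cmod (V x)))) * exp (\<i> * of_real (Arg (V x)))"
    by (simp only: factor_u_def factor_v_def mult_ac)
  also have "\<dots> = of_real (cmod (V x)) * exp (\<i> * of_real (Arg (V x)))"
    by (simp flip: of_real_mult)
  also have "\<dots> = V x" using Arg_eq[OF False] by simp
  finally show ?thesis .
qed (simp add: factor_v_def)

text \<open>Where \<open>V\<close> vanishes, both sides are 0 because division by zero gives 0. The
  quotient yields measurability without an appeal to \<open>Arg\<close>.\<close>

lemma factor_u_eq: "factor_u V x = V x / factor_v V x"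
proof (cases "V x = 0")
  case False
  then have "factor_v V x \<noteq> 0" by (simp add: factor_v_def)
  then show ?thesis by (simp add: nonzero_eq_divide_eq factor_u_v)
qed (simp add: factor_u_def)

lemma cmod_factor_v: "cmod (factor_v V x) = sqrt (cmod (V x))"
  by (simp add: factor_v_def)

lemma cmod_factor_u: "cmod (factor_u V x) = sqrt (cmod (V x))"
  by (simp add: factor_u_def norm_mult)

locale potential =
  fixes V :: "real \<Rightarrow> complex" and z :: complex
  assumes V: "integrable (lebesgue_on {0<..}) V"
    and Im_zsqrt_pos: "Im (zsqrt z) > 0"
begin

abbreviation "\<kappa> \<equiv> zsqrt z"

lemma V_meas [measurable]: "V \<in> borel_measurable half_line"
  using V by auto

lemma factor_v_meas [measurable]: "factor_v V \<in> borel_measurable half_line"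
  unfolding factor_v_def by measurable

lemma factor_u_meas [measurable]: "factor_u V \<in> borel_measurable half_line"
  unfolding factor_u_eq by measurable

lemma factor_v_L2: "factor_v V \<in> L2"
  using V by (intro L2_I[where b = "\<lambda>x. cmod (V x)"]) (auto simp: cmod_factor_v)

lemma zsqrt_nz: "\<kappa> \<noteq> 0"
  using Im_zsqrt_pos by auto

lemma cmod_exp_le_1: "0 \<le> r \<Longrightarrow> cmod (exp (\<i> * \<kappa> * of_real r)) \<le> 1"
  using Im_zsqrt_pos by (simp add: norm_exp_eq_Re)

text \<open>With \<open>\<psi>(x) = exp (\<i> \<kappa> x)\<close> the Green's function is \<open>\<integral>\<^sub>0\<^sup>\<infinity> wave x t * wave y t dt\<close>,
  because \<open>\<psi>\<^sup>-\<^sup>2\<close> is the derivative of the quotient of \<open>sin (\<kappa> x) / \<kappa>\<close> and \<open>\<psi>\<close>.\<close>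

definition wave :: "real \<Rightarrow> real \<Rightarrow> complex" where
  "wave x t = of_bool (t < x) * exp (\<i> * \<kappa> * of_real (x - t))"

lemma wave_borel: "(\<lambda>(x, t). wave x t) \<in> borel_measurable (borel \<Otimes>\<^sub>M borel)"
  unfolding wave_def by measurable

lemma wave_measurable [measurable (raw)]:
  assumes "f \<in> measurable M borel" "g \<in> measurable M borel"
  shows "(\<lambda>y. wave (f y) (g y)) \<in> borel_measurable M"
  using measurable_compose[OF measurable_Pair[OF assms] wave_borel] by simp

lemma wave_L2: "wave x \<in> L2"
proof (rule L2_I)
  have "emeasure half_line {0<..<x} = emeasure lborel {0<..<x}"
    by (subst emeasure_restrict_space) auto
  also have "\<dots> < \<infinity>" by (cases "0 \<le> x") auto
  finally show "integrable half_line (indicator {0<..<x} :: real \<Rightarrow> real)"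
    by (intro integrable_real_indicator) (auto simp: sets_restrict_space_iff)
  show "(cmod (wave x t))\<^sup>2 \<le> indicator {0<..<x} t" if "0 < t" for t
  proof (cases "t < x")
    case True
    then show ?thesis using that cmod_exp_le_1[of "x - t"] power_le_one[of "cmod (exp (\<i> * \<kappa> * of_real (x - t)))" 2]
      by (simp add: wave_def)
  qed (simp add: wave_def)
qed measurable

text \<open>The squared modulus is an exponential with integral
  \<open>(1 - exp (- (2 * Im \<kappa> * x))) / (2 * Im \<kappa>)\<close>. The bound is uniform in
  \<open>x\<close> and is the origin of the constant in the estimates of the Green's
  function.\<close>

lemma wave_norm:
  assumes "0 \<le> x"
  shows "(L2_norm (wave x))\<^sup>2 \<le> 1 / (2 * Im \<kappa>)"
proof -
  have "complex_of_real ((L2_norm (wave x))\<^sup>2) = L2_inner (wave x) (wave x)" by (simp add: L2_inner_self)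
  also have "\<dots> = (LINT t|half_line. exp (- of_real (2 * Im \<kappa> * x)) * (of_bool (t < x) * exp (of_real (2 * Im \<kappa>) * of_real t)))"
    unfolding L2_inner_def
  proof (intro Bochner_Integration.integral_cong refl)
    fix t
    have "wave x t * cnj (wave x t) = of_real ((cmod (wave x t))\<^sup>2)" by (simp only: complex_norm_square)
    also have "(cmod (wave x t))\<^sup>2 = of_bool (t < x) * exp (2 * Im \<kappa> * (t - x))"
      by (simp add: wave_def norm_mult norm_exp_eq_Re power2_eq_square algebra_simps flip: exp_add)
    also have "complex_of_real \<dots> = exp (- of_real (2 * Im \<kappa> * x)) * (of_bool (t < x) * exp (of_real (2 * Im \<kappa>) * of_real t))"
      by (simp add: algebra_simps flip: exp_of_real exp_add)
    finally show "wave x t * cnj (wave x t) = exp (- of_real (2 * Im \<kappa> * x)) * (of_bool (t < x) * exp (of_real (2 * Im \<kappa>) * of_real t))" .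
  qed
  also have "\<dots> = exp (- of_real (2 * Im \<kappa> * x)) * ((exp (of_real (2 * Im \<kappa>) * of_real x) - 1) / of_real (2 * Im \<kappa>))"
    using half_line_integral_exp[of "of_real (2 * Im \<kappa>)" x] assms Im_zsqrt_pos by simp
  also have "\<dots> = of_real ((1 - exp (- (2 * Im \<kappa> * x))) / (2 * Im \<kappa>))"
    by (simp add: right_diff_distrib exp_minus flip: exp_of_real)
  finally have "(L2_norm (wave x))\<^sup>2 = (1 - exp (- (2 * Im \<kappa> * x))) / (2 * Im \<kappa>)"
    by (simp only: of_real_eq_iff)
  then show ?thesis using Im_zsqrt_pos by (simp add: divide_right_mono)
qed

lemma green_commute: "green z x y = green z y x"
  by (auto simp: green_def)

lemma green_wave_le:
  assumes xy: "0 < x" "x \<le> y"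
  shows "green z x y = (LINT t|half_line. wave x t * wave y t)"
proof -
  have "(LINT t|half_line. wave x t * wave y t)
    = (LINT t|half_line. exp (\<i> * \<kappa> * of_real (x + y)) * (of_bool (t < x) * exp (- 2 * \<i> * \<kappa> * of_real t)))"
    using xy by (intro Bochner_Integration.integral_cong refl) (auto simp: wave_def algebra_simps simp flip: exp_add)
  also have "\<dots> = exp (\<i> * \<kappa> * of_real (x + y)) * ((exp (- 2 * \<i> * \<kappa> * of_real x) - 1) / (- 2 * \<i> * \<kappa>))"
    using half_line_integral_exp[of "- 2 * \<i> * \<kappa>" x] xy zsqrt_nz by simp
  also have "\<dots> = green z x y"
    using xy zsqrt_nz
    by (simp add: green_def sin_exp_eq field_simps flip: exp_add)
  finally show ?thesis ..
qed

text \<open>The factorization is bilinear; the conjugate cancels the one inside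
  \<open>L2_inner\<close>, which makes Parseval applicable.\<close>

lemma green_wave:
  assumes "0 < x" "0 < y"
  shows "green z x y = L2_inner (wave x) (\<lambda>t. cnj (wave y t))"
proof (cases "x \<le> y")
  case True
  then show ?thesis using green_wave_le assms by (simp add: L2_inner_def)
next
  case False
  then show ?thesis using green_wave_le[of y x] assms green_commute[of x y] by (simp add: L2_inner_def mult.commute)
qed

lemma wave_norm_mult: "0 \<le> x \<Longrightarrow> 0 \<le> y \<Longrightarrow> L2_norm (wave x) * L2_norm (wave y) \<le> 1 / (2 * Im \<kappa>)"
  using wave_norm[of x] wave_norm[of y] sum_squares_bound[of "L2_norm (wave x)" "L2_norm (wave y)"] by linarith

lemma green_bound:
  assumes "0 < x" "0 < y"
  shows "cmod (green z x y) \<le> 1 / (2 * Im \<kappa>)"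
proof -
  have "cmod (green z x y) \<le> L2_norm (wave x) * L2_norm (wave y)"
    using L2_inner_bound[OF wave_L2 L2_cnj[OF wave_L2], of x y] green_wave[OF assms] by simp
  with wave_norm_mult[of x y] assms show ?thesis by simp
qed

text \<open>Up to sign, \<open>K_op V z\<close> is a product of two Hilbert-Schmidt operators with
  kernels \<open>factor_u V x * wave x t\<close> and \<open>wave y t * factor_v V y\<close>; a basis
  inserted between them gives \<open>f\<close> and \<open>g\<close>. Bessel at each point,
  integrated against the modulus of \<open>V\<close>, makes the squared norms of the
  \<open>f j\<close> and of the \<open>g j\<close> summable.\<close>

theorem nuclear_expansion:
  obtains f g where
    "\<And>j. f j \<in> L2" "\<And>j. g j \<in> L2"
    "summable (\<lambda>j. L2_norm (f j) * L2_norm (g j))"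
    "\<And>h. h \<in> L2 \<Longrightarrow> K_op V z h \<in> L2"
    "\<And>h. h \<in> L2 \<Longrightarrow> (\<lambda>n. L2_norm (\<lambda>x. K_op V z h x - (\<Sum>j<n. L2_inner h (g j) * f j x))) \<longlonglongrightarrow> 0"
    "\<And>x y. 0 < x \<Longrightarrow> 0 < y \<Longrightarrow> summable (\<lambda>j. cmod (f j x * cnj (g j y)))"
    "\<And>x y. 0 < x \<Longrightarrow> 0 < y \<Longrightarrow> (\<lambda>j. f j x * cnj (g j y)) sums K_kernel V z x y"
proof -
  obtain \<epsilon> where basis: "orthonormal_basis \<epsilon>" using ex_orthonormal_basis by blast
  note \<epsilon> = orthonormal_basisD[OF basis]
  note \<epsilon>_meas [measurable] = L2_measurable[OF \<epsilon>(1)]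
  define a where "a j x = L2_inner (wave x) (\<epsilon> j)" for j x
  define b where "b j y = L2_inner (\<epsilon> j) (\<lambda>t. cnj (wave y t))" for j y
  define f where "f j x = - factor_u V x * a j x" for j x
  define g where "g j y = cnj (factor_v V y * b j y)" for j y
  let ?c = "1 / (2 * Im \<kappa>)"
  have c: "0 \<le> ?c" using Im_zsqrt_pos by simp
  have [measurable]: "a j \<in> borel_measurable borel" "b j \<in> borel_measurable borel" for j
    unfolding a_def b_def L2_inner_def complex_cnj_cnj by measurable
  have a_meas [measurable]: "a j \<in> borel_measurable half_line" "b j \<in> borel_measurable half_line" for j
    by (intro borel_measurable_half_lineI; measurable)+
  have a_sq: "(\<Sum>j<n. (cmod (a j x))\<^sup>2) \<le> ?c" if "0 < x" for n x
    unfolding a_def using Bessel[OF \<epsilon>(1,2) wave_L2, of "{..<n}" x] wave_norm[of x] that by simp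
  have b_flip: "cmod (b j y) = cmod (L2_inner (\<lambda>t. cnj (wave y t)) (\<epsilon> j))" for j y
    unfolding b_def by (subst L2_inner_cnj[symmetric]) simp
  have b_sq: "(\<Sum>j<n. (cmod (b j y))\<^sup>2) \<le> ?c" if "0 < y" for n y
    unfolding b_flip using Bessel[OF \<epsilon>(1,2) L2_cnj[OF wave_L2], of "{..<n}" y] wave_norm[of y] that by simp
  have ab: "(\<lambda>j. a j x * b j y) sums green z x y" if "0 < x" "0 < y" for x y
    unfolding a_def b_def green_wave[OF that] by (intro Parseval basis wave_L2 L2_cnj)
  have ab_summable: "summable (\<lambda>j. cmod (a j x * b j y))"
    and ab_bound: "(\<Sum>j<n. cmod (a j x * b j y)) \<le> ?c" if "0 < x" "0 < y" for x y n
    unfolding a_def b_def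
    using Bessel_Cauchy_Schwarz(1)[OF \<epsilon>(1,2) wave_L2 L2_cnj[OF wave_L2], of x y]
      order.trans[OF Bessel_Cauchy_Schwarz(2)[OF \<epsilon>(1,2) wave_L2 L2_cnj[OF wave_L2], of x y n]] wave_norm_mult[of x y] that
    by auto
  have fg: "f j x * cnj (g j y) = - factor_u V x * (a j x * b j y) * factor_v V y" for j x y
    by (simp add: f_def g_def)
  have f_sq: "(cmod (f j x))\<^sup>2 = cmod (V x) * (cmod (a j x))\<^sup>2" for j x
    by (simp add: f_def norm_mult cmod_factor_u power_mult_distrib)
  have g_sq: "(cmod (g j x))\<^sup>2 = cmod (V x) * (cmod (b j x))\<^sup>2" for j x
    by (simp add: g_def norm_mult cmod_factor_v power_mult_distrib)
  have Vc: "integrable half_line (\<lambda>x. cmod (V x) * ?c)" using V by simp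
  have f_L2: "f j \<in> L2" for j
  proof (rule L2_I[OF _ Vc])
    show "(cmod (f j x))\<^sup>2 \<le> cmod (V x) * ?c" if "0 < x" for x
      unfolding f_sq using a_sq[OF that, of "Suc j"] member_le_sum[of j "{..<Suc j}" "\<lambda>j. (cmod (a j x))\<^sup>2"]
      by (intro mult_left_mono) auto
  qed (unfold f_def, measurable)
  have g_L2: "g j \<in> L2" for j
  proof (rule L2_I[OF _ Vc])
    show "(cmod (g j x))\<^sup>2 \<le> cmod (V x) * ?c" if "0 < x" for x
      unfolding g_sq using b_sq[OF that, of "Suc j"] member_le_sum[of j "{..<Suc j}" "\<lambda>j. (cmod (b j x))\<^sup>2"]
      by (intro mult_left_mono) auto
  qed (unfold g_def, measurable)
  have norm_summable: "summable (\<lambda>j. (L2_norm (F j))\<^sup>2)"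
    if F: "\<And>j. F j \<in> L2" "\<And>j x. (cmod (F j x))\<^sup>2 = cmod (V x) * (cmod (d j x))\<^sup>2"
      and d: "\<And>n x. 0 < x \<Longrightarrow> (\<Sum>j<n. (cmod (d j x))\<^sup>2) \<le> ?c" for F :: "nat \<Rightarrow> real \<Rightarrow> complex" and d :: "nat \<Rightarrow> real \<Rightarrow> complex"
  proof (rule summableI_nonneg_bounded)
    fix n
    have "(\<Sum>j<n. (L2_norm (F j))\<^sup>2) = (LINT x|half_line. (\<Sum>j<n. (cmod (F j x))\<^sup>2))"
      using F(1) by (simp add: L2_norm_square L2_integrable_square)
    also have "\<dots> \<le> (LINT x|half_line. cmod (V x) * ?c)"
    proof (intro integral_mono Vc)
      fix x assume "x \<in> space half_line"
      then show "(\<Sum>j<n. (cmod (F j x))\<^sup>2) \<le> cmod (V x) * ?c"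
        using d[of x n] unfolding F(2) sum_distrib_left[symmetric] by (intro mult_left_mono) auto
    qed (use F(1) in \<open>auto intro!: Bochner_Integration.integrable_sum L2_integrable_square\<close>)
    finally show "(\<Sum>j<n. (L2_norm (F j))\<^sup>2) \<le> (LINT x|half_line. cmod (V x) * ?c)" .
  qed simp
  have fg_summable: "summable (\<lambda>j. L2_norm (f j) * L2_norm (g j))"
  proof (rule summable_comparison_test'[where N = 0])
    show "summable (\<lambda>j. (L2_norm (f j))\<^sup>2 + (L2_norm (g j))\<^sup>2)"
      by (intro summable_add norm_summable[of f a] norm_summable[of g b] f_L2 g_L2 f_sq g_sq a_sq b_sq)
    fix j
    have "0 \<le> L2_norm (f j) * L2_norm (g j)" by (simp add: L2_norm_nonneg)
    then show "norm (L2_norm (f j) * L2_norm (g j)) \<le> (L2_norm (f j))\<^sup>2 + (L2_norm (g j))\<^sup>2"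
      using sum_squares_bound[of "L2_norm (f j)" "L2_norm (g j)"] by simp
  qed
  have kernel_summable: "summable (\<lambda>j. cmod (f j x * cnj (g j y)))" if "0 < x" "0 < y" for x y
    using ab_summable[OF that] unfolding fg norm_mult[of _ "factor_v V y"] norm_mult[of "- factor_u V x"]
    by (intro summable_mult summable_mult2)
  have kernel_sums: "(\<lambda>j. f j x * cnj (g j y)) sums K_kernel V z x y" if "0 < x" "0 < y" for x y
    unfolding fg K_kernel_def by (intro sums_mult sums_mult2 ab that)
  have kernel_bound: "cmod (\<Sum>j<n. f j x * cnj (g j y)) \<le> sqrt (cmod (V x)) * ?c * cmod (factor_v V y)"
    if "0 < x" "0 < y" for x y n
  proof -
    have "(\<Sum>j<n. f j x * cnj (g j y)) = - factor_u V x * (\<Sum>j<n. a j x * b j y) * factor_v V y"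
      unfolding fg by (simp only: sum_distrib_left sum_distrib_right)
    then have "cmod (\<Sum>j<n. f j x * cnj (g j y)) = sqrt (cmod (V x)) * cmod (\<Sum>j<n. a j x * b j y) * cmod (factor_v V y)"
      by (simp add: norm_mult cmod_factor_u)
    also have "\<dots> \<le> sqrt (cmod (V x)) * ?c * cmod (factor_v V y)"
      using order.trans[OF norm_sum ab_bound[OF that, of n]] by (intro mult_right_mono mult_left_mono) auto
    finally show ?thesis .
  qed
  have op: "K_op V z h \<in> L2 \<and> (\<lambda>n. L2_norm (\<lambda>x. K_op V z h x - (\<Sum>j<n. L2_inner h (g j) * f j x))) \<longlonglongrightarrow> 0"
    if h: "h \<in> L2" for h
  proof -
    note h_meas [measurable] = L2_measurable[OF h]
    let ?s = "\<lambda>n x. \<Sum>j<n. L2_inner h (g j) * f j x"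
    define J where "J = (LINT y|half_line. cmod (factor_v V y * h y))"
    have J: "0 \<le> J" unfolding J_def by simp
    have vh: "integrable half_line (\<lambda>y. cmod (factor_v V y * h y))"
      using L2_mult_integrable[OF factor_v_L2 h] by simp
    have s_eq: "?s n x = (LINT y|half_line. (\<Sum>j<n. f j x * cnj (g j y)) * h y)" for n x
    proof -
      have "(LINT y|half_line. (\<Sum>j<n. f j x * cnj (g j y)) * h y) = (LINT y|half_line. (\<Sum>j<n. f j x * (h y * cnj (g j y))))"
        by (simp add: sum_distrib_left sum_distrib_right mult_ac)
      also have "\<dots> = ?s n x"
        using L2_inner_integrable[OF h g_L2]
        by (subst Bochner_Integration.integral_sum) (auto simp: L2_inner_def mult.commute)
      finally show ?thesis ..
    qed
    have bnd: "norm ((\<Sum>j<n. f j x * cnj (g j y)) * h y) \<le> sqrt (cmod (V x)) * ?c * cmod (factor_v V y * h y)"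
      if "0 < x" "0 < y" for n x y
      using mult_right_mono[OF kernel_bound[OF that, of n], of "cmod (h y)"] by (simp add: norm_mult mult.assoc)
    \<comment> \<open>For fixed \<open>x\<close> the partial sums of the kernel are at most a
      constant times \<open>cmod (factor_v V y)\<close>, and the product of
      \<open>factor_v V\<close> with \<open>h\<close> is integrable.\<close>
    have s_lim: "(\<lambda>n. ?s n x) \<longlonglongrightarrow> K_op V z h x" if x: "0 < x" for x
      unfolding s_eq K_op_def
    proof (rule integral_dominated_convergence)
      show "integrable half_line (\<lambda>y. sqrt (cmod (V x)) * ?c * cmod (factor_v V y * h y))" using vh by simp
      show "AE y in half_line. (\<lambda>n. (\<Sum>j<n. f j x * cnj (g j y)) * h y) \<longlonglongrightarrow> K_kernel V z x y * h y"
        using kernel_sums[OF x] by (intro AE_I2 tendsto_mult_right) (auto simp: sums_def)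
      show "AE y in half_line. norm ((\<Sum>j<n. f j x * cnj (g j y)) * h y) \<le> sqrt (cmod (V x)) * ?c * cmod (factor_v V y * h y)" for n
        using bnd[OF x] by (intro AE_I2) auto
      show "(\<lambda>y. (\<Sum>j<n. f j x * cnj (g j y)) * h y) \<in> borel_measurable half_line" for n
        using L2_measurable[OF g_L2] by measurable
      \<comment> \<open>The kernel inherits measurability in \<open>y\<close> as the pointwise limit
        of its partial sums.\<close>
      have "(\<lambda>y. lim (\<lambda>n. \<Sum>j<n. f j x * cnj (g j y)) * h y) \<in> borel_measurable half_line"
        using L2_measurable[OF g_L2] by measurable
      moreover have "lim (\<lambda>n. \<Sum>j<n. f j x * cnj (g j y)) = K_kernel V z x y" if "y \<in> space half_line" for y
        using kernel_sums[OF x, of y] that by (intro limI) (auto simp: sums_def)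
      ultimately show "(\<lambda>y. K_kernel V z x y * h y) \<in> borel_measurable half_line"
        by (subst measurable_cong[where g = "\<lambda>y. lim (\<lambda>n. \<Sum>j<n. f j x * cnj (g j y)) * h y"]) auto
    qed
    have s_bound: "cmod (?s n x) \<le> sqrt (cmod (V x)) * (?c * J)" if x: "0 < x" for n x
    proof -
      have "cmod (?s n x) \<le> (LINT y|half_line. norm ((\<Sum>j<n. f j x * cnj (g j y)) * h y))"
        unfolding s_eq by (rule integral_norm_bound)
      also have "\<dots> \<le> (LINT y|half_line. sqrt (cmod (V x)) * ?c * cmod (factor_v V y * h y))"
      proof (rule integral_mono')
        show "integrable half_line (\<lambda>y. sqrt (cmod (V x)) * ?c * cmod (factor_v V y * h y))" using vh by simp
      qed (use bnd[OF x] c in auto)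
      also have "\<dots> = sqrt (cmod (V x)) * (?c * J)" using vh by (simp add: J_def)
      finally show ?thesis .
    qed
    have K_bound: "cmod (K_op V z h x) \<le> sqrt (cmod (V x)) * (?c * J)" if "0 < x" for x
      using LIMSEQ_le_const2[OF tendsto_norm[OF s_lim[OF that]]] s_bound[OF that] by blast
    have s_L2: "?s n \<in> L2" for n by (intro L2_sum L2_scale f_L2)
    have K_meas: "K_op V z h \<in> borel_measurable half_line"
    proof -
      have "(\<lambda>x. lim (\<lambda>n. ?s n x)) \<in> borel_measurable half_line"
        using L2_measurable[OF s_L2] by (intro borel_measurable_lim_metric)
      moreover have "lim (\<lambda>n. ?s n x) = K_op V z h x" if "x \<in> space half_line" for x
        using s_lim[of x] that by (intro limI) auto
      ultimately show ?thesis by (subst measurable_cong[where g = "\<lambda>x. lim (\<lambda>n. ?s n x)"]) auto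
    qed
    have K_L2: "K_op V z h \<in> L2"
    proof (rule L2_I[OF K_meas])
      show "integrable half_line (\<lambda>x. cmod (V x) * (?c * J)\<^sup>2)" using V by simp
      show "(cmod (K_op V z h x))\<^sup>2 \<le> cmod (V x) * (?c * J)\<^sup>2" if "0 < x" for x
        using power_mono[OF K_bound[OF that], of 2] by (simp only: power_mult_distrib real_sqrt_pow2 norm_ge_zero)
    qed
    \<comment> \<open>Dominated convergence again, now in \<open>x\<close>. The limit and the
      partial sums share one bound, so the difference is at most twice that bound, whence the 4
      after squaring.\<close>
    have "(\<lambda>n. LINT x|half_line. (cmod (K_op V z h x - ?s n x))\<^sup>2) \<longlonglongrightarrow> (LINT x|half_line. 0 :: real)"
    proof (rule integral_dominated_convergence)
      show "integrable half_line (\<lambda>x. 4 * (cmod (V x) * (?c * J)\<^sup>2))" using V by simp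
      show "AE x in half_line. (\<lambda>n. (cmod (K_op V z h x - ?s n x))\<^sup>2) \<longlonglongrightarrow> 0"
      proof (rule AE_I2)
        fix x assume "x \<in> space half_line"
        then have "(\<lambda>n. (cmod (K_op V z h x - ?s n x))\<^sup>2) \<longlonglongrightarrow> (cmod (K_op V z h x - K_op V z h x))\<^sup>2"
          by (intro tendsto_intros s_lim) auto
        then show "(\<lambda>n. (cmod (K_op V z h x - ?s n x))\<^sup>2) \<longlonglongrightarrow> 0" by simp
      qed
      show "AE x in half_line. norm ((cmod (K_op V z h x - ?s n x))\<^sup>2) \<le> 4 * (cmod (V x) * (?c * J)\<^sup>2)" for n
      proof (rule AE_I2)
        fix x assume "x \<in> space half_line"
        then have x: "0 < x" by simp
        have "cmod (K_op V z h x - ?s n x) \<le> 2 * (sqrt (cmod (V x)) * (?c * J))"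
          using norm_triangle_ineq4[of "K_op V z h x" "?s n x"] K_bound[OF x] s_bound[OF x, of n] by linarith
        from power_mono[OF this, of 2]
        have "(cmod (K_op V z h x - ?s n x))\<^sup>2 \<le> 2\<^sup>2 * (cmod (V x) * (?c * J)\<^sup>2)"
          by (simp only: power_mult_distrib real_sqrt_pow2 norm_ge_zero)
        then show "norm ((cmod (K_op V z h x - ?s n x))\<^sup>2) \<le> 4 * (cmod (V x) * (?c * J)\<^sup>2)"
          by simp
      qed
    qed (use L2_measurable[OF s_L2] K_meas in \<open>auto intro!: borel_measurable_power borel_measurable_norm borel_measurable_diff\<close>)
    then have "(\<lambda>n. L2_norm (\<lambda>x. K_op V z h x - ?s n x)) \<longlonglongrightarrow> 0"
      unfolding L2_norm_def using tendsto_real_sqrt by fastforce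
    with K_L2 show ?thesis by blast
  qed
  show thesis
    by (rule that[of f g]) (use f_L2 g_L2 fg_summable op kernel_summable kernel_sums in auto)
qed

end

section \<open>Jost and regular solutions\<close>

lemma integrable_cmult_iff:
  fixes c :: complex
  assumes "c \<noteq> 0"
  shows "integrable M (\<lambda>x. c * f x) \<longleftrightarrow> integrable M f"
  using integrable_mult_right[of c M f] integrable_mult_right[of "inverse c" M "\<lambda>x. c * f x"] assms
  by (auto simp: mult.assoc[symmetric])

context potential
begin

text \<open>The extra exponential keeps this bounded for \<open>r \<ge> 0\<close>, whereas
  \<open>sin (\<kappa> * of_real r)\<close> alone grows like
  \<open>exp (Im \<kappa> * r)\<close>.\<close>

definition sine :: "real \<Rightarrow> complex" where
  "sine r = sin (\<kappa> * of_real r) * exp (\<i> * \<kappa> * of_real r) / \<kappa>"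

lemma sine_measurable [measurable]: "sine \<in> borel_measurable borel"
  unfolding sine_def by measurable

lemma sine_exp: "sine r = (exp (2 * \<i> * \<kappa> * of_real r) - 1) / (2 * \<i> * \<kappa>)"
proof -
  have "exp (\<i> * \<kappa> * of_real r) * exp (\<i> * \<kappa> * of_real r) = exp (2 * \<i> * \<kappa> * of_real r)"
    by (simp add: mult.assoc flip: exp_add)
  moreover have "exp (- (\<i> * \<kappa> * of_real r)) * exp (\<i> * \<kappa> * of_real r) = 1"
    by (simp flip: exp_add)
  ultimately show ?thesis
    using zsqrt_nz by (simp add: sine_def sin_exp_eq field_simps)
qed

lemma cmod_exp_2: "cmod (exp (2 * \<i> * \<kappa> * of_real r)) = exp (- (2 * Im \<kappa> * r))"
  by (simp add: norm_exp_eq_Re)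

lemma sine_bound: "0 \<le> r \<Longrightarrow> cmod (sine r) \<le> 1 / cmod \<kappa>"
proof -
  assume "0 \<le> r"
  then have "cmod (exp (2 * \<i> * \<kappa> * of_real r)) \<le> 1"
    unfolding cmod_exp_2 using Im_zsqrt_pos by simp
  then have "cmod (exp (2 * \<i> * \<kappa> * of_real r) - 1) \<le> 2"
    using norm_triangle_ineq4[of "exp (2 * \<i> * \<kappa> * of_real r)" 1] unfolding norm_one by linarith
  then show ?thesis
    unfolding sine_exp norm_divide norm_mult using zsqrt_nz by (simp add: field_simps)
qed

text \<open>For such \<open>r\<close> the exponential in \<open>sine_exp\<close> has modulus at most
  \<open>exp (- Im \<kappa>)\<close>. The bound serves to divide the kernel out of an integrability
  statement.\<close>

lemma sine_lower_bound:
  assumes "1/2 \<le> r"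
  shows "(1 - exp (- Im \<kappa>)) / (2 * cmod \<kappa>) \<le> cmod (sine r)"
proof -
  have "exp (- (2 * Im \<kappa> * r)) \<le> exp (- Im \<kappa>)" using assms Im_zsqrt_pos by simp
  then have "1 - exp (- Im \<kappa>) \<le> cmod (exp (2 * \<i> * \<kappa> * of_real r) - 1)"
    using norm_triangle_ineq2[of 1 "exp (2 * \<i> * \<kappa> * of_real r)"]
    unfolding cmod_exp_2 norm_one norm_minus_commute[of 1] by linarith
  then show ?thesis
    unfolding sine_exp norm_divide norm_mult by (simp add: divide_right_mono)
qed

text \<open>\<open>sine r\<close> is the integral over (0, r) of an exponential of modulus at most
  1. The bound supplies a factor \<open>x\<close> in the remainder of the regular solution at the
  origin.\<close>

lemma sine_le:
  assumes "0 \<le> r" shows "cmod (sine r) \<le> r"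
proof -
  have em: "emeasure half_line {0<..<r} = ennreal r"
    using assms by (subst emeasure_restrict_space) auto
  have "sine r = (LINT t|half_line. of_bool (t < r) * exp (2 * \<i> * \<kappa> * of_real t))"
    unfolding sine_exp using half_line_integral_exp[of "2 * \<i> * \<kappa>" r] zsqrt_nz assms by simp
  also have "cmod \<dots> \<le> (LINT t|half_line. cmod (of_bool (t < r) * exp (2 * \<i> * \<kappa> * of_real t)))"
    by (rule integral_norm_bound)
  also have "\<dots> \<le> (LINT t|half_line. indicator {0<..<r} t)"
  proof (rule integral_mono')
    show "integrable half_line (indicator {0<..<r} :: real \<Rightarrow> real)"
      using em
      by (intro integrable_real_indicator) (auto simp: sets_restrict_space_iff)
    show "cmod (of_bool (t < r) * exp (2 * \<i> * \<kappa> * of_real t)) \<le> indicator {0<..<r} t" if "t \<in> space half_line" for t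
      using that Im_zsqrt_pos unfolding norm_mult cmod_exp_2 by (auto simp: indicator_def)
  qed simp
  also have "\<dots> = measure half_line ({0<..<r} \<inter> {0<..})"
    by (simp add: space_restrict_space)
  also have "{0<..<r} \<inter> {0<..} = {0<..<r}" by auto
  also have "measure half_line {0<..<r} = r"
    unfolding measure_def em using assms by simp
  finally show ?thesis .
qed

text \<open>An exponential of modulus below 1 cannot equal 1. This makes the pivots of the
  elimination nonzero wherever \<open>V\<close> is.\<close>

lemma sine_nz: "0 < r \<Longrightarrow> sine r \<noteq> 0"
proof -
  assume "0 < r"
  then have "cmod (exp (2 * \<i> * \<kappa> * of_real r)) < 1"
    unfolding cmod_exp_2 using Im_zsqrt_pos by simp
  then have "exp (2 * \<i> * \<kappa> * of_real r) \<noteq> 1" by (metis norm_one less_irrefl)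
  then show ?thesis unfolding sine_exp using zsqrt_nz by simp
qed

sublocale jost: volterra V "\<lambda>x t. sine (t - x)" "\<lambda>t x. x < t" "\<lambda>_. 1" "1 / cmod \<kappa>" 1
  by unfold_locales (use V sine_bound in auto)

text \<open>The unknown is \<open>exp (\<i> * \<kappa> * of_real x) * \<phi> x\<close>, with the
  exponent opposite to that of the Jost case, since a regular solution may grow like
  \<open>exp (Im \<kappa> * x)\<close>.\<close>

sublocale regular: volterra V "\<lambda>x t. sine (x - t)" "\<lambda>t x. t < x" sine "1 / cmod \<kappa>" "1 / cmod \<kappa>"
  by unfold_locales (use V sine_bound in auto)

text \<open>Reversing \<open>x - t\<close> produces a minus sign, which cancels the one before the
  integral in the Jost equation.\<close>

lemma jost_kernel:
  "sin (\<kappa> * of_real (x - t)) / \<kappa> * V t * f t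
    = - exp (\<i> * \<kappa> * of_real x) * (sine (t - x) * V t * (exp (- (\<i> * \<kappa> * of_real t)) * f t))"
proof -
  have e: "exp (\<i> * \<kappa> * of_real x) * exp (\<i> * \<kappa> * of_real (t - x)) * exp (- (\<i> * \<kappa> * of_real t)) = 1"
    by (simp add: algebra_simps flip: exp_add)
  have s: "sin (\<kappa> * of_real (x - t)) = - sin (\<kappa> * of_real (t - x))"
    unfolding sin_minus[symmetric] by (simp add: algebra_simps)
  have "- exp (\<i> * \<kappa> * of_real x) * (sine (t - x) * V t * (exp (- (\<i> * \<kappa> * of_real t)) * f t))
     = - sin (\<kappa> * of_real (t - x)) / \<kappa> * V t * f t *
       (exp (\<i> * \<kappa> * of_real x) * exp (\<i> * \<kappa> * of_real (t - x)) * exp (- (\<i> * \<kappa> * of_real t)))"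
    unfolding sine_def by simp
  then show ?thesis unfolding e s by simp
qed

lemma regular_kernel:
  "sin (\<kappa> * of_real (x - t)) / \<kappa> * V t * f t
    = exp (- (\<i> * \<kappa> * of_real x)) * (sine (x - t) * V t * (exp (\<i> * \<kappa> * of_real t) * f t))"
proof -
  have e: "exp (- (\<i> * \<kappa> * of_real x)) * exp (\<i> * \<kappa> * of_real (x - t)) * exp (\<i> * \<kappa> * of_real t) = 1"
    by (simp add: algebra_simps flip: exp_add)
  have "exp (- (\<i> * \<kappa> * of_real x)) * (sine (x - t) * V t * (exp (\<i> * \<kappa> * of_real t) * f t))
     = sin (\<kappa> * of_real (x - t)) / \<kappa> * V t * f t *
       (exp (- (\<i> * \<kappa> * of_real x)) * exp (\<i> * \<kappa> * of_real (x - t)) * exp (\<i> * \<kappa> * of_real t))"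
    unfolding sine_def by simp
  then show ?thesis unfolding e by simp
qed

lemma jost_solution_iff:
  fixes f :: "real \<Rightarrow> complex"
  defines "d \<equiv> \<lambda>x. exp (- (\<i> * \<kappa> * of_real x)) * f x"
  shows "jost_solution V z f \<longleftrightarrow> bounded (d ` {0..}) \<and>
    (\<forall>x\<ge>0. integrable half_line (\<lambda>t. sine (t - x) * V t * of_bool (x < t) * d t) \<and>
      d x = 1 + (LINT t|half_line. sine (t - x) * V t * of_bool (x < t) * d t))"
proof -
  have eq: "(integrable (lebesgue_on {x<..}) (\<lambda>t. sin (\<kappa> * of_real (x - t)) / \<kappa> * V t * f t) \<and>
        f x = exp (\<i> * \<kappa> * of_real x) - (LINT t|lebesgue_on {x<..}. sin (\<kappa> * of_real (x - t)) / \<kappa> * V t * f t))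
    \<longleftrightarrow> (integrable half_line (\<lambda>t. sine (t - x) * V t * of_bool (x < t) * d t) \<and>
      d x = 1 + (LINT t|half_line. sine (t - x) * V t * of_bool (x < t) * d t))" if x: "0 \<le> x" for x
  proof -
    let ?e = "exp (\<i> * \<kappa> * of_real x)"
    have k: "of_bool (t \<in> {x<..}) * (sin (\<kappa> * of_real (x - t)) / \<kappa> * V t * f t)
        = - ?e * (sine (t - x) * V t * of_bool (x < t) * d t)" for t
      unfolding jost_kernel d_def by simp
    have S: "{x<..} \<in> sets lebesgue" "{x<..} \<subseteq> {0<..}" using x by auto
    have e: "- ?e \<noteq> 0" by simp
    have "f x = ?e * d x" unfolding d_def by (simp add: exp_minus)
    then have "f x = ?e - - ?e * I \<longleftrightarrow> d x = 1 + I" for I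
      by (simp flip: distrib_left[of ?e 1, simplified])
    then show ?thesis
      unfolding half_line_integrable_subset[OF S, symmetric] k integrable_cmult_iff[OF e] by simp
  qed
  show ?thesis
    unfolding jost_solution_def by (simp only: eq d_def[symmetric] cong: conj_cong imp_cong)
qed

lemma regular_solution_iff:
  fixes f :: "real \<Rightarrow> complex"
  defines "d \<equiv> \<lambda>x. exp (\<i> * \<kappa> * of_real x) * f x"
  shows "regular_solution V z f \<longleftrightarrow>
    (\<forall>x\<ge>0. integrable half_line (\<lambda>t. sine (x - t) * V t * of_bool (t < x) * d t) \<and>
      d x = sine x + (LINT t|half_line. sine (x - t) * V t * of_bool (t < x) * d t))"
proof -
  have eq: "(integrable (lebesgue_on {0<..<x}) (\<lambda>t. sin (\<kappa> * of_real (x - t)) / \<kappa> * V t * f t) \<and>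
        f x = sin (\<kappa> * of_real x) / \<kappa> + (LINT t|lebesgue_on {0<..<x}. sin (\<kappa> * of_real (x - t)) / \<kappa> * V t * f t))
    \<longleftrightarrow> (integrable half_line (\<lambda>t. sine (x - t) * V t * of_bool (t < x) * d t) \<and>
      d x = sine x + (LINT t|half_line. sine (x - t) * V t * of_bool (t < x) * d t))" if x: "0 \<le> x" for x
  proof -
    let ?e = "exp (- (\<i> * \<kappa> * of_real x))"
    let ?h = "\<lambda>t. sine (x - t) * V t * of_bool (t < x) * d t"
    have k: "of_bool (t \<in> {0<..<x}) * (sin (\<kappa> * of_real (x - t)) / \<kappa> * V t * f t) = ?e * ?h t"
      if "t \<in> space half_line" for t
      using that unfolding regular_kernel d_def by simp
    have S: "{0<..<x} \<in> sets lebesgue" "{0<..<x} \<subseteq> {0<..}" by auto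
    have int: "integrable (lebesgue_on {0<..<x}) (\<lambda>t. sin (\<kappa> * of_real (x - t)) / \<kappa> * V t * f t) \<longleftrightarrow> integrable half_line ?h"
    proof -
      have "integrable half_line (\<lambda>t. of_bool (t \<in> {0<..<x}) * (sin (\<kappa> * of_real (x - t)) / \<kappa> * V t * f t))
          \<longleftrightarrow> integrable half_line (\<lambda>t. ?e * ?h t)"
        by (intro Bochner_Integration.integrable_cong refl k)
      also have "\<dots> \<longleftrightarrow> integrable half_line ?h" by (rule integrable_cmult_iff) simp
      finally show ?thesis unfolding half_line_integrable_subset[OF S] .
    qed
    have lint: "(LINT t|lebesgue_on {0<..<x}. sin (\<kappa> * of_real (x - t)) / \<kappa> * V t * f t) = ?e * (LINT t|half_line. ?h t)"
    proof -
      have "(LINT t|half_line. of_bool (t \<in> {0<..<x}) * (sin (\<kappa> * of_real (x - t)) / \<kappa> * V t * f t))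
          = (LINT t|half_line. ?e * ?h t)"
        by (intro Bochner_Integration.integral_cong refl k)
      then show ?thesis unfolding half_line_integrable_subset[OF S] by simp
    qed
    have "f x = ?e * d x" "sin (\<kappa> * of_real x) / \<kappa> = ?e * sine x"
      unfolding d_def sine_def by (simp_all add: exp_minus)
    then have "f x = sin (\<kappa> * of_real x) / \<kappa> + ?e * I \<longleftrightarrow> d x = sine x + I" for I
      by (simp flip: distrib_left)
    then show ?thesis unfolding int lint by simp
  qed
  show ?thesis
    unfolding regular_solution_def by (simp only: eq cong: conj_cong imp_cong)
qed

lemma ex_jost_solution: "jost_solution V z (\<lambda>x. exp (\<i> * \<kappa> * of_real x) * jost.solution x)"
proof -
  have d: "exp (- (\<i> * \<kappa> * of_real x)) * (exp (\<i> * \<kappa> * of_real x) * jost.solution x) = jost.solution x" for x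
    by (simp add: exp_minus)
  have "bounded (jost.solution ` {0..})"
    using jost.solution_bound by (auto simp: bounded_iff)
  then show ?thesis
    unfolding jost_solution_iff d
    by (intro conjI allI impI) (assumption | rule jost.solution_integrable jost.solution_eq)+
qed

text \<open>The boundedness clause in the definition is what uniqueness for the Volterra equation
  asks for.\<close>

lemma jost_solution_at_0:
  assumes "jost_solution V z f"
  shows "f 0 = jost.solution 0"
proof -
  let ?d = "\<lambda>x. exp (- (\<i> * \<kappa> * of_real x)) * f x"
  note sol = assms[unfolded jost_solution_iff]
  have "bounded (?d ` {0..})" using sol by blast
  then obtain D where D: "\<forall>y\<in>?d ` {0..}. norm y \<le> D" unfolding bounded_iff by blast
  have "?d 0 = jost.solution 0"
  proof (rule jost.solution_unique[where D = D])
    show "cmod (?d x) \<le> D" if "0 \<le> x" for x using D that by (metis atLeast_iff imageI)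
    show "integrable half_line (\<lambda>t. sine (t - x) * V t * of_bool (x < t) * ?d t)" if "0 \<le> x" for x
      by (rule sol[THEN conjunct2, rule_format, OF that, THEN conjunct1])
    show "?d x = 1 + (LINT t|half_line. sine (t - x) * V t * of_bool (x < t) * ?d t)" if "0 \<le> x" for x
      by (rule sol[THEN conjunct2, rule_format, OF that, THEN conjunct2])
  qed simp
  then show ?thesis by simp
qed

lemma ex_regular_solution: "regular_solution V z (\<lambda>x. exp (- (\<i> * \<kappa> * of_real x)) * regular.solution x)"
proof -
  have d: "exp (\<i> * \<kappa> * of_real x) * (exp (- (\<i> * \<kappa> * of_real x)) * regular.solution x) = regular.solution x" for x
    by (simp add: exp_minus)
  show ?thesis
    unfolding regular_solution_iff d
    by (intro conjI allI impI) (rule regular.solution_integrable regular.solution_eq; assumption)+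
qed

text \<open>The definition gives no bound on \<open>\<phi>\<close>, only integrability of the kernel
  against it. At \<open>x = 1\<close> this already makes \<open>V * d\<close> integrable near 0. The
  perturbation \<open>E x\<close> is then at most \<open>x * N x\<close>, where \<open>N x\<close>
  is the integral of the modulus of \<open>V * d\<close> over (0, x) and tends to 0, so
  \<open>E\<close> has derivative 0 at the origin.\<close>

lemma regular_solution_at_0:
  assumes "regular_solution V z \<phi>"
  shows "\<phi> 0 = 0" and "(\<phi> has_vector_derivative 1) (at 0 within {0..})"
proof -
  define d where "d x = exp (\<i> * \<kappa> * of_real x) * \<phi> x" for x
  have int: "integrable half_line (\<lambda>t. sine (x - t) * V t * of_bool (t < x) * d t)"
    and eq: "d x = sine x + (LINT t|half_line. sine (x - t) * V t * of_bool (t < x) * d t)" if "0 \<le> x" for x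
    using assms that unfolding regular_solution_iff d_def by auto
  define E where "E x = (LINT t|half_line. sine (x - t) * V t * of_bool (t < x) * d t)" for x
  have E0: "E 0 = 0"
  proof -
    have "E 0 = (LINT t|half_line. 0)"
      unfolding E_def by (intro Bochner_Integration.integral_cong) auto
    then show ?thesis by simp
  qed
  have "d 0 = 0" using eq[of 0] E0 by (simp add: E_def sine_def)
  then show phi0: "\<phi> 0 = 0" by (simp add: d_def)
  let ?u = "\<lambda>t. of_bool (t < 1/2) * (V t * d t)"
  let ?c = "(1 - exp (- Im \<kappa>)) / (2 * cmod \<kappa>)"
  have c: "0 < ?c" using Im_zsqrt_pos zsqrt_nz by simp
  \<comment> \<open>For \<open>t < 1/2\<close> the factor \<open>sine (1 - t)\<close> has modulus at
    least \<open>?c\<close>, so the integrand at \<open>x = 1\<close> divided by \<open>?c\<close>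
    dominates \<open>?u\<close>.\<close>
  have u_int: "integrable half_line ?u"
  proof (rule Bochner_Integration.integrable_bound)
    show "integrable half_line (\<lambda>t. (sine (1 - t) * V t * of_bool (t < 1) * d t) / of_real ?c)"
      using int[of 1] by simp
    \<comment> \<open>Measurability of \<open>V t * d t\<close> also comes from the integrand at
      \<open>x = 1\<close>, by division by the nonzero \<open>sine (1 - t)\<close>.\<close>
    have "(\<lambda>t. of_bool (t < 1/2) * ((sine (1 - t) * V t * of_bool (t < 1) * d t) / sine (1 - t))) \<in> borel_measurable half_line"
      using borel_measurable_integrable[OF int[of 1]] by measurable
    then show "?u \<in> borel_measurable half_line"
      by (rule measurable_cong[THEN iffD1, rotated]) (auto simp: sine_nz)
    show "AE t in half_line. norm (?u t) \<le> norm ((sine (1 - t) * V t * of_bool (t < 1) * d t) / of_real ?c)"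
    proof (rule AE_I2)
      fix t
      show "norm (?u t) \<le> norm ((sine (1 - t) * V t * of_bool (t < 1) * d t) / of_real ?c)"
      proof (cases "t < 1/2")
        case True
        have "?c * cmod (V t * d t) \<le> cmod (sine (1 - t)) * cmod (V t * d t)"
          using sine_lower_bound[of "1 - t"] True by (intro mult_right_mono) auto
        then have "cmod (V t * d t) \<le> cmod (sine (1 - t)) * cmod (V t * d t) / ?c"
          using c by (subst pos_le_divide_eq) (auto simp: mult.commute)
        then show ?thesis using True c by (simp only: norm_divide norm_of_real abs_of_pos) (simp add: norm_mult mult_ac)
      qed simp
    qed
  qed
  define N where "N x = (LINT t|half_line. of_bool (t < x) * cmod (?u t))" for x
  have N_int: "integrable half_line (\<lambda>t. of_bool (t < x) * cmod (?u t))" for x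
    using borel_measurable_integrable[OF u_int]
    by (intro Bochner_Integration.integrable_bound[OF integrable_norm[OF u_int]] AE_I2) auto
  have "(\<lambda>n. N (1 / real (Suc n))) \<longlonglongrightarrow> (LINT t|half_line. 0 :: real)"
    unfolding N_def
  proof (rule integral_dominated_convergence)
    show "integrable half_line (\<lambda>t. cmod (?u t))" using u_int by (rule integrable_norm)
    show "AE t in half_line. (\<lambda>n. of_bool (t < 1 / real (Suc n)) * cmod (?u t)) \<longlonglongrightarrow> 0"
    proof (rule AE_I2)
      fix t assume "t \<in> space half_line"
      then have t: "0 < t" by simp
      have "\<forall>\<^sub>F n in sequentially. 1 / real (Suc n) < t"
        using order_tendstoD(2)[OF LIMSEQ_inverse_real_of_nat t] by (simp add: inverse_eq_divide)
      then have "\<forall>\<^sub>F n in sequentially. of_bool (t < 1 / real (Suc n)) * cmod (?u t) = 0"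
        by eventually_elim simp
      then show "(\<lambda>n. of_bool (t < 1 / real (Suc n)) * cmod (?u t)) \<longlonglongrightarrow> 0"
        by (rule tendsto_eventually)
    qed
  qed (use N_int u_int in auto)
  then have N_lim: "(\<lambda>n. N (1 / real (Suc n))) \<longlonglongrightarrow> 0" by simp
  have E_bound: "cmod (E x) \<le> x * N x" if x: "0 \<le> x" "x \<le> 1/2" for x
  proof -
    have "cmod (E x) \<le> (LINT t|half_line. cmod (sine (x - t) * V t * of_bool (t < x) * d t))"
      unfolding E_def by (rule integral_norm_bound)
    also have "\<dots> \<le> (LINT t|half_line. x * (of_bool (t < x) * cmod (?u t)))"
    proof (rule integral_mono')
      show "integrable half_line (\<lambda>t. x * (of_bool (t < x) * cmod (?u t)))" using N_int by (rule integrable_mult_right)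
      fix t assume t: "t \<in> space half_line"
      show "cmod (sine (x - t) * V t * of_bool (t < x) * d t) \<le> x * (of_bool (t < x) * cmod (?u t))"
      proof (cases "t < x")
        case True
        have "cmod (sine (x - t)) \<le> x" using sine_le[of "x - t"] True t by simp
        then show ?thesis using True x mult_right_mono[of "cmod (sine (x - t))" x "cmod (V t * d t)"]
          by (simp add: norm_mult mult.assoc)
      qed simp
    qed (use x in simp)
    also have "\<dots> = x * N x" unfolding N_def by simp
    finally show ?thesis .
  qed
  have "(E has_vector_derivative 0) (at 0 within {0..})"
    unfolding has_vector_derivative_def has_derivative_within_alt
  proof (intro conjI allI impI)
    fix \<epsilon> :: real assume "0 < \<epsilon>"
    then obtain n where n: "N (1 / real (Suc n)) < \<epsilon>"
      using order_tendstoD(2)[OF N_lim] by (auto simp: eventually_sequentially)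
    show "\<exists>\<delta>>0. \<forall>y\<in>{0..}. norm (y - 0) < \<delta> \<longrightarrow> norm (E y - E 0 - (y - 0) *\<^sub>R 0) \<le> \<epsilon> * norm (y - 0)"
    \<comment> \<open>\<open>N\<close> is monotone, so its value at \<open>1 / Suc n\<close>
      controls all smaller \<open>y\<close>; the bound 1/2 keeps \<open>E_bound\<close>
      applicable.\<close>
    proof (intro exI[of _ "min (1/2) (1 / real (Suc n))"] conjI ballI impI)
      fix y :: real assume y: "y \<in> {0..}" "norm (y - 0) < min (1/2) (1 / real (Suc n))"
      have "N y \<le> N (1 / real (Suc n))"
        unfolding N_def using y by (intro integral_mono N_int) (auto intro!: mult_right_mono)
      with n have "N y \<le> \<epsilon>" by simp
      then have "y * N y \<le> y * \<epsilon>" using y by (intro mult_left_mono) auto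
      with E_bound[of y] y show "norm (E y - E 0 - (y - 0) *\<^sub>R 0) \<le> \<epsilon> * norm (y - 0)"
        by (simp add: E0 mult.commute)
    qed simp
  qed (simp add: bounded_linear_zero)
  moreover have "(sine has_vector_derivative 1) (at 0 within {0..})"
  proof -
    have "((\<lambda>w. sin (\<kappa> * w) * exp (\<i> * \<kappa> * w) / \<kappa>) has_field_derivative 1) (at (of_real 0))"
      using zsqrt_nz by (auto intro!: derivative_eq_intros)
    then have "((\<lambda>w. sin (\<kappa> * w) * exp (\<i> * \<kappa> * w) / \<kappa>) \<circ> complex_of_real has_vector_derivative 1 * 1) (at 0 within {0..})"
      by (intro field_vector_diff_chain_within) (auto intro: has_field_derivative_at_within has_vector_derivative_of_real derivative_eq_intros)
    then show ?thesis by (simp add: o_def sine_def[abs_def])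
  qed
  ultimately have dE: "((\<lambda>x. sine x + E x) has_vector_derivative 1) (at 0 within {0..})"
    using has_vector_derivative_add by fastforce
  have "((\<lambda>x. exp (- (\<i> * \<kappa> * of_real x))) has_vector_derivative - (\<i> * \<kappa>)) (at 0 within {0..})"
  proof -
    have "((\<lambda>w. exp (- (\<i> * \<kappa> * w))) has_field_derivative - (\<i> * \<kappa>)) (at (of_real 0))"
      by (auto intro!: derivative_eq_intros)
    then have "((\<lambda>w. exp (- (\<i> * \<kappa> * w))) \<circ> complex_of_real has_vector_derivative 1 * - (\<i> * \<kappa>)) (at 0 within {0..})"
      by (intro field_vector_diff_chain_within) (auto intro: has_field_derivative_at_within has_vector_derivative_of_real derivative_eq_intros)
    then show ?thesis by (simp add: o_def)
  qed
  from has_vector_derivative_mult[OF this dE]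
  have "((\<lambda>x. exp (- (\<i> * \<kappa> * of_real x)) * (sine x + E x)) has_vector_derivative 1) (at 0 within {0..})"
    by (simp add: E0 sine_def)
  then show "(\<phi> has_vector_derivative 1) (at 0 within {0..})"
  proof (rule has_vector_derivative_transform[rotated 2])
    show "\<phi> x = exp (- (\<i> * \<kappa> * of_real x)) * (sine x + E x)" if "x \<in> {0..}" for x
      using eq[of x] that unfolding E_def d_def by (simp add: exp_minus field_simps)
  qed simp
qed

text \<open>The initial values 0 and 1 of the regular solution reduce the Wronskian to
  \<open>f 0\<close>; the derivative of \<open>f\<close> is multiplied by 0, whatever its value.
  Every admissible pair thus gives the same number.\<close>

theorem jost_function_eq: "jost_function V z = jost.solution 0"
proof -
  \<comment> \<open>The origin is not isolated in the closed half-line, so the one-sided derivative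
    there is unique.\<close>
  have nontriv: "at 0 within {0::real..} \<noteq> bot"
  proof
    have subset: "{0::real<..} \<subseteq> {0..}" by auto
    assume "at 0 within {0::real..} = bot"
    then have "at_right (0::real) = bot"
      using at_le[OF subset, of 0] by (simp add: bot.extremum_unique)
    then show False using trivial_limit_at_right_real[of 0] by simp
  qed
  have wr: "wronskian f \<phi> 0 = jost.solution 0"
    if f: "jost_solution V z f" and \<phi>: "regular_solution V z \<phi>" for f \<phi>
  proof -
    have "vector_derivative \<phi> (at 0 within {0..}) = 1"
      by (rule vector_derivative_within[OF nontriv regular_solution_at_0(2)[OF \<phi>]])
    then show ?thesis
      using jost_solution_at_0[OF f] regular_solution_at_0(1)[OF \<phi>] by (simp add: wronskian_def)
  qed
  show ?thesis
    unfolding jost_function_def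
  proof (rule the_equality)
    show "\<exists>f \<phi>. jost_solution V z f \<and> regular_solution V z \<phi> \<and> jost.solution 0 = wronskian f \<phi> 0"
      by (rule exI, rule exI, intro conjI, rule ex_jost_solution, rule ex_regular_solution,
          rule wr[OF ex_jost_solution ex_regular_solution, symmetric])
  qed (elim exE conjE, simp add: wr)
qed

end

section \<open>The Fredholm determinant\<close>

lemma borel_measurable_det_on:
  assumes "finite I" "\<And>a b. a \<in> I \<Longrightarrow> b \<in> I \<Longrightarrow> (\<lambda>x. M x a b) \<in> borel_measurable N"
  shows "(\<lambda>x. det_on I (M x)) \<in> borel_measurable N"
  unfolding det_on_def
  by (intro borel_measurable_sum borel_measurable_times borel_measurable_const borel_measurable_prod)
     (auto simp: permutes_in_image intro: assms)

text \<open>Each term of the Leibniz formula is bounded separately. The factorial is harmless: only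
  integrability for a fixed index set is at stake, and decay in \<open>k\<close> comes from the
  Picard bounds.\<close>

lemma det_on_norm_bound:
  assumes I: "finite I" and M: "\<And>a b. a \<in> I \<Longrightarrow> b \<in> I \<Longrightarrow> cmod (M a b) \<le> c a"
  shows "cmod (det_on I M) \<le> fact (card I) * (\<Prod>a\<in>I. c a)"
proof -
  have "cmod (det_on I M) \<le> (\<Sum>p | p permutes I. (\<Prod>a\<in>I. c a))"
    unfolding det_on_def
  proof (rule sum_norm_le, clarify)
    fix p assume p: "p permutes I"
    have "cmod (of_int (sign p)) = 1" by (cases p rule: sign_cases) auto
    then have "cmod (of_int (sign p) * (\<Prod>i\<in>I. M i (p i))) = (\<Prod>i\<in>I. cmod (M i (p i)))"
      by (simp add: norm_mult prod_norm)
    also have "\<dots> \<le> (\<Prod>a\<in>I. c a)"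
      using M permutes_in_image[OF p] by (intro prod_mono) auto
    finally show "cmod (of_int (sign p) * (\<Prod>i\<in>I. M i (p i))) \<le> (\<Prod>a\<in>I. c a)" .
  qed
  also have "\<dots> = fact (card I) * (\<Prod>a\<in>I. c a)"
    using card_permutations[OF refl I] by simp
  finally show ?thesis .
qed

text \<open>Where the minimum of \<open>x\<close> is not attained uniquely, two rows coincide and both sides vanish.\<close>

lemma det_on_sum_unique_min:
  fixes x :: "nat \<Rightarrow> real"
  assumes I: "finite I" "I \<noteq> {}"
    and rows: "\<And>a b j. a \<in> I \<Longrightarrow> b \<in> I \<Longrightarrow> j \<in> I \<Longrightarrow> x a = x b \<Longrightarrow> M a j = M b j"
  shows "det_on I M = (\<Sum>m\<in>I. of_bool (\<forall>a\<in>I - {m}. x m < x a) * det_on I M)"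
proof -
  have "Min (x ` I) \<in> x ` I" using I by (intro Min_in) auto
  then obtain m0 where "m0 \<in> I" "x m0 = Min (x ` I)" by auto
  then have m0: "m0 \<in> I" "\<And>a. a \<in> I \<Longrightarrow> x m0 \<le> x a" using I by auto
  show ?thesis
  proof (cases "\<exists>a\<in>I - {m0}. x a = x m0")
    case True
    then obtain a where a: "a \<in> I" "a \<noteq> m0" "x a = x m0" by auto
    have "det_on I M = 0"
      by (rule det_on_equal_rows[OF I(1) a(1) m0(1) a(2)]) (rule rows[OF a(1) m0(1) _ a(3)])
    then show ?thesis by simp
  next
    case False
    have "\<forall>a\<in>I - {m0}. x m0 < x a"
    proof
      fix a assume a: "a \<in> I - {m0}"
      then have "x a \<noteq> x m0" using False by blast
      with m0(2)[of a] a show "x m0 < x a" by simp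
    qed
    then have "(\<forall>a\<in>I - {m}. x m < x a) \<longleftrightarrow> m = m0" if "m \<in> I" for m
      using that m0(1) by (cases "m = m0") (auto dest!: bspec[where x = m0] bspec[where x = m] intro: less_asym)
    then have "(\<Sum>m\<in>I. of_bool (\<forall>a\<in>I - {m}. x m < x a) * det_on I M) = (\<Sum>m\<in>I. if m = m0 then det_on I M else 0)"
      by (intro sum.cong) auto
    also have "\<dots> = det_on I M" using m0 I by simp
    finally show ?thesis ..
  qed
qed

lemma integrable_pair_mult:
  fixes f :: "'a \<Rightarrow> real" and g :: "'b \<Rightarrow> real"
  assumes M1: "sigma_finite_measure M1" and M2: "sigma_finite_measure M2"
    and f: "integrable M1 f" and g: "integrable M2 g"
  shows "integrable (M1 \<Otimes>\<^sub>M M2) (\<lambda>(x, y). f x * g y)"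
proof -
  interpret pair_sigma_finite M1 M2 using M1 M2 by (simp add: pair_sigma_finite_def)
  have [measurable]: "f \<in> borel_measurable M1" "g \<in> borel_measurable M2" using f g by auto
  show ?thesis
  proof (rule Fubini_integrable)
    show "integrable M1 (\<lambda>x. LINT y|M2. norm (case (x, y) of (x, y) \<Rightarrow> f x * g y))"
      using f by (simp add: abs_mult integrable_mult_left)
  qed (use g in auto)
qed

section \<open>Integrals of Green determinants and the Jost recursion\<close>

context potential
begin

lemma green_borel: "(\<lambda>(x, t). green z x t) \<in> borel_measurable (borel \<Otimes>\<^sub>M borel)"
  unfolding green_def by measurable

lemma green_measurable [measurable (raw)]:
  assumes "f \<in> measurable M borel" "g \<in> measurable M borel"
  shows "(\<lambda>y. green z (f y) (g y)) \<in> borel_measurable M"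
  using measurable_compose[OF measurable_Pair[OF assms] green_borel] by simp

lemma green_same: "green z r r = sine r"
  by (simp add: green_def sine_def)

text \<open>Eliminating the point \<open>P\<close> turns the Green's function of \<open>(0, \<infinity>)\<close> into that of \<open>(P, \<infinity>)\<close>.\<close>

lemma green_Schur:
  assumes P: "0 < P" and "0 < X" "0 < Y"
  shows "green z (P + X) (P + Y) - green z (P + X) P * green z P (P + Y) / green z P P = green z X Y"
proof -
  have main: "green z (P + X) (P + Y) - green z (P + X) P * green z P (P + Y) / green z P P = green z X Y"
    if X: "0 < X" and XY: "X \<le> Y" for X Y
  proof -
    define S where "S r = sin (\<kappa> * of_real r)" for r
    define E where "E r = exp (\<i> * \<kappa> * of_real r)" for r
    have E: "E (r + s) = E r * E s" for r s by (simp add: E_def algebra_simps exp_add)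
    \<comment> \<open>The combination of sine and exponential that vanishes at \<open>P\<close> is
      the sine shifted by \<open>P\<close>.\<close>
    have S: "S (P + X) * E P - S P * E (P + X) = S X"
    proof -
      have SE: "S r = (E r - inverse (E r)) / (2 * \<i>)" for r
        by (simp add: S_def E_def sin_exp_eq exp_minus algebra_simps)
      have "E P \<noteq> 0" "E X \<noteq> 0" by (simp_all add: E_def)
      then show ?thesis unfolding SE E inverse_mult_distrib by (simp add: field_simps)
    qed
    have nz: "S P \<noteq> 0" "E P \<noteq> 0" using sine_nz[OF P] by (auto simp: sine_def S_def E_def)
    have g: "green z r s = S r * E s / \<kappa>" "green z s r = S r * E s / \<kappa>" if "r \<le> s" for r s
      using that by (auto simp: green_def S_def E_def)
    have "green z (P + X) P * green z P (P + Y) / green z P P = S P * E (P + X) * E Y / \<kappa>"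
      using P X XY nz zsqrt_nz by (simp add: g E field_simps)
    moreover have "green z (P + X) (P + Y) = S (P + X) * E P * E Y / \<kappa>"
      using XY by (simp add: g E)
    moreover have "green z X Y = S X * E Y / \<kappa>" using XY by (simp add: g)
    ultimately show ?thesis unfolding S[symmetric] by (simp add: algebra_simps diff_divide_distrib)
  qed
  show ?thesis
  proof (cases "X \<le> Y")
    case False
    then show ?thesis
      using main[of Y X] assms
      by (simp add: green_commute[of X Y] green_commute[of "P + X" "P + Y"] green_commute[of "P + X" P]
          green_commute[of P "P + Y"] mult.commute)
  qed (use main assms in auto)
qed

text \<open>The Green's function of the half-line starting at \<open>s\<close>, extended by zero and
  with \<open>V\<close> attached to the rows. The moving endpoint \<open>s\<close> becomes the
  variable of the Volterra equation.\<close>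

definition kernel :: "real \<Rightarrow> (nat \<Rightarrow> real) \<Rightarrow> nat \<Rightarrow> nat \<Rightarrow> complex" where
  "kernel s x a b = V (x a) * (of_bool (s < x a \<and> s < x b) * green z (x a - s) (x b - s))"

text \<open>The pivot is \<open>sine (x m - s) * V (x m)\<close>, and the Schur complement replaces
  the endpoint \<open>s\<close> by \<open>x m\<close>. In the degenerate cases both sides
  vanish.\<close>

lemma det_kernel_Schur:
  assumes I: "finite I" "m \<in> I"
  shows "of_bool (\<forall>a\<in>I - {m}. x m < x a) * det_on I (kernel s x)
    = sine (x m - s) * V (x m) * of_bool (s < x m) * det_on (I - {m}) (kernel (x m) x)"
proof -
  let ?t = "x m"
  \<comment> \<open>The first two alternatives give a zero row \<open>m\<close> on the left. In the
    third, row \<open>a\<close> of the smaller determinant on the right is zero because its cutoff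
    sits at \<open>x m\<close>.\<close>
  consider "\<not> s < ?t" | "V ?t = 0" | a where "s < ?t" "a \<in> I - {m}" "\<not> ?t < x a"
    | "s < ?t" "V ?t \<noteq> 0" "\<forall>a\<in>I - {m}. ?t < x a" by blast
  then show ?thesis
  proof cases
    case 1
    then have "det_on I (kernel s x) = 0"
      by (intro det_on_zero_row[OF I]) (simp add: kernel_def)
    with 1 show ?thesis by simp
  next
    case 2
    then have "det_on I (kernel s x) = 0"
      by (intro det_on_zero_row[OF I]) (simp add: kernel_def)
    with 2 show ?thesis by simp
  next
    case 3
    then have "det_on (I - {m}) (kernel ?t x) = 0"
      using I by (intro det_on_zero_row[of _ a]) (auto simp: kernel_def)
    moreover have "\<not> (\<forall>a\<in>I - {m}. ?t < x a)" using 3 by blast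
    ultimately show ?thesis by simp
  next
    case 4
    have mm: "kernel s x m m = sine (?t - s) * V ?t"
      using 4 by (simp add: kernel_def green_same)
    then have nz: "kernel s x m m \<noteq> 0" using 4 sine_nz[of "?t - s"] by simp
    have "kernel s x a b - kernel s x a m * kernel s x m b / kernel s x m m = kernel ?t x a b"
      if ab: "a \<in> I - {m}" "b \<in> I - {m}" for a b
    proof -
      have lt: "?t < x a" "?t < x b" using 4 ab by auto
      have "kernel s x a b - kernel s x a m * kernel s x m b / kernel s x m m
         = V (x a) * (green z (x a - s) (x b - s) - green z (x a - s) (?t - s) * green z (?t - s) (x b - s) / green z (?t - s) (?t - s))"
        using lt 4 by (simp add: kernel_def right_diff_distrib)
      also have "\<dots> = V (x a) * green z (x a - ?t) (x b - ?t)"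
        using green_Schur[of "?t - s" "x a - ?t" "x b - ?t"] lt 4 by simp
      finally show ?thesis using lt by (simp add: kernel_def)
    qed
    then have "det_on (I - {m}) (\<lambda>a b. kernel s x a b - kernel s x a m * kernel s x m b / kernel s x m m)
        = det_on (I - {m}) (kernel ?t x)"
      by (intro det_on_cong) auto
    with det_on_Schur[where M = "kernel s x", OF I nz] mm 4 show ?thesis by (simp add: mult.assoc)
  qed
qed

lemma kernel_bound: "cmod (kernel s x a b) \<le> cmod (V (x a)) * (1 / (2 * Im \<kappa>))"
proof -
  have "cmod (of_bool (s < x a \<and> s < x b) * green z (x a - s) (x b - s)) \<le> 1 / (2 * Im \<kappa>)"
    using green_bound[of "x a - s" "x b - s"] Im_zsqrt_pos by auto
  then show ?thesis unfolding kernel_def norm_mult by (intro mult_left_mono) (auto simp: norm_mult)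
qed

lemma det_kernel_bound:
  "finite I \<Longrightarrow> cmod (det_on I (kernel s x)) \<le> fact (card I) * (\<Prod>a\<in>I. cmod (V (x a)) * (1 / (2 * Im \<kappa>)))"
  by (intro det_on_norm_bound kernel_bound)

interpretation half_lines: product_sigma_finite "\<lambda>_ :: nat. half_line"
  by (simp add: product_sigma_finite_def sigma_finite_half_line)

lemma det_bound_integrable:
  fixes I :: "nat set"
  assumes "finite I"
  shows "integrable (PiM I (\<lambda>_. half_line)) (\<lambda>x. fact (card I) * (\<Prod>a\<in>I. cmod (V (x a)) * (1 / (2 * Im \<kappa>))))"
proof -
  have "integrable half_line (\<lambda>y. cmod (V y) * (1 / (2 * Im \<kappa>)))" using V by simp
  then show ?thesis
    using half_lines.product_integrable_prod[OF assms, of "\<lambda>_ y. cmod (V y) * (1 / (2 * Im \<kappa>))"]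
    by (intro integrable_mult_right)
qed

lemma component_measurable:
  "a \<in> I \<Longrightarrow> (\<lambda>x. x a) \<in> borel_measurable (PiM I (\<lambda>_. half_line))"
  by (rule measurable_compose[OF measurable_component_singleton[of a I "\<lambda>_. half_line"] measurable_ident_half_line])

lemma det_kernel_measurable:
  assumes I: "finite I" and [measurable]: "s \<in> borel_measurable M"
    and "\<And>a. a \<in> I \<Longrightarrow> (\<lambda>y. x y a) \<in> measurable M half_line"
  shows "(\<lambda>y. det_on I (kernel (s y) (x y))) \<in> borel_measurable M"
proof (rule borel_measurable_det_on[OF I])
  fix a b assume ab: "a \<in> I" "b \<in> I"
  have xa: "(\<lambda>y. x y a) \<in> borel_measurable M"
    by (rule measurable_compose[OF assms(3)[OF ab(1)] measurable_ident_half_line])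
  have xb: "(\<lambda>y. x y b) \<in> borel_measurable M"
    by (rule measurable_compose[OF assms(3)[OF ab(2)] measurable_ident_half_line])
  have "Measurable.pred M (\<lambda>y. s y < x y a \<and> s y < x y b)"
    by (intro pred_intros_logic borel_measurable_pred_less xa xb assms(2))
  then have "(\<lambda>y. of_bool (s y < x y a \<and> s y < x y b) :: complex) \<in> borel_measurable M"
    by (rule measurable_compose) simp
  moreover have "(\<lambda>y. green z (x y a - s y) (x y b - s y)) \<in> borel_measurable M"
    by (intro green_measurable borel_measurable_diff xa xb assms(2))
  moreover have "(\<lambda>y. V (x y a)) \<in> borel_measurable M"
    by (rule measurable_compose[OF assms(3)[OF ab(1)] V_meas])
  ultimately show "(\<lambda>y. kernel (s y) (x y) a b) \<in> borel_measurable M"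
    unfolding kernel_def by (intro borel_measurable_times)
qed

lemma det_kernel_integrable:
  assumes "finite I"
  shows "integrable (PiM I (\<lambda>_. half_line)) (\<lambda>x. det_on I (kernel s x))"
proof (rule Bochner_Integration.integrable_bound[OF det_bound_integrable[OF assms]])
  show "(\<lambda>x. det_on I (kernel s x)) \<in> borel_measurable (PiM I (\<lambda>_. half_line))"
    using assms by (intro det_kernel_measurable) auto
  show "AE x in PiM I (\<lambda>_. half_line). norm (det_on I (kernel s x)) \<le> norm (fact (card I) * (\<Prod>a\<in>I. cmod (V (x a)) * (1 / (2 * Im \<kappa>))))"
    using det_kernel_bound[OF assms] by (intro AE_I2) (auto intro: order.trans[OF _ abs_ge_self])
qed

text \<open>Fubini splits off the smallest coordinate as \<open>t\<close>. After elimination the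
  remaining determinant depends on it only through its endpoint.\<close>

lemma integral_unique_min:
  assumes I: "finite I" "m \<in> I"
  shows "integrable (PiM I (\<lambda>_. half_line)) (\<lambda>x. of_bool (\<forall>a\<in>I - {m}. x m < x a) * det_on I (kernel s x))"
    and "(LINT x|PiM I (\<lambda>_. half_line). of_bool (\<forall>a\<in>I - {m}. x m < x a) * det_on I (kernel s x))
      = (LINT t|half_line. sine (t - s) * V t * of_bool (s < t) *
          (LINT x|PiM (I - {m}) (\<lambda>_. half_line). det_on (I - {m}) (kernel t x)))"
proof -
  define J where "J = I - {m}"
  have J: "finite J" "m \<notin> J" "I = insert m J" using I by (auto simp: J_def)
  let ?f = "\<lambda>x. of_bool (\<forall>a\<in>I - {m}. x m < x a) * det_on I (kernel s x)"
  let ?g = "\<lambda>x t. sine (t - s) * V t * of_bool (s < t) * det_on J (kernel t x)"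
  show int: "integrable (PiM I (\<lambda>_. half_line)) ?f"
  proof (rule Bochner_Integration.integrable_bound[OF det_kernel_integrable[OF I(1), of s]])
    have "(\<lambda>x. det_on I (kernel s x)) \<in> borel_measurable (PiM I (\<lambda>_. half_line))"
      using I by (intro det_kernel_measurable) auto
    moreover have "Measurable.pred (PiM I (\<lambda>_. half_line)) (\<lambda>x. \<forall>a\<in>I - {m}. x m < x a)"
      using I by (intro pred_intros_finite borel_measurable_pred_less component_measurable) auto
    ultimately show "?f \<in> borel_measurable (PiM I (\<lambda>_. half_line))" by measurable
  qed (auto intro!: AE_I2)
  interpret P: pair_sigma_finite "PiM J (\<lambda>_. half_line)" half_line
    using half_lines.sigma_finite[OF J(1)] sigma_finite_half_line by (simp add: pair_sigma_finite_def)
  have g_int: "integrable (PiM J (\<lambda>_. half_line) \<Otimes>\<^sub>M half_line) (case_prod ?g)"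
  proof (rule Bochner_Integration.integrable_bound)
    let ?B = "\<lambda>x. fact (card J) * (\<Prod>a\<in>J. cmod (V (x a)) * (1 / (2 * Im \<kappa>)))"
    show "integrable (PiM J (\<lambda>_. half_line) \<Otimes>\<^sub>M half_line) (\<lambda>(x, t). ?B x * (1 / cmod \<kappa> * cmod (V t)))"
      using V by (intro integrable_pair_mult half_lines.sigma_finite J sigma_finite_half_line det_bound_integrable) auto
    have [measurable]: "(\<lambda>y. det_on J (kernel (snd y) (fst y))) \<in> borel_measurable (PiM J (\<lambda>_. half_line) \<Otimes>\<^sub>M half_line)"
      by (rule det_kernel_measurable[OF J(1)]) measurable
    show "case_prod ?g \<in> borel_measurable (PiM J (\<lambda>_. half_line) \<Otimes>\<^sub>M half_line)"
      unfolding case_prod_beta' by measurable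
    show "AE y in PiM J (\<lambda>_. half_line) \<Otimes>\<^sub>M half_line. norm (case_prod ?g y) \<le> norm (case y of (x, t) \<Rightarrow> ?B x * (1 / cmod \<kappa> * cmod (V t)))"
    proof (rule AE_I2, clarify)
      fix x t
      have s: "cmod (sine (t - s) * of_bool (s < t)) \<le> 1 / cmod \<kappa>" using sine_bound[of "t - s"] by auto
      have "norm (?g x t) = cmod (det_on J (kernel t x)) * (cmod (sine (t - s) * of_bool (s < t)) * cmod (V t))"
        by (simp add: norm_mult)
      also have "\<dots> \<le> ?B x * (1 / cmod \<kappa> * cmod (V t))"
        using det_kernel_bound[OF J(1), of t x]
        by (intro mult_mono mult_right_mono s) (auto intro: order.trans[OF norm_ge_zero])
      also have "\<dots> \<le> norm (?B x * (1 / cmod \<kappa> * cmod (V t)))"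
        by (simp only: real_norm_def abs_ge_self)
      finally show "norm (?g x t) \<le> norm (?B x * (1 / cmod \<kappa> * cmod (V t)))" .
    qed
  qed
  have "(LINT x|PiM I (\<lambda>_. half_line). ?f x) = (LINT x|PiM J (\<lambda>_. half_line). LINT t|half_line. ?f (x(m := t)))"
    using half_lines.product_integral_insert[OF J(1,2), of ?f] int unfolding J(3) by simp
  also have "\<dots> = (LINT x|PiM J (\<lambda>_. half_line). LINT t|half_line. ?g x t)"
  proof (intro Bochner_Integration.integral_cong refl)
    fix x t
    \<comment> \<open>The index \<open>m\<close> is not in \<open>J\<close>, so the update is
      invisible to this determinant.\<close>
    have "det_on J (kernel t (x(m := t))) = det_on J (kernel t x)"
      using J by (intro det_on_cong) (auto simp: kernel_def)
    then show "?f (x(m := t)) = ?g x t"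
      using det_kernel_Schur[OF I, of "x(m := t)" s] by (simp add: J_def[symmetric])
  qed
  also have "\<dots> = (LINT t|half_line. LINT x|PiM J (\<lambda>_. half_line). ?g x t)"
    by (rule P.Fubini_integral[OF g_int, symmetric])
  also have "\<dots> = (LINT t|half_line. sine (t - s) * V t * of_bool (s < t) *
          (LINT x|PiM J (\<lambda>_. half_line). det_on J (kernel t x)))"
    by simp
  finally show "(LINT x|PiM I (\<lambda>_. half_line). ?f x)
      = (LINT t|half_line. sine (t - s) * V t * of_bool (s < t) *
          (LINT x|PiM (I - {m}) (\<lambda>_. half_line). det_on (I - {m}) (kernel t x)))"
    unfolding J_def .
qed

text \<open>Any of the \<open>Suc n\<close> points may be the smallest. Each choice contributes
  \<open>fact n * jost.picard (Suc n) s\<close>, and together they give the factorial of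
  \<open>Suc n\<close>.\<close>

theorem integral_det_kernel:
  assumes "finite I"
  shows "(LINT x|PiM I (\<lambda>_. half_line). det_on I (kernel s x)) = fact (card I) * jost.picard (card I) s"
  using assms
proof (induction "card I" arbitrary: I s)
  case 0
  then have "I = {}" by simp
  \<comment> \<open>The product over no factors is a one-point space of mass 1, and the empty
    determinant is 1, which is also the zeroth iterate.\<close>
  then show ?case by (simp add: PiM_empty det_on_def lebesgue_integral_count_space_finite)
next
  case (Suc n)
  have I: "finite I" "I \<noteq> {}" using Suc by auto
  have "(LINT x|PiM I (\<lambda>_. half_line). det_on I (kernel s x))
     = (LINT x|PiM I (\<lambda>_. half_line). (\<Sum>m\<in>I. of_bool (\<forall>a\<in>I - {m}. x m < x a) * det_on I (kernel s x)))"
    by (intro Bochner_Integration.integral_cong refl det_on_sum_unique_min I) (simp add: kernel_def)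
  also have "\<dots> = (\<Sum>m\<in>I. LINT x|PiM I (\<lambda>_. half_line). of_bool (\<forall>a\<in>I - {m}. x m < x a) * det_on I (kernel s x))"
    by (intro Bochner_Integration.integral_sum integral_unique_min I)
  also have "\<dots> = (\<Sum>m\<in>I. fact n * jost.picard (Suc n) s)"
  proof (rule sum.cong[OF refl])
    fix m assume m: "m \<in> I"
    have "n = card (I - {m})" "finite (I - {m})" using Suc(2) m I by simp_all
    note IH = Suc(1)[OF this]
    have "(LINT x|PiM I (\<lambda>_. half_line). of_bool (\<forall>a\<in>I - {m}. x m < x a) * det_on I (kernel s x))
       = (LINT t|half_line. fact n * (sine (t - s) * V t * of_bool (s < t) * jost.picard n t))"
      unfolding integral_unique_min(2)[OF I(1) m] IH \<open>n = card (I - {m})\<close>[symmetric] by (simp add: mult_ac)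
    then show "(LINT x|PiM I (\<lambda>_. half_line). of_bool (\<forall>a\<in>I - {m}. x m < x a) * det_on I (kernel s x))
       = fact n * jost.picard (Suc n) s" by simp
  qed
  also have "\<dots> = fact (card I) * jost.picard (card I) s"
    unfolding Suc(2)[symmetric] by (simp add: Suc(2)[symmetric] algebra_simps)
  finally show ?case .
qed

text \<open>The sign \<open>(-1) ^ k\<close> from the minus sign in \<open>K_kernel\<close> cancels
  that of the alternating sum, and endpoint 0 is the original half-line. The determinant is the
  Picard series term by term.\<close>

theorem fredholm_det_eq: "fredholm_det (K_op V z) = jost.solution 0"
proof -
  obtain f g where fg: "\<And>j. f j \<in> L2" "\<And>j. g j \<in> L2"
      "summable (\<lambda>j. L2_norm (f j) * L2_norm (g j))"
      "\<And>h. h \<in> L2 \<Longrightarrow> K_op V z h \<in> L2"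
      "\<And>h. h \<in> L2 \<Longrightarrow> (\<lambda>n. L2_norm (\<lambda>x. K_op V z h x - (\<Sum>j<n. L2_inner h (g j) * f j x))) \<longlonglongrightarrow> 0"
      "\<And>x y. 0 < x \<Longrightarrow> 0 < y \<Longrightarrow> summable (\<lambda>j. cmod (f j x * cnj (g j y)))"
    and K: "\<And>x y. 0 < x \<Longrightarrow> 0 < y \<Longrightarrow> (\<lambda>j. f j x * cnj (g j y)) sums K_kernel V z x y"
    using nuclear_expansion by blast
  have "(-1) ^ k * ext_power_trace (K_op V z) k = jost.picard k 0" for k
  proof -
    have "(LINT x|PiM {..<k} (\<lambda>_. half_line). det_on {..<k} (\<lambda>a b. \<Sum>l. f l (x a) * cnj (g l (x b))))
       = (LINT x|PiM {..<k} (\<lambda>_. half_line). (-1) ^ k * det_on {..<k} (kernel 0 x))"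
    proof (intro Bochner_Integration.integral_cong refl)
      fix x assume "x \<in> space (PiM {..<k} (\<lambda>_. half_line))"
      then have pos: "0 < x a" if "a < k" for a
        using that by (auto simp: space_PiM space_restrict_space)
      have "det_on {..<k} (\<lambda>a b. \<Sum>l. f l (x a) * cnj (g l (x b)))
          = det_on {..<k} (\<lambda>a b. - factor_u V (x a) * (green z (x a) (x b) * factor_v V (x b)))"
        using sums_unique[OF K, symmetric] pos
        by (intro det_on_cong) (auto simp: K_kernel_def mult.assoc)
      also have "\<dots> = (\<Prod>a<k. - factor_u V (x a)) * ((\<Prod>a<k. factor_v V (x a)) * det_on {..<k} (\<lambda>a b. green z (x a) (x b)))"
        by (simp only: det_on_scale_rows det_on_scale_columns)
      \<comment> \<open>Row factors \<open>factor_u\<close> and column factors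
        \<open>factor_v\<close> come out of the determinant separately and recombine to
        \<open>V\<close>.\<close>
      also have "\<dots> = (\<Prod>a<k. - V (x a)) * det_on {..<k} (\<lambda>a b. green z (x a) (x b))"
        by (simp add: factor_u_v flip: prod.distrib mult.assoc)
      also have "\<dots> = (-1) ^ k * ((\<Prod>a<k. V (x a)) * det_on {..<k} (\<lambda>a b. green z (x a) (x b)))"
        by (simp add: prod_uminus)
      also have "(\<Prod>a<k. V (x a)) * det_on {..<k} (\<lambda>a b. green z (x a) (x b)) = det_on {..<k} (\<lambda>a b. V (x a) * green z (x a) (x b))"
        by (simp only: det_on_scale_rows)
      also have "\<dots> = det_on {..<k} (kernel 0 x)"
        using pos by (intro det_on_cong) (auto simp: kernel_def)
      finally show "det_on {..<k} (\<lambda>a b. \<Sum>l. f l (x a) * cnj (g l (x b))) = (-1) ^ k * det_on {..<k} (kernel 0 x)" .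
    qed
    also have "\<dots> = (-1) ^ k * (fact k * jost.picard k 0)"
      using integral_det_kernel[of "{..<k}" 0] by simp
    finally show ?thesis
      using ext_power_trace_nuclear[OF fg, of k] by (simp flip: power_mult_distrib mult.assoc)
  qed
  then show ?thesis
    unfolding fredholm_det_def jost.solution_def by simp
qed

end

theorem theorem4p3:
  fixes V :: "real \<Rightarrow> complex" and z :: complex
  assumes "integrable (lebesgue_on {0<..}) V"
    and "Im (zsqrt z) > 0"
  shows "trace_class (K_op V z) \<and> fredholm_det (K_op V z) = jost_function V z"
proof -
  interpret potential V z using assms by unfold_locales
  have "trace_class (K_op V z)"
    unfolding trace_class_def by (rule nuclear_expansion) blast
  then show ?thesis
    by (simp add: fredholm_det_eq jost_function_eq)
qed

end
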